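(* Let $\phi$ be a Drinfeld $A[\underline{t}_s]$-module over $\mathbb{T}_s$ with $\phi_\theta=\theta+A_1\tau+\dots+A_r\tau^r$, $A_r\in\mathbb{T}_s^\times$, and suppose $\phi$ has a rigid analytic trivialization $\Psi$. Let $V_\phi=\{\mathbf{g}\in\mathrm{Mat}_{1\times r}(\mathbb{T}_s\{z/\theta\}) \mid \mathbf{g}^{(-1)}\Phi=\mathbf{g}\}$, and let $D_0:V_\phi\to\mathbb{T}_s$ send $\mathbf{g}=[g_1,\dots,g_r]$ to $g_1|_{z=\theta}$. Then $D_0$ maps $V_\phi$ bijectively onto $\Lambda_\phi$, and $\Lambda_\phi$ is a free $A[\underline{t}_s]$-module of rank $r$.
   Context: $\mathbb{F}_q$ finite field, $\theta,t_1,\dots,t_s,z$ independent variables, $A[\underline{t}_s]=\mathbb{F}_q[\theta,t_1,\dots,t_s]$, $\mathbb{F}_q[\underline{t}_s]=\mathbb{F}_q[t_1,\dots,t_s]$. $\mathbb{C}_\infty$: completion of an algebraic closure of $\mathbb{F}_q((1/\theta))$, $|\theta|_\infty=q$. $\mathbb{T}_s$: Tate algebra of power series in $t_1,\dots,t_s$ over $\mathbb{C}_\infty$ with coefficients tending to $0$, Gauss norm $\|\cdot\|_\infty$. $\tau$: automorphism raising $\mathbb{C}_\infty$-coefficients to the $q$-th power, $f^{(n)}=\tau^n(f)$ ($n\in\mathbb{Z}$), applied entrywise to matrices and coefficientwise to power series in $z$. $\mathbb{T}_s[\tau]$, $\mathbb{T}_s[[\tau]]$: twisted rings with $\tau f=f^{(1)}\tau$,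 acting by $\sum a_i\tau^i(f)=\sum a_if^{(i)}$. A Drinfeld $A[\underline{t}_s]$-module is an $\mathbb{F}_q[\underline{t}_s]$-algebra homomorphism $\phi:A[\underline{t}_s]\to\mathbb{T}_s[\tau]$ with $\phi_\theta=\theta+A_1\tau+\dots+A_r\tau^r$; $\exp_\phi=\sum\alpha_i\tau^i$ is the unique series with $\alpha_0=1$, $\exp_\phi a=\phi_a\exp_\phi$; it converges on $\mathbb{T}_s$, and $\Lambda_\phi=\ker(\exp_\phi:\mathbb{T}_s\to\mathbb{T}_s)$. $\mathbb{T}_s\{z/\theta\}=\{\sum_{i\ge0}a_iz^i: a_i\in\mathbb{T}_s,\ q^i\|a_i\|_\infty\to0\}$. $\Phi\in\mathrm{Mat}_r(\mathbb{T}_s[z])$ has $i$-th row the $(i+1)$-st standard basis row vector for $1\le i\le r-1$ and last row $\big[(z-\theta)/A_r^{(-r)},-A_1^{(-1)}/A_r^{(-r)},\dots,-A_{r-1}^{(-r+1)}/A_r^{(-r)}\big]$. A rigid analytic trivialization is a $\Psi\in\mathrm{GL}_r(\mathbb{T}_s\{z/\theta\})$ with $\Psi^{(-1)}=\Phi\Psi$. *)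

theory Defs
  imports "HOL-Computational_Algebra.Polynomial"
begin

text \<open>An abstract field 'k with a function nv (the absolute value) plays the role of
C_infinity.  The predicate is_C_infinity characterises C_infinity up to isometric
isomorphism: a complete algebraically closed field of characteristic p, with
nonarchimedean absolute value, containing theta with |theta| = q, in which the elements
algebraic over the closure of F_q(theta) (a copy of F_q((1/theta))) are dense.\<close>

definition abs_val :: "('k::field \<Rightarrow> real) \<Rightarrow> bool" where
  "abs_val nv \<longleftrightarrow> (\<forall>x. nv x \<ge> 0) \<and> (\<forall>x. nv x = 0 \<longleftrightarrow> x = 0)
     \<and> (\<forall>x y. nv (x * y) = nv x * nv y) \<and> (\<forall>x y. nv (x + y) \<le> max (nv x) (nv y))"

definition nv_tendsto :: "('k::field \<Rightarrow> real) \<Rightarrow> (nat \<Rightarrow> 'k) \<Rightarrow> 'k \<Rightarrow> bool" where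
  "nv_tendsto nv X L \<longleftrightarrow> (\<forall>e>0. \<exists>N. \<forall>n\<ge>N. nv (X n - L) < e)"

definition nv_cauchy :: "('k::field \<Rightarrow> real) \<Rightarrow> (nat \<Rightarrow> 'k) \<Rightarrow> bool" where
  "nv_cauchy nv X \<longleftrightarrow> (\<forall>e>0. \<exists>N. \<forall>m\<ge>N. \<forall>n\<ge>N. nv (X m - X n) < e)"

definition nv_complete :: "('k::field \<Rightarrow> real) \<Rightarrow> bool" where
  "nv_complete nv \<longleftrightarrow> (\<forall>X. nv_cauchy nv X \<longrightarrow> (\<exists>L. nv_tendsto nv X L))"

definition Fq :: "nat \<Rightarrow> 'k::field set" where
  "Fq q = {x. x ^ q = x}"

definition Fq_theta_closure :: "nat \<Rightarrow> 'k::field \<Rightarrow> ('k \<Rightarrow> real) \<Rightarrow> 'k set" where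
  "Fq_theta_closure q \<theta> nv = {x. \<forall>e>0. \<exists>P Q. (\<forall>i. coeff P i \<in> Fq q) \<and> (\<forall>i. coeff Q i \<in> Fq q)
      \<and> poly Q \<theta> \<noteq> 0 \<and> nv (x - poly P \<theta> / poly Q \<theta>) < e}"

definition is_C_infinity :: "nat \<Rightarrow> 'k::field \<Rightarrow> ('k \<Rightarrow> real) \<Rightarrow> bool" where
  "is_C_infinity q \<theta> nv \<longleftrightarrow>
     (\<exists>p e. prime p \<and> e \<ge> 1 \<and> q = p ^ e \<and> of_nat p = (0::'k))
     \<and> abs_val nv \<and> nv_complete nv
     \<and> (\<forall>P::'k poly. degree P \<ge> 1 \<longrightarrow> (\<exists>x. poly P x = 0))
     \<and> nv \<theta> = real q
     \<and> (\<forall>x e. e > 0 \<longrightarrow> (\<exists>y P. P \<noteq> 0 \<and> (\<forall>i. coeff P i \<in> Fq_theta_closure q \<theta> nv)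
              \<and> poly P y = 0 \<and> nv (x - y) < e))"

text \<open>Multi-indices for monomials t_1^(m 0) ... t_s^(m (s-1)).\<close>
type_synonym mi = "nat \<Rightarrow> nat"
type_synonym 'k ts = "mi \<Rightarrow> 'k"
type_synonym 'k zs = "nat \<Rightarrow> 'k ts"

definition valid_mi :: "nat \<Rightarrow> mi \<Rightarrow> bool" where
  "valid_mi s m \<longleftrightarrow> (\<forall>i\<ge>s. m i = 0)"

definition tate :: "nat \<Rightarrow> ('k::field \<Rightarrow> real) \<Rightarrow> 'k ts set" where
  "tate s nv = {f. (\<forall>m. \<not> valid_mi s m \<longrightarrow> f m = 0) \<and> (\<forall>e>0. finite {m. nv (f m) \<ge> e})}"

definition gauss :: "('k::field \<Rightarrow> real) \<Rightarrow> 'k ts \<Rightarrow> real" where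
  "gauss nv f = Sup (range (\<lambda>m. nv (f m)))"

definition ts_zero :: "'k::field ts" where "ts_zero = (\<lambda>m. 0)"
definition ts_const :: "'k::field \<Rightarrow> 'k ts" where
  "ts_const c = (\<lambda>m. if m = (\<lambda>_. 0) then c else 0)"
definition ts_one :: "'k::field ts" where "ts_one = ts_const 1"

definition ts_mul :: "'k::field ts \<Rightarrow> 'k ts \<Rightarrow> 'k ts" where
  "ts_mul f g = (\<lambda>m. \<Sum>(a, b) \<in> {(a, b). \<forall>i. a i + b i = m i}. f a * g b)"

definition ts_inv :: "nat \<Rightarrow> ('k::field \<Rightarrow> real) \<Rightarrow> 'k ts \<Rightarrow> 'k ts" where
  "ts_inv s nv f = (THE g. g \<in> tate s nv \<and> ts_mul f g = ts_one)"

definition ts_sums :: "('k::field \<Rightarrow> real) \<Rightarrow> (nat \<Rightarrow> 'k ts) \<Rightarrow> 'k ts \<Rightarrow> bool" where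
  "ts_sums nv X L \<longleftrightarrow> (\<forall>e>0. \<exists>N. \<forall>n\<ge>N. gauss nv (\<lambda>m. (\<Sum>i<n. X i m) - L m) < e)"

definition frob_inv :: "nat \<Rightarrow> 'k::field \<Rightarrow> 'k" where
  "frob_inv q x = (THE y. y ^ q = x)"

definition twist :: "nat \<Rightarrow> int \<Rightarrow> 'k::field \<Rightarrow> 'k" where
  "twist q n x = (if n \<ge> 0 then ((\<lambda>y. y ^ q) ^^ nat n) x else (frob_inv q ^^ nat (- n)) x)"

definition ts_tw :: "nat \<Rightarrow> int \<Rightarrow> 'k::field ts \<Rightarrow> 'k ts" where
  "ts_tw q n f = (\<lambda>m. twist q n (f m))"

definition zs_tw :: "nat \<Rightarrow> int \<Rightarrow> 'k::field zs \<Rightarrow> 'k zs" where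
  "zs_tw q n g = (\<lambda>i. ts_tw q n (g i))"

definition tate_z :: "nat \<Rightarrow> nat \<Rightarrow> ('k::field \<Rightarrow> real) \<Rightarrow> 'k zs set" where
  "tate_z s q nv = {g. (\<forall>i. g i \<in> tate s nv) \<and> (\<lambda>i. real q ^ i * gauss nv (g i)) \<longlonglongrightarrow> 0}"

definition zs_zero :: "'k::field zs" where "zs_zero = (\<lambda>i. ts_zero)"
definition zs_const :: "'k::field ts \<Rightarrow> 'k zs" where
  "zs_const c = (\<lambda>i. if i = 0 then c else ts_zero)"
definition zs_one :: "'k::field zs" where "zs_one = zs_const ts_one"

definition zs_mul :: "'k::field zs \<Rightarrow> 'k zs \<Rightarrow> 'k zs" where
  "zs_mul g h = (\<lambda>n m. \<Sum>i\<le>n. ts_mul (g i) (h (n - i)) m)"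

definition z_minus_theta :: "'k::field \<Rightarrow> 'k zs" where
  "z_minus_theta \<theta> = (\<lambda>i. if i = 0 then ts_const (- \<theta>) else if i = 1 then ts_one else ts_zero)"

definition zs_eval :: "('k::field \<Rightarrow> real) \<Rightarrow> 'k \<Rightarrow> 'k zs \<Rightarrow> 'k ts" where
  "zs_eval nv \<theta> g = (\<lambda>m. THE v. nv_tendsto nv (\<lambda>n. \<Sum>i<n. g i m * \<theta> ^ i) v)"

type_synonym 'k zmat = "nat \<Rightarrow> nat \<Rightarrow> 'k zs"
type_synonym 'k zvec = "nat \<Rightarrow> 'k zs"

definition mat_mul :: "nat \<Rightarrow> 'k::field zmat \<Rightarrow> 'k zmat \<Rightarrow> 'k zmat" where
  "mat_mul r M N = (\<lambda>i j n m. \<Sum>k<r. zs_mul (M i k) (N k j) n m)"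

definition vec_mat :: "nat \<Rightarrow> 'k::field zvec \<Rightarrow> 'k zmat \<Rightarrow> 'k zvec" where
  "vec_mat r g M = (\<lambda>j n m. \<Sum>k<r. zs_mul (g k) (M k j) n m)"

definition mat_tw :: "nat \<Rightarrow> int \<Rightarrow> 'k::field zmat \<Rightarrow> 'k zmat" where
  "mat_tw q n M = (\<lambda>i j. zs_tw q n (M i j))"

definition mat_eq :: "nat \<Rightarrow> 'k::field zmat \<Rightarrow> 'k zmat \<Rightarrow> bool" where
  "mat_eq r M N \<longleftrightarrow> (\<forall>i<r. \<forall>j<r. M i j = N i j)"

definition mat_id :: "'k::field zmat" where
  "mat_id = (\<lambda>i j. if i = j then zs_one else zs_zero)"

definition in_GL :: "nat \<Rightarrow> nat \<Rightarrow> ('k::field \<Rightarrow> real) \<Rightarrow> nat \<Rightarrow> 'k zmat \<Rightarrow> bool" where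
  "in_GL s q nv r M \<longleftrightarrow> (\<forall>i<r. \<forall>j<r. M i j \<in> tate_z s q nv) \<and>
     (\<exists>N. (\<forall>i<r. \<forall>j<r. N i j \<in> tate_z s q nv) \<and>
          mat_eq r (mat_mul r M N) mat_id \<and> mat_eq r (mat_mul r N M) mat_id)"

text \<open>The matrix Phi; A i (1 \<le> i \<le> r) are the coefficients of phi_theta.\<close>
definition Phi_mat :: "nat \<Rightarrow> 'k::field \<Rightarrow> ('k \<Rightarrow> real) \<Rightarrow> nat \<Rightarrow> nat \<Rightarrow> (nat \<Rightarrow> 'k ts) \<Rightarrow> 'k zmat" where
  "Phi_mat q \<theta> nv s r A = (\<lambda>i j.
     (let u = ts_inv s nv (ts_tw q (- int r) (A r)) in
      if i + 1 < r then (if j = i + 1 then zs_one else zs_zero)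
      else if j = 0 then zs_mul (z_minus_theta \<theta>) (zs_const u)
      else zs_const (ts_mul (\<lambda>m. - ts_tw q (- int j) (A j) m) u)))"

definition has_rat :: "nat \<Rightarrow> 'k::field \<Rightarrow> ('k \<Rightarrow> real) \<Rightarrow> nat \<Rightarrow> nat \<Rightarrow> (nat \<Rightarrow> 'k ts) \<Rightarrow> bool" where
  "has_rat q \<theta> nv s r A \<longleftrightarrow> (\<exists>\<Psi>. in_GL s q nv r \<Psi> \<and>
     mat_eq r (mat_tw q (-1) \<Psi>) (mat_mul r (Phi_mat q \<theta> nv s r A) \<Psi>))"

definition V_phi :: "nat \<Rightarrow> 'k::field \<Rightarrow> ('k \<Rightarrow> real) \<Rightarrow> nat \<Rightarrow> nat \<Rightarrow> (nat \<Rightarrow> 'k ts) \<Rightarrow> 'k zvec set" where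
  "V_phi q \<theta> nv s r A = {g. (\<forall>j<r. g j \<in> tate_z s q nv) \<and> (\<forall>j\<ge>r. g j = zs_zero) \<and>
     (\<forall>j<r. vec_mat r (\<lambda>k. zs_tw q (-1) (g k)) (Phi_mat q \<theta> nv s r A) j = g j)}"

text \<open>Twisted power series sum_i a_i tau^i, with product in T_s[[tau]].\<close>
definition tw_mul :: "nat \<Rightarrow> (nat \<Rightarrow> 'k::field ts) \<Rightarrow> (nat \<Rightarrow> 'k ts) \<Rightarrow> (nat \<Rightarrow> 'k ts)" where
  "tw_mul q a b = (\<lambda>n m. \<Sum>i\<le>n. ts_mul (a i) (ts_tw q (int i) (b (n - i))) m)"

definition phi_theta :: "'k::field \<Rightarrow> nat \<Rightarrow> (nat \<Rightarrow> 'k ts) \<Rightarrow> (nat \<Rightarrow> 'k ts)" where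
  "phi_theta \<theta> r A = (\<lambda>i. if i = 0 then ts_const \<theta> else if i \<le> r then A i else ts_zero)"

definition exp_coeffs :: "nat \<Rightarrow> 'k::field \<Rightarrow> ('k \<Rightarrow> real) \<Rightarrow> nat \<Rightarrow> nat \<Rightarrow> (nat \<Rightarrow> 'k ts) \<Rightarrow> (nat \<Rightarrow> 'k ts)" where
  "exp_coeffs q \<theta> nv s r A = (THE \<alpha>. (\<forall>i. \<alpha> i \<in> tate s nv) \<and> \<alpha> 0 = ts_one \<and>
      tw_mul q \<alpha> (\<lambda>i. if i = 0 then ts_const \<theta> else ts_zero) = tw_mul q (phi_theta \<theta> r A) \<alpha>)"

definition Lambda_phi :: "nat \<Rightarrow> 'k::field \<Rightarrow> ('k \<Rightarrow> real) \<Rightarrow> nat \<Rightarrow> nat \<Rightarrow> (nat \<Rightarrow> 'k ts) \<Rightarrow> 'k ts set" where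
  "Lambda_phi q \<theta> nv s r A = {f \<in> tate s nv.
     ts_sums nv (\<lambda>i. ts_mul (exp_coeffs q \<theta> nv s r A i) (ts_tw q (int i) f)) ts_zero}"

definition A_ts :: "nat \<Rightarrow> nat \<Rightarrow> 'k::field \<Rightarrow> 'k ts set" where
  "A_ts q s \<theta> = {f. (\<forall>m. \<not> valid_mi s m \<longrightarrow> f m = 0) \<and> finite {m. f m \<noteq> 0} \<and>
      (\<forall>m. \<exists>P. (\<forall>i. coeff P i \<in> Fq q) \<and> f m = poly P \<theta>)}"

definition free_rank :: "nat \<Rightarrow> nat \<Rightarrow> 'k::field \<Rightarrow> nat \<Rightarrow> 'k ts set \<Rightarrow> bool" where
  "free_rank q s \<theta> r L \<longleftrightarrow> (\<exists>b. (\<forall>i<r. b i \<in> L) \<and>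
     (\<forall>a. (\<forall>i<r. a i \<in> A_ts q s \<theta>) \<longrightarrow> (\<lambda>m. \<Sum>i<r. ts_mul (a i) (b i) m) \<in> L) \<and>
     (\<forall>f\<in>L. \<exists>!a. (\<forall>i<r. a i \<in> A_ts q s \<theta>) \<and> (\<forall>i\<ge>r. a i = ts_zero) \<and>
                 f = (\<lambda>m. \<Sum>i<r. ts_mul (a i) (b i) m)))"

end

theory Submission
  imports Defs "HOL-Computational_Algebra.Formal_Power_Series"
begin

text \<open>Solving \<open>g\<^sup>(\<^sup>-\<^sup>1\<^sup>) \<Phi> = g\<close> column by column expresses all entries of \<open>g\<close> through the single
  series \<open>h = g\<^sub>1 / (z - \<theta>)\<close>, and what remains is \<open>\<phi>\<^sub>\<theta>(h) = z h\<close>: the coefficients satisfy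
  \<open>\<phi>\<^sub>\<theta>(h\<^sub>0) = 0\<close> and \<open>\<phi>\<^sub>\<theta>(h\<^sub>n) = h\<^sub>n\<^sub>-\<^sub>1\<close>. The partial sums of \<open>g\<^sub>1\<close> at \<open>z = \<theta>\<close> telescope to
  \<open>- \<theta>\<^sup>n\<^sup>+\<^sup>1 h\<^sub>n\<close>. With \<open>\<lambda> = D\<^sub>0(g)\<close> the sequence \<open>h\<^sub>n + exp(\<lambda> / \<theta>\<^sup>n\<^sup>+\<^sup>1)\<close> is therefore
  \<open>\<phi>\<^sub>\<theta>\<close>-compatible and decays faster than \<open>\<theta>\<^sup>-\<^sup>n\<close>, which forces it to vanish. So \<open>\<lambda>\<close> determines \<open>h\<close>
  and \<open>exp(\<lambda>) = 0\<close>; conversely \<open>h\<^sub>n = - exp(\<lambda> / \<theta>\<^sup>n\<^sup>+\<^sup>1)\<close> defines a preimage of each period \<open>\<lambda>\<close>.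
  Only the freeness uses the trivialization: \<open>g \<mapsto> g \<Psi>\<close> identifies \<open>V\<^sub>\<phi>\<close> with \<open>r\<close>-tuples of
  Frobenius-fixed series, which are polynomials in \<open>t\<close> and \<open>z\<close> over \<open>F\<^sub>q\<close>, and \<open>D\<^sub>0\<close> turns \<open>z\<close> into \<open>\<theta>\<close>.\<close>

section \<open>Power series in the variables t\<close>

text \<open>No division by \<open>z - \<theta>\<close> takes place: the first column of the equation
  already presents \<open>g\<^sub>1\<close> as \<open>z - \<theta>\<close> times an explicit twist.
  The obstacle is that \<open>h\<close> sits on the boundary of convergence. As
  \<open>\<theta>\<^sup>n\<^sup>+\<^sup>1 h\<^sub>n\<close> tends to \<open>- \<lambda>\<close>, the
  sequence \<open>q^n |h_n|\<close> is bounded but not null unless \<open>\<lambda> = 0\<close>: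
  formally \<open>h\<close> has a pole at \<open>z = \<theta>\<close> with residue
  \<open>\<lambda>\<close>, so \<open>\<lambda>\<close> is a limit and not a value of
  \<open>h\<close>. A positive twist raises coefficients to at least the \<open>q\<close>-th power
  and restores convergence, and the preimage of a period involves positive twists of
  \<open>h\<close> only. About \<open>exp\<close> near 0 only \<open>exp(x) - x = O(|x|^q)\<close>
  is used, about \<open>\<phi>\<^sub>\<theta>\<close> only that small elements grow at most by the
  factor \<open>q\<close>, the critical rate for \<open>o(\<theta>\<^sup>-\<^sup>n)\<close>. The raw
  functions of the definitions do not form a ring, so the argument runs in ring types of
  series.\<close>

definition fin_mi :: "mi \<Rightarrow> bool" where
  "fin_mi m \<longleftrightarrow> finite {i. m i \<noteq> 0}"

text \<open>A type cannot depend on the number \<open>s\<close> of variables. Finite support is a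
  condition free of \<open>s\<close> under which products are finite sums, and it covers the support
  of every element of \<open>tate s nv\<close>.\<close>

lemma valid_mi_imp_fin_mi:
  assumes "valid_mi s m"
  shows "fin_mi m"
proof -
  have "{i. m i \<noteq> 0} \<subseteq> {..<s}"
  proof
    fix i assume "i \<in> {i. m i \<noteq> 0}"
    thus "i \<in> {..<s}"
      using assms by (cases "i < s") (auto simp: valid_mi_def)
  qed
  thus ?thesis
    unfolding fin_mi_def by (rule finite_subset) simp
qed

text \<open>At a multi-index of infinite support the sum in \<open>ts_mul\<close> ranges over an infinite set, so its value
  is the junk value 0; only with coefficients vanishing there is \<open>ts_one\<close> a unit.\<close>

typedef (overloaded) 'k mps = "{f :: mi \<Rightarrow> 'k::field. \<forall>m. \<not> fin_mi m \<longrightarrow> f m = 0}"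
  morphisms mcoeff Mps
  by (rule exI[of _ "\<lambda>_. 0"]) simp

setup_lifting type_definition_mps

lemma mps_eqI:
  assumes "\<And>m. fin_mi m \<Longrightarrow> mcoeff f m = mcoeff g m"
  shows "f = g"
proof -
  have "mcoeff f m = mcoeff g m" for m
    using assms[of m] mcoeff[of f] mcoeff[of g] by (cases "fin_mi m") auto
  thus ?thesis by (simp add: fun_eq_iff flip: mcoeff_inject)
qed

definition mi_splits :: "mi \<Rightarrow> (mi \<times> mi) set" where
  "mi_splits m = {(a, b). \<forall>i. a i + b i = m i}"

lemma fin_mi_add: "\<forall>i. a i + b i = m i \<Longrightarrow> fin_mi m \<longleftrightarrow> fin_mi a \<and> fin_mi b"
proof -
  assume "\<forall>i. a i + b i = m i"
  hence "m = (\<lambda>i. a i + b i)" by auto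
  hence "{i. m i \<noteq> 0} = {i. a i \<noteq> 0} \<union> {i. b i \<noteq> 0}" by auto
  thus ?thesis by (simp add: fin_mi_def)
qed

lemma finite_mi_splits:
  assumes "fin_mi m"
  shows "finite (mi_splits m)"
proof -
  let ?S = "{i. m i \<noteq> 0}"
  \<comment> \<open>Both parts of a splitting of \<open>m\<close> live on the support of
    \<open>m\<close> and are bounded by its largest entry.\<close>
  let ?F = "{f. \<forall>x. (x \<in> ?S \<longrightarrow> f x \<in> {..Max (m ` ?S)}) \<and> (x \<notin> ?S \<longrightarrow> f x = 0)}"
  have fS: "finite ?S" using assms by (simp add: fin_mi_def)
  have "finite ?F" by (rule finite_set_of_finite_funs[OF fS]) simp
  moreover have "mi_splits m \<subseteq> ?F \<times> ?F"
  proof (clarsimp simp: mi_splits_def)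
    fix a b :: mi
    assume s: "\<forall>i. a i + b i = m i"
    have le: "a i \<le> m i" "b i \<le> m i" for i
      using s by (metis le_add1, metis le_add2)
    have M: "m i \<le> Max (m ` {i. 0 < m i})" if "m i > 0" for i
      using fS that by (intro Max_ge) auto
    show "(\<forall>x. (0 < m x \<longrightarrow> a x \<le> Max (m ` {i. 0 < m i})) \<and> (m x = 0 \<longrightarrow> a x = 0)) \<and>
          (\<forall>x. (0 < m x \<longrightarrow> b x \<le> Max (m ` {i. 0 < m i})) \<and> (m x = 0 \<longrightarrow> b x = 0))"
    proof (intro conjI allI impI)
      fix x assume "0 < m x"
      thus "a x \<le> Max (m ` {i. 0 < m i})" "b x \<le> Max (m ` {i. 0 < m i})"
        using le M[of x] order_trans by blast+
    next
      fix x assume "m x = 0"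
      thus "a x = 0" "b x = 0" using le[of x] by simp_all
    qed
  qed
  ultimately show ?thesis by (meson finite_SigmaI finite_subset)
qed

lemma ts_mul_eq: "ts_mul f g m = (\<Sum>(a, b)\<in>mi_splits m. f a * g b)"
  by (simp add: ts_mul_def mi_splits_def)

lemma ts_const_mul:
  assumes "fin_mi m"
  shows "ts_mul (ts_const c) f m = c * f m"
proof -
  have "ts_mul (ts_const c) f m = (\<Sum>(a, b)\<in>{(\<lambda>_. 0, m)}. ts_const c a * f b)"
    unfolding ts_mul_eq
    by (rule sum.mono_neutral_right[OF finite_mi_splits[OF assms]])
       (auto simp: mi_splits_def ts_const_def fun_eq_iff split: if_splits)
  thus ?thesis by (simp add: ts_const_def)
qed

lemma ts_mul_commute: "ts_mul f g = ts_mul g f"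
  by (rule ext, unfold ts_mul_eq, rule sum.reindex_bij_witness[of _ prod.swap prod.swap])
     (auto simp: mi_splits_def add.commute mult.commute)

lemma ts_mul_assoc:
  assumes m: "fin_mi m"
  shows "ts_mul (ts_mul f g) h m = ts_mul f (ts_mul g h) m"
proof -
  have fin: "finite (mi_splits m)" by (rule finite_mi_splits[OF m])
  have f1: "\<forall>x\<in>mi_splits m. finite (mi_splits (fst x))"
    using m by (auto simp: mi_splits_def[of m] fin_mi_add intro!: finite_mi_splits)
  have f2: "\<forall>x\<in>mi_splits m. finite (mi_splits (snd x))"
    using m by (auto simp: mi_splits_def[of m] fin_mi_add intro!: finite_mi_splits)
  have "ts_mul (ts_mul f g) h m
      = (\<Sum>x\<in>mi_splits m. \<Sum>y\<in>mi_splits (fst x). f (fst y) * g (snd y) * h (snd x))"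
    unfolding ts_mul_eq by (simp add: case_prod_beta sum_distrib_right)
  also have "\<dots> = (\<Sum>(x, y)\<in>(SIGMA x:mi_splits m. mi_splits (fst x)). f (fst y) * g (snd y) * h (snd x))"
    by (rule sum.Sigma[OF fin f1])
  also have "\<dots> = (\<Sum>(x, y)\<in>(SIGMA x:mi_splits m. mi_splits (snd x)). f (fst x) * (g (fst y) * h (snd y)))"
    \<comment> \<open>Both sums run over the decompositions of \<open>m\<close> into three summands
      \<open>a\<close>, \<open>b\<close>, \<open>d\<close>; the witnesses only move the
      brackets.\<close>
    by (rule sum.reindex_bij_witness
        [of _ "\<lambda>((a, e), (b, d)). ((\<lambda>i. a i + b i, d), (a, b))"
              "\<lambda>((c, d), (a, b)). ((a, \<lambda>i. b i + d i), (b, d))"])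
       (auto simp: mi_splits_def mult.assoc fun_eq_iff, (metis add.assoc)+)
  also have "\<dots> = (\<Sum>x\<in>mi_splits m. \<Sum>y\<in>mi_splits (snd x). f (fst x) * (g (fst y) * h (snd y)))"
    by (rule sum.Sigma[OF fin f2, symmetric])
  also have "\<dots> = ts_mul f (ts_mul g h) m"
    unfolding ts_mul_eq by (simp add: case_prod_beta sum_distrib_left)
  finally show ?thesis .
qed

instantiation mps :: (field) comm_ring_1
begin

lift_definition zero_mps :: "'a mps" is ts_zero by (simp add: ts_zero_def)
lift_definition one_mps :: "'a mps" is ts_one
  by (auto simp: ts_one_def ts_const_def fin_mi_def)
lift_definition plus_mps :: "'a mps \<Rightarrow> 'a mps \<Rightarrow> 'a mps" is "\<lambda>f g m. f m + g m" by simp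
lift_definition minus_mps :: "'a mps \<Rightarrow> 'a mps \<Rightarrow> 'a mps" is "\<lambda>f g m. f m - g m" by simp
lift_definition uminus_mps :: "'a mps \<Rightarrow> 'a mps" is "\<lambda>f m. - f m" by simp
lift_definition times_mps :: "'a mps \<Rightarrow> 'a mps \<Rightarrow> 'a mps" is ts_mul
  unfolding ts_mul_eq by (intro allI impI sum.neutral) (auto simp: mi_splits_def fin_mi_add)

instance
proof
  fix a b c :: "'a mps"
  show "a * b * c = a * (b * c)"
    by (rule mps_eqI) (simp add: times_mps.rep_eq ts_mul_assoc)
  show "a * b = b * a"
    by transfer (rule ts_mul_commute)
  show "1 * a = a"
    by (rule mps_eqI) (simp add: times_mps.rep_eq one_mps.rep_eq ts_one_def ts_const_mul)
  show "a + b + c = a + (b + c)" "a + b = b + a" "0 + a = a" "- a + a = 0" "a - b = a + - b"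
    by (transfer; simp add: ts_zero_def add_ac)+
  show "(a + b) * c = a * c + b * c"
    by transfer (simp add: ts_mul_eq[abs_def] case_prod_beta distrib_right sum.distrib)
  show "(0::'a mps) \<noteq> 1"
    by transfer (auto simp: ts_zero_def ts_one_def ts_const_def fun_eq_iff)
qed

end

lemma mcoeff_add [simp]: "mcoeff (f + g) m = mcoeff f m + mcoeff g m"
  and mcoeff_diff [simp]: "mcoeff (f - g) m = mcoeff f m - mcoeff g m"
  and mcoeff_minus [simp]: "mcoeff (- f) m = - mcoeff f m"
  and mcoeff_zero [simp]: "mcoeff 0 m = 0"
  by (simp_all add: plus_mps.rep_eq minus_mps.rep_eq uminus_mps.rep_eq zero_mps.rep_eq ts_zero_def)

lemma mcoeff_sum: "mcoeff (sum f S) m = (\<Sum>i\<in>S. mcoeff (f i) m)"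
  by (induction S rule: infinite_finite_induct) auto

lift_definition mconst :: "'k::field \<Rightarrow> 'k mps" is ts_const
  by (auto simp: ts_const_def fin_mi_def)

lemma mcoeff_mconst_mult [simp]: "mcoeff (mconst c * f) m = c * mcoeff f m"
proof (cases "fin_mi m")
  case True
  thus ?thesis by (simp add: times_mps.rep_eq mconst.rep_eq ts_const_mul)
next
  case False
  thus ?thesis using mcoeff[of f] mcoeff[of "mconst c * f"] by simp
qed

lemma mconst_1 [simp]: "mconst 1 = 1"
  by transfer (simp add: ts_one_def)

lemma mconst_0 [simp]: "mconst 0 = 0"
  by transfer (simp add: ts_zero_def ts_const_def)

lemma mconst_mult: "mconst (c * d) = mconst c * mconst d"
  by (rule mps_eqI) (metis (no_types, lifting) mcoeff_mconst_mult mult.assoc mult.right_neutral)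

lemma mconst_diff: "mconst (c - d) = mconst c - mconst d"
  by (rule mps_eqI) (simp add: mconst.rep_eq ts_const_def)

section \<open>Absolute value, twists and the Tate algebra\<close>

text \<open>For arbitrary \<open>q\<close> a twist of 0 may be nonzero (for \<open>q = 0\<close> one
  has \<open>0 ^ q = 1\<close>), so the values at infinite support are reset explicitly. Inside
  \<open>c_infinity\<close> the case distinction disappears, see \<open>mcoeff_tw\<close>.\<close>

lift_definition mtw :: "nat \<Rightarrow> int \<Rightarrow> 'k::field mps \<Rightarrow> 'k mps" is
  "\<lambda>q n f m. if fin_mi m then twist q n (f m) else 0" by simp

definition ztw :: "nat \<Rightarrow> int \<Rightarrow> 'k::field mps fps \<Rightarrow> 'k mps fps" where
  "ztw q n g = Abs_fps (\<lambda>i. mtw q n (fps_nth g i))"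

locale c_infinity =
  fixes q s :: nat and \<theta> :: "'k::field" and nv :: "'k \<Rightarrow> real"
  assumes C_inf: "is_C_infinity q \<theta> nv"
begin

section \<open>The ultrametric absolute value\<close>

lemma nv_nonneg [simp]: "nv x \<ge> 0"
  and nv_eq_0 [simp]: "nv x = 0 \<longleftrightarrow> x = 0"
  and nv_mult: "nv (x * y) = nv x * nv y"
  and nv_add: "nv (x + y) \<le> max (nv x) (nv y)"
  using C_inf unfolding is_C_infinity_def abs_val_def by blast+

lemma nv_theta: "nv \<theta> = real q"
  using C_inf unfolding is_C_infinity_def by blast

lemma nv_0 [simp]: "nv 0 = 0" by simp

lemma nv_1 [simp]: "nv 1 = 1"
  using nv_mult[of 1 1] by simp

lemma nv_minus [simp]: "nv (- x) = nv x"
proof -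
  have "nv (- 1) * nv (- 1) = 1" by (simp flip: nv_mult)
  hence "nv (- 1) = 1"
    using nv_nonneg[of "- 1"] by (metis abs_of_nonneg real_sqrt_abs2 real_sqrt_one)
  thus ?thesis using nv_mult[of "- 1" x] by simp
qed

lemma nv_power: "nv (x ^ n) = nv x ^ n"
  by (induction n) (simp_all add: nv_mult)

lemma nv_diff: "nv (x - y) \<le> max (nv x) (nv y)"
  using nv_add[of x "- y"] by simp

lemma nv_sum_le: "C \<ge> 0 \<Longrightarrow> (\<And>i. i \<in> S \<Longrightarrow> nv (f i) \<le> C) \<Longrightarrow> nv (sum f S) \<le> C"
proof (induction S rule: infinite_finite_induct)
  case (insert x F)
  thus ?case using nv_add[of "f x" "sum f F"] by (auto intro: order_trans)
qed auto

lemma nv_sum_less: "C > 0 \<Longrightarrow> (\<And>i. i \<in> S \<Longrightarrow> nv (f i) < C) \<Longrightarrow> nv (sum f S) < C"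
proof (induction S rule: infinite_finite_induct)
  case (insert x F)
  thus ?case using nv_add[of "f x" "sum f F"] by (auto intro: order_le_less_trans)
qed auto

text \<open>The characteristic divides the given prime and is not 1, hence equals it. In this form
  the additivity of \<open>x ^ q\<close> becomes available.\<close>

lemma q_prime_power: "\<exists>e\<ge>1. prime CHAR('k) \<and> q = CHAR('k) ^ e"
proof -
  obtain p e where p: "prime p" "e \<ge> 1" "q = p ^ e" "of_nat p = (0::'k)"
    using C_inf unfolding is_C_infinity_def by blast
  have "CHAR('k) dvd p" using p(4) by (simp add: of_nat_eq_0_iff_char_dvd)
  moreover have "CHAR('k) \<noteq> 1" by simp
  ultimately have "CHAR('k) = p" using p(1) prime_nat_iff by blast
  thus ?thesis using p by blast
qed

lemma q_ge_2: "q \<ge> 2"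
proof -
  obtain e where e: "e \<ge> 1" "prime CHAR('k)" "q = CHAR('k) ^ e"
    using q_prime_power by blast
  have "CHAR('k) ^ 1 \<le> CHAR('k) ^ e"
    using e prime_ge_1_nat by (intro power_increasing) auto
  thus ?thesis using e prime_ge_2_nat[of "CHAR('k)"] by simp
qed

lemma q_pos [simp]: "q > 0" "q \<noteq> 0" using q_ge_2 by simp_all

lemma theta_neq_0 [simp]: "\<theta> \<noteq> 0"
  using nv_theta q_ge_2 nv_eq_0[of \<theta>] by auto

text \<open>Of two unequal absolute values the larger one is that of the difference. These
  differences are the denominators in the recursion for the exponential, and their size makes it
  converge everywhere.\<close>

lemma nv_theta_frob_diff: "n \<ge> 1 \<Longrightarrow> nv (\<theta> ^ (q ^ n) - \<theta>) = real q ^ (q ^ n)"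
proof -
  assume n: "n \<ge> 1"
  have "q ^ 1 \<le> q ^ n" using n q_ge_2 by (intro power_increasing) auto
  hence "real q ^ 1 < real q ^ (q ^ n)"
    using q_ge_2 by (intro power_strict_increasing) auto
  hence lt: "nv \<theta> < nv (\<theta> ^ (q ^ n))" by (simp add: nv_power nv_theta)
  have "nv (\<theta> ^ (q ^ n)) \<le> max (nv (\<theta> ^ (q ^ n) - \<theta>)) (nv \<theta>)"
    using nv_add[of "\<theta> ^ (q ^ n) - \<theta>" \<theta>] by simp
  moreover have "nv (\<theta> ^ (q ^ n) - \<theta>) \<le> max (nv (\<theta> ^ (q ^ n))) (nv \<theta>)"
    by (rule nv_diff)
  ultimately show ?thesis using lt unfolding nv_power nv_theta by linarith
qed

section \<open>Frobenius and its integral powers\<close>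

lemma frob_add: "(x + y :: 'k) ^ (q ^ n) = x ^ (q ^ n) + y ^ (q ^ n)"
proof -
  obtain e where e: "prime CHAR('k)" "q = CHAR('k) ^ e"
    using q_prime_power by blast
  show ?thesis
    by (rule freshmans_dream'[where n = "e * n"]) (simp_all add: e(1) e(2) power_mult)
qed

lemma frob_inj: "(x::'k) ^ (q ^ n) = y ^ (q ^ n) \<longleftrightarrow> x = y"
proof
  assume "x ^ (q ^ n) = y ^ (q ^ n)"
  hence "(x - y) ^ (q ^ n) = 0"
    using frob_add[of "x - y" y n] by simp
  thus "x = y" by simp
qed simp

lemma frob_inv_power: "frob_inv q (x::'k) ^ q = x"
proof -
  have "q \<le> degree (monom (1::'k) q - [:x:])"
    using q_ge_2 by (intro le_degree) (simp add: coeff_pCons split: nat.split)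
  hence "degree (monom (1::'k) q - [:x:]) \<ge> 1" using q_ge_2 by simp
  hence "\<exists>y. poly (monom (1::'k) q - [:x:]) y = 0"
    using C_inf unfolding is_C_infinity_def by blast
  then obtain y where y: "y ^ q = x" by (auto simp: poly_monom)
  show ?thesis unfolding frob_inv_def
    by (rule theI2[of _ y]) (use y frob_inj[of _ 1 y] in auto)
qed

lemma twist_nat: "twist q (int n) x = (x::'k) ^ (q ^ n)"
proof -
  have "((\<lambda>y. y ^ q) ^^ n) x = x ^ (q ^ n)"
    by (induction n) (simp_all add: power_mult[symmetric] mult.commute)
  thus ?thesis by (simp add: twist_def)
qed

text \<open>Negative twists are awkward iterated definite descriptions. A sufficiently high power of
  Frobenius removes them, and since Frobenius is injective, every identity between twists can be
  checked after applying that power.\<close>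

lemma twist_power:
  assumes "int k + n \<ge> 0"
  shows "twist q n (x::'k) ^ (q ^ k) = x ^ (q ^ nat (int k + n))"
proof (cases "n \<ge> 0")
  case True
  thus ?thesis
    using twist_nat[of "nat n" x] by (simp add: nat_add_distrib power_add mult.commute flip: power_mult)
next
  case False
  define j where "j = nat (- n)"
  have j: "n = - int j" "j \<le> k" "nat (int k + n) = k - j" using False assms by (auto simp: j_def)
  have "((frob_inv q ^^ j) x) ^ (q ^ j) = x"
    by (induction j) (simp_all add: power_mult frob_inv_power)
  hence "twist q n x ^ (q ^ j) = x" using False by (simp add: twist_def j_def)
  hence "(twist q n x ^ (q ^ j)) ^ (q ^ (k - j)) = x ^ (q ^ (k - j))" by simp
  thus ?thesis using j by (simp flip: power_mult power_add)
qed

lemma twist_eqI: "int k + n \<ge> 0 \<Longrightarrow> (y::'k) ^ (q ^ k) = x ^ (q ^ nat (int k + n)) \<Longrightarrow> twist q n x = y"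
  using twist_power[of k n x] frob_inj by metis

lemma twist_twist: "twist q a (twist q b (x::'k)) = twist q (a + b) x"
proof -
  \<comment> \<open>Large enough for \<open>k + a\<close> and \<open>k + a + b\<close> to be
    nonnegative, whatever the signs.\<close>
  define k where "k = nat \<bar>a\<bar> + nat \<bar>b\<bar>"
  have 1: "int k + a \<ge> 0" "int k + (a + b) \<ge> 0" "int (nat (int k + a)) + b \<ge> 0"
    by (auto simp: k_def)
  have "int (nat (int k + a)) + b = int k + (a + b)" using 1 by simp
  hence "twist q a (twist q b x) ^ (q ^ k) = twist q (a + b) x ^ (q ^ k)"
    using twist_power[OF 1(1)] twist_power[OF 1(2)] twist_power[OF 1(3)] by (simp add: add.assoc)
  thus ?thesis by (simp add: frob_inj)
qed

lemma twist_add: "twist q n (x + y) = twist q n x + twist q n (y::'k)"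
  by (rule twist_eqI[of "nat \<bar>n\<bar>"]) (auto simp: frob_add twist_power)

lemma twist_mult: "twist q n (x * y) = twist q n x * twist q n (y::'k)"
  by (rule twist_eqI[of "nat \<bar>n\<bar>"]) (auto simp: power_mult_distrib twist_power)

lemma twist_0 [simp]: "twist q n (0::'k) = 0"
  by (rule twist_eqI[of "nat \<bar>n\<bar>"]) (auto simp: power_0_left)

lemma twist_1 [simp]: "twist q n (1::'k) = 1"
  by (rule twist_eqI[of "nat \<bar>n\<bar>"]) auto

lemma twist_minus: "twist q n (- x::'k) = - twist q n x"
  using twist_add[of n x "- x"] by (simp add: eq_neg_iff_add_eq_0 add.commute)

lemma twist_zero_index [simp]: "twist q 0 x = (x::'k)"
  by (simp add: twist_def)

lemma twist_sum: "twist q n (sum f S) = (\<Sum>i\<in>S. twist q n (f i :: 'k))"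
  by (induction S rule: infinite_finite_induct) (auto simp: twist_add)

lemma nv_twist_nat: "nv (twist q (int n) x) = nv x ^ (q ^ n)"
  by (simp add: twist_nat nv_power)

section \<open>Twists of series in t and in z\<close>

abbreviation tw :: "int \<Rightarrow> 'k mps \<Rightarrow> 'k mps" where "tw \<equiv> mtw q"
abbreviation zt :: "int \<Rightarrow> 'k mps fps \<Rightarrow> 'k mps fps" where "zt \<equiv> ztw q"

lemma mcoeff_tw [simp]: "mcoeff (tw n f) m = twist q n (mcoeff f m)"
  using mcoeff[of f] by (simp add: mtw.rep_eq)

lemma ts_tw_mcoeff: "ts_tw q n (mcoeff f) = mcoeff (tw n f)"
  by (simp add: ts_tw_def fun_eq_iff)

lemma tw_add: "tw n (f + g) = tw n f + tw n g"
  by (rule mps_eqI) (simp add: twist_add)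

lemma tw_minus: "tw n (- f) = - tw n f"
  by (rule mps_eqI) (simp add: twist_minus)

lemma tw_diff: "tw n (f - g) = tw n f - tw n g"
  using tw_add[of n f "- g"] by (simp add: tw_minus)

lemma tw_0 [simp]: "tw n 0 = 0"
  by (rule mps_eqI) simp

lemma tw_mult: "tw n (f * g) = tw n f * tw n g"
  by (rule mps_eqI)
     (simp add: times_mps.rep_eq ts_mul_eq twist_sum case_prod_beta twist_mult)

lemma tw_mconst: "tw n (mconst c) = mconst (twist q n c)"
  by (rule mps_eqI) (simp add: mconst.rep_eq ts_const_def)

lemma tw_1 [simp]: "tw n 1 = 1"
  using tw_mconst[of n 1] by simp

lemma tw_tw: "tw a (tw b f) = tw (a + b) f"
  by (rule mps_eqI) (simp add: twist_twist)

lemma tw_zero_index [simp]: "tw 0 f = f"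
  by (rule mps_eqI) simp

lemma tw_sum: "tw n (sum f S) = (\<Sum>i\<in>S. tw n (f i))"
  by (induction S rule: infinite_finite_induct) (auto simp: tw_add)

lemma zt_nth [simp]: "fps_nth (zt n g) i = tw n (fps_nth g i)"
  by (simp add: ztw_def)

lemma zt_add: "zt n (f + g) = zt n f + zt n g"
  by (rule fps_ext) (simp add: tw_add)

lemma zt_diff: "zt n (f - g) = zt n f - zt n g"
  by (rule fps_ext) (simp add: tw_diff)

lemma zt_0 [simp]: "zt n 0 = 0"
  by (rule fps_ext) simp

lemma zt_1 [simp]: "zt n 1 = 1"
  by (rule fps_ext) (simp add: fps_one_nth)

lemma zt_mult: "zt n (f * g) = zt n f * zt n g"
  by (rule fps_ext) (simp add: fps_mult_nth tw_sum tw_mult)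

lemma zt_sum: "zt n (sum f S) = (\<Sum>i\<in>S. zt n (f i))"
  by (induction S rule: infinite_finite_induct) (auto simp: zt_add)

lemma zt_const: "zt n (fps_const c) = fps_const (tw n c)"
  by (rule fps_ext) simp

lemma zt_zt: "zt a (zt b f) = zt (a + b) f"
  by (rule fps_ext) (simp add: tw_tw)

lemma zt_zero_index [simp]: "zt 0 f = f"
  by (rule fps_ext) simp

section \<open>The Tate algebra and its Gauss norm\<close>

definition T :: "'k mps set" where "T = {f. mcoeff f \<in> tate s nv}"

definition N :: "'k mps \<Rightarrow> real" where "N f = gauss nv (mcoeff f)"

lemma T_iff: "f \<in> T \<longleftrightarrow> (\<forall>m. \<not> valid_mi s m \<longrightarrow> mcoeff f m = 0) \<and>
    (\<forall>e>0. finite {m. e \<le> nv (mcoeff f m)})"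
  by (simp add: T_def tate_def)

lemma tate_mcoeff_obtain:
  assumes "f \<in> tate s nv"
  obtains F where "F \<in> T" "mcoeff F = f"
proof
  show "mcoeff (Mps f) = f"
    using assms by (intro Mps_inverse) (use valid_mi_imp_fin_mi in \<open>auto simp: tate_def\<close>)
  thus "Mps f \<in> T" using assms by (simp add: T_def)
qed

lemma N_le: "(\<And>m. nv (mcoeff f m) \<le> C) \<Longrightarrow> N f \<le> C"
  unfolding N_def gauss_def by (rule cSup_least) auto

text \<open>A real \<open>Sup\<close> says something only about sets bounded above. Here only
  finitely many coefficients reach 1, so a maximum over those bounds them all.\<close>

lemma nv_mcoeff_le_N:
  assumes "f \<in> T"
  shows "nv (mcoeff f m) \<le> N f"
proof -
  let ?S = "{m. 1 \<le> nv (mcoeff f m)}"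
  let ?C = "Max (insert 1 ((\<lambda>m. nv (mcoeff f m)) ` ?S))"
  have fin: "finite ?S" using assms by (simp add: T_iff)
  have "nv (mcoeff f m) \<le> ?C" for m
  proof (cases "m \<in> ?S")
    case True
    thus ?thesis using fin by (intro Max_ge) auto
  next
    case False
    hence "nv (mcoeff f m) \<le> 1" by simp
    also have "1 \<le> ?C" using fin by (intro Max_ge) auto
    finally show ?thesis .
  qed
  hence "bdd_above (range (\<lambda>m. nv (mcoeff f m)))" by (auto intro!: bdd_aboveI)
  thus ?thesis unfolding N_def gauss_def by (rule cSup_upper[rotated]) simp
qed

lemma N_nonneg [simp]: "f \<in> T \<Longrightarrow> N f \<ge> 0"
  using nv_mcoeff_le_N[of f "\<lambda>_. 0"] nv_nonneg order_trans by blast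

lemma N_0 [simp]: "N 0 = 0"
  by (simp add: N_def gauss_def)

lemma N_eq_0: "f \<in> T \<Longrightarrow> N f = 0 \<Longrightarrow> f = 0"
  by (rule mps_eqI) (metis nv_mcoeff_le_N mcoeff_zero nv_eq_0 nv_nonneg order_antisym)

lemma N_minus [simp]: "N (- f) = N f"
  by (simp add: N_def gauss_def)

lemma T_0 [simp]: "0 \<in> T"
  by (simp add: T_iff)

lemma T_mconst [simp]: "mconst c \<in> T"
  unfolding T_iff mconst.rep_eq
proof (intro conjI allI impI)
  fix e :: real assume "e > 0"
  hence "{m. e \<le> nv (ts_const c m)} \<subseteq> {\<lambda>_. 0}"
    by (auto simp: ts_const_def split: if_splits)
  thus "finite {m. e \<le> nv (ts_const c m)}" by (rule finite_subset) simp
qed (auto simp: ts_const_def valid_mi_def)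

lemma T_1 [simp]: "1 \<in> T"
  using T_mconst[of 1] by simp

lemma T_minus: "f \<in> T \<Longrightarrow> - f \<in> T"
  by (simp add: T_iff)

lemma T_add:
  assumes "f \<in> T" "g \<in> T"
  shows "f + g \<in> T"
  unfolding T_iff
proof (intro conjI allI impI)
  fix e :: real assume "e > 0"
  hence "finite ({m. e \<le> nv (mcoeff f m)} \<union> {m. e \<le> nv (mcoeff g m)})"
    using assms by (simp add: T_iff)
  moreover have "{m. e \<le> nv (mcoeff (f + g) m)} \<subseteq> {m. e \<le> nv (mcoeff f m)} \<union> {m. e \<le> nv (mcoeff g m)}"
  proof
    fix m assume "m \<in> {m. e \<le> nv (mcoeff (f + g) m)}"
    thus "m \<in> {m. e \<le> nv (mcoeff f m)} \<union> {m. e \<le> nv (mcoeff g m)}"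
      using nv_add[of "mcoeff f m" "mcoeff g m"] by (auto simp: max_def split: if_splits)
  qed
  ultimately show "finite {m. e \<le> nv (mcoeff (f + g) m)}" by (rule finite_subset[rotated])
qed (use assms in \<open>auto simp: T_iff\<close>)

lemma T_diff: "f \<in> T \<Longrightarrow> g \<in> T \<Longrightarrow> f - g \<in> T"
  using T_add[of f "- g"] by (simp add: T_minus)

lemma T_sum: "(\<And>i. i \<in> S \<Longrightarrow> f i \<in> T) \<Longrightarrow> sum f S \<in> T"
  by (induction S rule: infinite_finite_induct) (auto intro: T_add)

lemma valid_mi_splits:
  assumes "\<not> valid_mi s m" "(a, b) \<in> mi_splits m"
  shows "\<not> valid_mi s a \<or> \<not> valid_mi s b"
proof -
  obtain i where "i \<ge> s" "m i \<noteq> 0" using assms(1) by (auto simp: valid_mi_def)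
  moreover have "a i + b i = m i" using assms(2) by (auto simp: mi_splits_def)
  ultimately show ?thesis unfolding valid_mi_def by force
qed

lemma N_mult_coeff:
  assumes "f \<in> T" "g \<in> T"
  shows "nv (mcoeff f a * mcoeff g b) \<le> N f * N g"
  using assms by (simp add: nv_mult mult_mono nv_mcoeff_le_N)

text \<open>By the strong triangle inequality a coefficient of size \<open>e\<close> in the product
  requires one product of coefficients of size \<open>e\<close>, hence two factors of size at least
  \<open>e / C\<close>. Its index is then a sum of indices from two finite sets.\<close>

lemma T_mult:
  assumes "f \<in> T" "g \<in> T"
  shows "f * g \<in> T"
  unfolding T_iff
proof (intro conjI allI impI)
  fix m assume "\<not> valid_mi s m"
  hence "mcoeff f a * mcoeff g b = 0" if "(a, b) \<in> mi_splits m" for a b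
    using valid_mi_splits[OF _ that] assms by (auto simp: T_iff)
  thus "mcoeff (f * g) m = 0"
    by (auto simp: times_mps.rep_eq ts_mul_eq intro!: sum.neutral)
next
  fix e :: real assume e: "e > 0"
  \<comment> \<open>The summand 1 keeps \<open>C\<close> positive when both norms vanish.\<close>
  define C where "C = 1 + N f + N g"
  have C: "C > 0" "N f \<le> C" "N g \<le> C"
    using N_nonneg[OF assms(1)] N_nonneg[OF assms(2)] by (auto simp: C_def)
  define U where "U = (\<lambda>h. {m. e / C \<le> nv (mcoeff h m)})"
  have "finite (U f)" "finite (U g)"
    using assms e C by (simp_all add: U_def T_iff)
  hence "finite ((\<lambda>(a, b) i. a i + b i) ` (U f \<times> U g))" by blast
  moreover have "{m. e \<le> nv (mcoeff (f * g) m)} \<subseteq> (\<lambda>(a, b) i. a i + b i) ` (U f \<times> U g)"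
  proof
    fix m assume m: "m \<in> {m. e \<le> nv (mcoeff (f * g) m)}"
    have "\<exists>x\<in>mi_splits m. e \<le> nv (mcoeff f (fst x) * mcoeff g (snd x))"
    proof (rule ccontr)
      assume "\<not> ?thesis"
      hence "nv (\<Sum>x\<in>mi_splits m. mcoeff f (fst x) * mcoeff g (snd x)) < e"
        by (intro nv_sum_less e) force
      thus False using m by (simp add: times_mps.rep_eq ts_mul_eq case_prod_beta)
    qed
    then obtain a b where ab: "(a, b) \<in> mi_splits m" "e \<le> nv (mcoeff f a) * nv (mcoeff g b)"
      by (auto simp: nv_mult)
    have "nv (mcoeff f a) * nv (mcoeff g b) \<le> nv (mcoeff f a) * C"
      using nv_mcoeff_le_N[OF assms(2)] C order_trans by (intro mult_left_mono) auto
    hence "a \<in> U f" using ab(2) C by (simp add: U_def divide_le_eq)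
    have "nv (mcoeff f a) * nv (mcoeff g b) \<le> C * nv (mcoeff g b)"
      using nv_mcoeff_le_N[OF assms(1)] C order_trans by (intro mult_right_mono) auto
    hence "b \<in> U g" using ab(2) C by (simp add: U_def divide_le_eq mult.commute)
    have "m = (\<lambda>i. a i + b i)" using ab(1) by (auto simp: mi_splits_def)
    thus "m \<in> (\<lambda>(a, b) i. a i + b i) ` (U f \<times> U g)"
      using \<open>a \<in> U f\<close> \<open>b \<in> U g\<close> by (intro image_eqI[of _ _ "(a, b)"]) auto
  qed
  ultimately show "finite {m. e \<le> nv (mcoeff (f * g) m)}" by (rule finite_subset[rotated])
qed

lemma N_mult_le:
  assumes "f \<in> T" "g \<in> T"
  shows "N (f * g) \<le> N f * N g"
  unfolding times_mps.rep_eq ts_mul_eq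
  by (rule N_le) (unfold times_mps.rep_eq ts_mul_eq, rule nv_sum_le, use assms N_mult_coeff in auto)

lemma N_add_le:
  assumes "f \<in> T" "g \<in> T" "N f \<le> C" "N g \<le> C"
  shows "N (f + g) \<le> C"
proof (rule N_le)
  fix m
  have "nv (mcoeff f m) \<le> C" "nv (mcoeff g m) \<le> C"
    using assms nv_mcoeff_le_N order_trans by blast+
  thus "nv (mcoeff (f + g) m) \<le> C"
    using nv_add[of "mcoeff f m" "mcoeff g m"] by simp
qed

lemma N_diff_le:
  assumes "f \<in> T" "g \<in> T" "N f \<le> C" "N g \<le> C"
  shows "N (f - g) \<le> C"
  using N_add_le[of f "- g" C] assms by (simp add: T_minus)

lemma N_sum_le:
  "C \<ge> 0 \<Longrightarrow> (\<And>i. i \<in> S \<Longrightarrow> f i \<in> T) \<Longrightarrow> (\<And>i. i \<in> S \<Longrightarrow> N (f i) \<le> C) \<Longrightarrow> N (sum f S) \<le> C"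
  by (induction S rule: infinite_finite_induct) (auto intro!: N_add_le T_sum)

lemma N_mconst_mult:
  assumes "f \<in> T"
  shows "N (mconst c * f) = nv c * N f"
proof (rule antisym)
  show le: "N (mconst c * f) \<le> nv c * N f" for c
    by (rule N_le) (simp add: nv_mult mult_left_mono nv_mcoeff_le_N assms)
  show "nv c * N f \<le> N (mconst c * f)"
  proof (cases "c = 0")
    case False
    have "nv c * nv (mcoeff f m) \<le> N (mconst c * f)" for m
      using nv_mcoeff_le_N[OF T_mult[OF T_mconst assms], of c m] by (simp add: nv_mult)
    moreover have "nv c > 0" using False nv_nonneg[of c] nv_eq_0[of c] by linarith
    ultimately have "N f \<le> N (mconst c * f) / nv c"
      by (intro N_le) (simp add: le_divide_eq mult.commute)
    thus ?thesis using \<open>nv c > 0\<close> by (simp add: le_divide_eq mult.commute)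
  qed simp
qed

lemma T_tw:
  assumes "f \<in> T"
  shows "tw n f \<in> T"
  unfolding T_iff
proof (intro conjI allI impI)
  fix e :: real assume e: "e > 0"
  define k where "k = nat \<bar>n\<bar>"
  define Q where "Q = q ^ nat (int k + n)"
  \<comment> \<open>A twist \<open>y\<close> of a coefficient \<open>x\<close> satisfies
    \<open>|y|^(q^k) = |x|^Q\<close>, so \<open>|y| \<ge> e\<close> gives
    \<open>|x|^Q \<ge> d\<close>. The cap 1 excludes \<open>|x| < d\<close>, since then
    \<open>|x|^Q \<le> |x| < d\<close>.\<close>
  define d where "d = min 1 (e ^ (q ^ k))"
  have d: "d > 0" "d \<le> 1" "d \<le> e ^ (q ^ k)" using e by (auto simp: d_def)
  have Q: "Q \<ge> 1" by (simp add: Q_def Suc_leI)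
  have "{m. e \<le> nv (mcoeff (tw n f) m)} \<subseteq> {m. d \<le> nv (mcoeff f m)}"
  proof clarify
    fix m assume "e \<le> nv (mcoeff (tw n f) m)"
    hence "e ^ (q ^ k) \<le> nv (mcoeff (tw n f) m) ^ (q ^ k)"
      using e by (intro power_mono) auto
    also have "\<dots> = nv (mcoeff f m) ^ Q"
      using twist_power[of k n "mcoeff f m"] by (simp add: k_def Q_def flip: nv_power)
    finally have *: "d \<le> nv (mcoeff f m) ^ Q" using d by simp
    show "d \<le> nv (mcoeff f m)"
    proof (rule ccontr)
      assume "\<not> ?thesis"
      hence "nv (mcoeff f m) < d" by simp
      hence "nv (mcoeff f m) ^ Q \<le> nv (mcoeff f m) ^ 1"
        using d Q by (intro power_decreasing) auto
      thus False using * \<open>nv (mcoeff f m) < d\<close> by simp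
    qed
  qed
  moreover have "finite {m. d \<le> nv (mcoeff f m)}" using assms d by (simp add: T_iff)
  ultimately show "finite {m. e \<le> nv (mcoeff (tw n f) m)}" by (rule finite_subset)
qed (use assms in \<open>auto simp: T_iff\<close>)

lemma N_tw_le:
  assumes "f \<in> T"
  shows "N (tw (int n) f) \<le> N f ^ (q ^ n)"
  by (rule N_le) (simp add: nv_twist_nat power_mono nv_mcoeff_le_N assms)

end

section \<open>Convergence and the exponential\<close>

lemma sum_lessThan_diff: "n \<le> k \<Longrightarrow> sum f {..<k} - sum f {..<n} = sum (f :: nat \<Rightarrow> 'a::ab_group_add) {n..<k}"
  using sum.atLeastLessThan_concat[of 0 n k f] by (simp add: lessThan_atLeast0 algebra_simps)

lemma sum_atMost_head: "(\<Sum>j\<le>n. f j) = f 0 + (\<Sum>j\<in>{1..n}. f j)" for f :: "nat \<Rightarrow> 'a::comm_monoid_add"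
  by (simp add: atMost_atLeast0 sum.atLeast_Suc_atMost)

context c_infinity
begin

section \<open>Limits in the Gauss norm\<close>

definition tends :: "(nat \<Rightarrow> 'k mps) \<Rightarrow> 'k mps \<Rightarrow> bool" where
  "tends X L \<longleftrightarrow> (\<lambda>n. N (X n - L)) \<longlonglongrightarrow> 0"

lemma tends_iff:
  assumes "\<And>n. X n \<in> T" "L \<in> T"
  shows "tends X L \<longleftrightarrow> (\<forall>e>0. \<exists>n0. \<forall>n\<ge>n0. N (X n - L) < e)"
  unfolding tends_def LIMSEQ_iff using assms by (simp add: T_diff)

lemma tends_squeeze:
  assumes "\<And>n. N (Y n - K) \<le> f n" "f \<longlonglongrightarrow> 0" "\<And>n. Y n \<in> T" "K \<in> T"
  shows "tends Y K"
  unfolding tends_def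
  by (rule tendsto_sandwich[OF _ _ tendsto_const assms(2)]) (use assms in \<open>auto simp: T_diff\<close>)

lemma tends_const: "tends (\<lambda>_. L) L"
  by (simp add: tends_def)

text \<open>Balls are closed without any loss of epsilon: a limit of norm above \<open>C\<close>
  would eventually be closer to \<open>X n\<close> than its own norm, and
  \<open>L = X n - (X n - L)\<close> would be too small.\<close>

lemma tends_bound:
  assumes "tends X L" "\<And>n. X n \<in> T" "L \<in> T" "\<And>n. n \<ge> n0 \<Longrightarrow> N (X n) \<le> C"
  shows "N L \<le> C"
proof (rule ccontr)
  assume "\<not> N L \<le> C"
  hence "C < N L" by simp
  have "N L > 0"
    using \<open>C < N L\<close> assms(4)[of n0] N_nonneg[OF assms(2)[of n0]] by simp
  then obtain n1 where n1: "\<And>n. n \<ge> n1 \<Longrightarrow> N (X n - L) < N L"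
    using assms(1) tends_iff[of X L] assms(2,3) by meson
  define n where "n = max n0 n1"
  have "N (X n - (X n - L)) \<le> max C (N (X n - L))"
    by (rule N_diff_le) (use assms(2,3) assms(4)[of n] in \<open>auto simp: n_def T_diff le_max_iff_disj\<close>)
  thus False using n1[of n] \<open>C < N L\<close> by (auto simp: n_def)
qed

lemma tends_add:
  assumes "tends X L" "tends Y K" "\<And>n. X n \<in> T" "L \<in> T" "\<And>n. Y n \<in> T" "K \<in> T"
  shows "tends (\<lambda>n. X n + Y n) (L + K)"
proof (rule tends_squeeze)
  show "(\<lambda>n. N (X n - L) + N (Y n - K)) \<longlonglongrightarrow> 0"
    using tendsto_add[OF assms(1,2)[unfolded tends_def]] by simp
  fix n
  have "N ((X n - L) + (Y n - K)) \<le> N (X n - L) + N (Y n - K)"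
    by (rule N_add_le) (use assms in \<open>auto simp: T_diff\<close>)
  thus "N (X n + Y n - (L + K)) \<le> N (X n - L) + N (Y n - K)"
    by (simp add: algebra_simps)
qed (use assms in \<open>auto intro: T_add\<close>)

lemma tends_mult:
  assumes "tends X L" "c \<in> T" "\<And>n. X n \<in> T" "L \<in> T"
  shows "tends (\<lambda>n. c * X n) (c * L)"
proof (rule tends_squeeze)
  show "(\<lambda>n. N c * N (X n - L)) \<longlonglongrightarrow> 0"
    using tendsto_mult[OF tendsto_const assms(1)[unfolded tends_def]] by simp
  show "N (c * X n - c * L) \<le> N c * N (X n - L)" for n
    using N_mult_le[of c "X n - L"] assms by (simp add: T_diff right_diff_distrib)
qed (use assms in \<open>auto intro: T_mult\<close>)

lemma tends_minus:
  assumes "tends X L"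
  shows "tends (\<lambda>n. - X n) (- L)"
proof -
  have "N (- X n - - L) = N (X n - L)" for n
    using N_minus[of "X n - L"] by simp
  thus ?thesis using assms unfolding tends_def by simp
qed

lemma tends_tw:
  assumes "tends X L" "\<And>n. X n \<in> T" "L \<in> T"
  shows "tends (\<lambda>n. tw (int k) (X n)) (tw (int k) L)"
proof (rule tends_squeeze)
  show "(\<lambda>n. N (X n - L) ^ (q ^ k)) \<longlonglongrightarrow> 0"
    using tendsto_power[OF assms(1)[unfolded tends_def], of "q ^ k"] by (simp add: power_0_left)
  show "N (tw (int k) (X n) - tw (int k) L) \<le> N (X n - L) ^ (q ^ k)" for n
    using N_tw_le[of "X n - L" k] assms by (simp add: T_diff tw_diff)
qed (use assms in \<open>auto intro: T_tw\<close>)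

lemma tends_sum:
  assumes "finite S" "\<And>j. j \<in> S \<Longrightarrow> tends (X j) (L j)" "\<And>j n. j \<in> S \<Longrightarrow> X j n \<in> T"
    "\<And>j. j \<in> S \<Longrightarrow> L j \<in> T"
  shows "tends (\<lambda>n. \<Sum>j\<in>S. X j n) (\<Sum>j\<in>S. L j)"
  using assms
proof (induction S rule: finite_induct)
  case empty
  show ?case using tends_const[of 0] by simp
next
  case (insert x F)
  have "tends (\<lambda>n. X x n + (\<Sum>j\<in>F. X j n)) (L x + (\<Sum>j\<in>F. L j))"
    by (rule tends_add) (use insert in \<open>auto intro: T_sum\<close>)
  thus ?case using insert by simp
qed

lemma tends_unique:
  assumes "tends X L" "tends X K" "\<And>n. X n \<in> T" "L \<in> T" "K \<in> T"
  shows "L = K"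
proof -
  have "tends (\<lambda>n. X n + - X n) (L + - K)"
    by (intro tends_add tends_minus) (use assms in \<open>auto intro: T_minus\<close>)
  hence "tends (\<lambda>_. 0) (L - K)" by simp
  hence "N (L - K) \<le> 0"
    by (rule tends_bound[of _ _ 0]) (use assms in \<open>auto intro: T_diff\<close>)
  moreover have "N (L - K) \<ge> 0" using assms by (simp add: T_diff)
  ultimately have "N (L - K) = 0" by simp
  thus ?thesis using N_eq_0[of "L - K"] assms by (simp add: T_diff)
qed

text \<open>The subtraction truncates at 0, which affects finitely many indices only.\<close>

lemma tends_offset:
  assumes "tends X L"
  shows "tends (\<lambda>n. X (n - k)) L"
  unfolding tends_def
  using filterlim_compose[OF assms[unfolded tends_def] filterlim_minus_const_nat_at_top[of k]]
  by simp

section \<open>Completeness and convergence of series\<close>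

lemma nv_tendsto_bound:
  assumes "nv_tendsto nv S L" "\<And>k. k \<ge> n \<Longrightarrow> nv (S k - y) \<le> C"
  shows "nv (L - y) \<le> C"
proof (rule ccontr)
  assume "\<not> nv (L - y) \<le> C"
  hence C: "C < nv (L - y)" by simp
  have "nv (L - y) > 0" using C assms(2)[of n] nv_nonneg[of "S n - y"] by linarith
  then obtain n1 where n1: "\<And>k. k \<ge> n1 \<Longrightarrow> nv (S k - L) < nv (L - y)"
    using assms(1) unfolding nv_tendsto_def by meson
  define k where "k = max n n1"
  have "nv (S k - y - (S k - L)) \<le> max (nv (S k - y)) (nv (S k - L))" by (rule nv_diff)
  thus False using n1[of k] assms(2)[of k] C by (auto simp: k_def max_def split: if_splits)
qed

lemma nv_tendsto_unique:
  assumes "nv_tendsto nv S L" "nv_tendsto nv S L'"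
  shows "L = L'"
proof (rule ccontr)
  assume "L \<noteq> L'"
  hence "nv (L - L') > 0" using nv_nonneg[of "L - L'"] nv_eq_0[of "L - L'"] by (simp add: less_le)
  then obtain n where n: "\<And>k. k \<ge> n \<Longrightarrow> nv (S k - L') < nv (L - L')"
    using assms(2) unfolding nv_tendsto_def by meson
  obtain n' where n': "\<And>k. k \<ge> n' \<Longrightarrow> nv (S k - L) < nv (L - L')"
    using assms(1) \<open>nv (L - L') > 0\<close> unfolding nv_tendsto_def by meson
  define k where "k = max n n'"
  have "nv (S k - L' - (S k - L)) \<le> max (nv (S k - L')) (nv (S k - L))" by (rule nv_diff)
  thus False using n[of k] n'[of k] by (auto simp: k_def max_def split: if_splits)
qed

lemma nv_series_converges:
  assumes "(\<lambda>i. nv (x i)) \<longlonglongrightarrow> 0"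
  shows "\<exists>L. nv_tendsto nv (\<lambda>n. \<Sum>i<n. x i) L"
proof -
  have "nv_cauchy nv (\<lambda>n. \<Sum>i<n. x i)"
    unfolding nv_cauchy_def
  proof (intro allI impI)
    fix e :: real assume e: "e > 0"
    then obtain n0 where n0: "\<And>i. i \<ge> n0 \<Longrightarrow> nv (x i) < e"
      using assms unfolding LIMSEQ_iff by auto
    have *: "nv ((\<Sum>i<k. x i) - (\<Sum>i<n. x i)) < e" if "n0 \<le> n" "n \<le> k" for n k
      using that e n0 by (subst sum_lessThan_diff) (auto intro!: nv_sum_less)
    have "nv ((\<Sum>i<k. x i) - (\<Sum>i<n. x i)) < e" if "n0 \<le> n" "n0 \<le> k" for n k
    proof (cases "n \<le> k")
      case False
      have "nv ((\<Sum>i<k. x i) - (\<Sum>i<n. x i)) = nv (- ((\<Sum>i<n. x i) - (\<Sum>i<k. x i)))"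
        by simp
      also have "\<dots> < e" unfolding nv_minus using False that by (intro *) auto
      finally show ?thesis .
    qed (use that * in blast)
    thus "\<exists>N. \<forall>m\<ge>N. \<forall>n\<ge>N. nv ((\<Sum>i<m. x i) - (\<Sum>i<n. x i)) < e" by blast
  qed
  thus ?thesis using C_inf unfolding is_C_infinity_def nv_complete_def by blast
qed

text \<open>Completeness is given for the field only. The limit is taken coefficient by coefficient,
  and the ultrametric tail estimate, uniform in \<open>m\<close>, turns this into convergence in the
  Gauss norm. The coefficientwise limits stay in the conclusion because \<open>zs_eval\<close> is
  defined through them.\<close>

lemma series_converges:
  assumes X: "\<And>i. X i \<in> T" and lim: "(\<lambda>i. N (X i)) \<longlonglongrightarrow> 0"
  obtains L where "L \<in> T" "tends (\<lambda>n. \<Sum>i<n. X i) L"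
    "\<And>m. nv_tendsto nv (\<lambda>n. \<Sum>i<n. mcoeff (X i) m) (mcoeff L m)"
proof -
  have "(\<lambda>i. nv (mcoeff (X i) m)) \<longlonglongrightarrow> 0" for m
    by (rule tendsto_sandwich[OF _ _ tendsto_const lim]) (simp_all add: X nv_mcoeff_le_N)
  hence "\<exists>l. nv_tendsto nv (\<lambda>n. \<Sum>i<n. mcoeff (X i) m) l" for m
    by (rule nv_series_converges)
  then obtain l where l: "\<And>m. nv_tendsto nv (\<lambda>n. \<Sum>i<n. mcoeff (X i) m) (l m)" by metis
  have tail: "nv (l m - (\<Sum>i<n. mcoeff (X i) m)) \<le> C"
    if "C \<ge> 0" "\<And>i. i \<ge> n \<Longrightarrow> N (X i) \<le> C" for C n m
  proof (rule nv_tendsto_bound[OF l])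
    fix k assume "n \<le> k"
    have "nv (mcoeff (X i) m) \<le> C" if "i \<ge> n" for i
      using that \<open>\<And>i. i \<ge> n \<Longrightarrow> N (X i) \<le> C\<close> nv_mcoeff_le_N[OF X] order_trans by blast
    thus "nv ((\<Sum>i<k. mcoeff (X i) m) - (\<Sum>i<n. mcoeff (X i) m)) \<le> C"
      using \<open>n \<le> k\<close> \<open>C \<ge> 0\<close> by (subst sum_lessThan_diff) (auto intro!: nv_sum_le)
  qed
  have small: "\<exists>n0. \<forall>i\<ge>n0. N (X i) \<le> e" if "e > 0" for e
    using lim that X unfolding LIMSEQ_iff by (fastforce intro: less_imp_le)
  have "l \<in> tate s nv"
    unfolding tate_def mem_Collect_eq
  proof (intro conjI allI impI)
    fix m assume "\<not> valid_mi s m"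
    hence "mcoeff (X i) m = 0" for i using X[of i] by (simp add: T_iff)
    hence "nv (l m - 0) \<le> 0" by (intro nv_tendsto_bound[OF l, of 0]) simp
    thus "l m = 0" using nv_nonneg[of "l m"] nv_eq_0[of "l m"] by (simp del: nv_nonneg nv_eq_0)
  next
    fix e :: real assume e: "e > 0"
    then obtain n where n: "\<And>i. i \<ge> n \<Longrightarrow> N (X i) \<le> e / 2" using small[of "e / 2"] by auto
    have "(\<Sum>i<n. X i) \<in> T" using X by (rule T_sum)
    hence "finite {m. e \<le> nv (mcoeff (\<Sum>i<n. X i) m)}" using e by (simp add: T_iff)
    \<comment> \<open>With a tail of size at most \<open>e / 2\<close>, a limit coefficient of size
      \<open>e\<close> must already be that large in the partial sum.\<close>
    moreover have "{m. e \<le> nv (l m)} \<subseteq> {m. e \<le> nv (mcoeff (\<Sum>i<n. X i) m)}"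
    proof clarify
      fix m assume "e \<le> nv (l m)"
      moreover have "nv (l m) \<le> max (nv (l m - (\<Sum>i<n. mcoeff (X i) m))) (nv (\<Sum>i<n. mcoeff (X i) m))"
        using nv_add[of "l m - (\<Sum>i<n. mcoeff (X i) m)" "\<Sum>i<n. mcoeff (X i) m"] by simp
      moreover have "nv (l m - (\<Sum>i<n. mcoeff (X i) m)) \<le> e / 2"
        using e n by (intro tail) auto
      ultimately show "e \<le> nv (mcoeff (\<Sum>i<n. X i) m)"
        using e by (auto simp: mcoeff_sum max_def split: if_splits)
    qed
    ultimately show "finite {m. e \<le> nv (l m)}" by (rule finite_subset[rotated])
  qed
  then obtain L where L: "L \<in> T" "mcoeff L = l" by (rule tate_mcoeff_obtain)
  have "tends (\<lambda>n. \<Sum>i<n. X i) L"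
  proof (subst tends_iff)
    show "\<forall>e>0. \<exists>n0. \<forall>n\<ge>n0. N ((\<Sum>i<n. X i) - L) < e"
    proof (intro allI impI)
      fix e :: real assume e: "e > 0"
      then obtain n0 where n0: "\<And>i. i \<ge> n0 \<Longrightarrow> N (X i) \<le> e / 2" using small[of "e / 2"] by auto
      have "nv (l m - (\<Sum>i<n. mcoeff (X i) m)) \<le> e / 2" if "n \<ge> n0" for n m
        by (rule tail) (use that e n0 in auto)
      hence "N (L - (\<Sum>i<n. X i)) \<le> e / 2" if "n \<ge> n0" for n
        using that by (intro N_le) (simp add: mcoeff_sum L(2))
      hence "N ((\<Sum>i<n. X i) - L) \<le> e / 2" if "n \<ge> n0" for n
        using that N_minus[of "L - (\<Sum>i<n. X i)"] by simp
      thus "\<exists>n0. \<forall>n\<ge>n0. N ((\<Sum>i<n. X i) - L) < e"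
        using e by (metis field_sum_of_halves less_add_same_cancel1 half_gt_zero order_le_less_trans)
    qed
  qed (auto intro: T_sum X L)
  thus thesis using that L l by metis
qed

end

locale drinfeld = c_infinity q s \<theta> nv
  for q s :: nat and \<theta> :: "'k::field" and nv :: "'k \<Rightarrow> real" +
  fixes r :: nat and A :: "nat \<Rightarrow> 'k mps" and B :: "'k mps"
  assumes r_pos: "1 \<le> r" and A_T: "\<And>i. i \<in> {1..r} \<Longrightarrow> A i \<in> T"
    and B_T: "B \<in> T" and A_B: "A r * B = 1"
begin

section \<open>Coefficients and convergence of the exponential\<close>

definition P :: "nat \<Rightarrow> 'k mps" where
  "P j = (if j = 0 then mconst \<theta> else if j \<le> r then A j else 0)"

lemma P_T [simp]: "P j \<in> T"
  using A_T by (simp add: P_def)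

text \<open>Comparing the coefficients of \<open>\<tau>^n\<close> in
  \<open>exp \<theta> = \<phi>_\<theta> exp\<close> gives \<open>exp_coeff_rec\<close>; the term
  \<open>j = 0\<close> is \<open>\<theta>\<close> times the unknown coefficient, and moving it to
  the other side leaves the factor \<open>\<theta> ^ (q ^ n) - \<theta>\<close>.\<close>

function exp_coeff :: "nat \<Rightarrow> 'k mps" where
  "exp_coeff n = (if n = 0 then 1 else
     mconst (1 / (\<theta> ^ (q ^ n) - \<theta>)) * (\<Sum>j\<in>{1..n}. P j * tw (int j) (exp_coeff (n - j))))"
  by auto
termination by (relation "measure id") auto

declare exp_coeff.simps [simp del]

lemma exp_coeff_0: "exp_coeff 0 = 1"
  by (simp add: exp_coeff.simps)

lemma exp_coeff_T [simp]: "exp_coeff n \<in> T"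
proof (induction n rule: less_induct)
  case (less n)
  thus ?case by (subst exp_coeff.simps) (auto intro!: T_mult T_sum T_tw)
qed

lemma theta_frob_neq: "n \<noteq> 0 \<Longrightarrow> \<theta> ^ (q ^ n) - \<theta> \<noteq> 0"
  using nv_theta_frob_diff[of n] nv_eq_0[of "\<theta> ^ (q ^ n) - \<theta>"] by auto

lemma exp_coeff_rec: "mconst (\<theta> ^ (q ^ n)) * exp_coeff n = (\<Sum>j\<le>n. P j * tw (int j) (exp_coeff (n - j)))"
proof (cases "n = 0")
  case False
  let ?d = "\<theta> ^ (q ^ n) - \<theta>"
  have "mconst ?d * exp_coeff n = mconst (?d * (1 / ?d)) * (\<Sum>j\<in>{1..n}. P j * tw (int j) (exp_coeff (n - j)))"
    using False by (subst exp_coeff.simps) (simp only: mconst_mult mult.assoc if_False)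
  hence "mconst ?d * exp_coeff n = (\<Sum>j\<in>{1..n}. P j * tw (int j) (exp_coeff (n - j)))"
    using theta_frob_neq[OF False] by simp
  thus ?thesis by (simp add: sum_atMost_head mconst_diff P_def[of 0] algebra_simps)
qed (simp add: P_def)

lemma exp_coeff_unique:
  assumes "a 0 = 1" "\<And>n. mconst (\<theta> ^ (q ^ n)) * a n = (\<Sum>j\<le>n. P j * tw (int j) (a (n - j)))"
  shows "a = exp_coeff"
proof
  fix n show "a n = exp_coeff n"
  proof (induction n rule: less_induct)
    case (less n)
    show ?case
    proof (cases "n = 0")
      case False
      let ?d = "\<theta> ^ (q ^ n) - \<theta>"
      have "mconst ?d * b n = (\<Sum>j\<in>{1..n}. P j * tw (int j) (b (n - j)))"
        if "mconst (\<theta> ^ (q ^ n)) * b n = (\<Sum>j\<le>n. P j * tw (int j) (b (n - j)))" for b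
        using that by (simp add: sum_atMost_head mconst_diff P_def[of 0] algebra_simps)
      note this[OF assms(2)] this[OF exp_coeff_rec]
      moreover have "(\<Sum>j\<in>{1..n}. P j * tw (int j) (a (n - j))) = (\<Sum>j\<in>{1..n}. P j * tw (int j) (exp_coeff (n - j)))"
        using less.IH by (intro sum.cong) auto
      ultimately have "mconst ?d * a n = mconst ?d * exp_coeff n" by simp
      hence "mconst (1 / ?d) * (mconst ?d * a n) = mconst (1 / ?d) * (mconst ?d * exp_coeff n)" by simp
      thus ?thesis using theta_frob_neq[OF False] by (simp flip: mconst_mult mult.assoc)
    qed (simp add: assms(1) exp_coeff_0)
  qed
qed

text \<open>The constant \<open>c\<close> only has to satisfy \<open>1 < c ^ r * q\<close>; since \<open>q \<ge> 2\<close>,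
  Bernoulli's inequality allows \<open>c = 1 - 1 / (4 * r)\<close>.\<close>

lemma exp_coeff_bound:
  obtains C c :: real where "C \<ge> 1" "0 < c" "c < 1" "\<And>n. N (exp_coeff n) \<le> (C * c ^ n) ^ (q ^ n)"
proof -
  define c :: real where "c = 1 - 1 / (4 * r)"
  have c: "0 < c" "c < 1" using r_pos by (simp_all add: c_def field_simps)
  have "1 + real r * (- 1 / (4 * r)) \<le> (1 + - 1 / (4 * r)) ^ r"
    using r_pos by (intro Bernoulli_inequality) (simp add: field_simps)
  hence cr: "3 / 4 \<le> c ^ r" using r_pos by (simp add: c_def)
  have cj: "1 \<le> 4 / 3 * c ^ j" if "j \<le> r" for j
  proof -
    have "c ^ r \<le> c ^ j" using c that by (intro power_decreasing) auto
    thus ?thesis using cr by simp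
  qed
  define M where "M = Max (insert 1 (N ` P ` {..r}))"
  have M1: "M \<ge> 1" unfolding M_def by (intro Max_ge) auto
  have M: "N (P j) \<le> M" for j
  proof (cases "j \<le> r")
    case True
    thus ?thesis unfolding M_def by (intro Max_ge) auto
  qed (use M1 in \<open>simp add: P_def\<close>)
  \<comment> \<open>Replacing \<open>c ^ (n - j)\<close> by \<open>c ^ n\<close> costs at most
    \<open>4 / 3\<close>, while the denominator gains \<open>q \<ge> 2\<close>. The ratio is at most
    \<open>2 / 3\<close>, and its power with exponent \<open>q ^ n\<close> absorbs the bound
    \<open>M\<close> of the coefficients of \<open>\<phi>_\<theta>\<close>.\<close>
  have "(\<lambda>n. M * (2 / 3) ^ n) \<longlonglongrightarrow> M * 0"
    by (intro tendsto_mult tendsto_const LIMSEQ_realpow_zero) auto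
  hence "eventually (\<lambda>n. M * (2 / 3) ^ n < 1) sequentially"
    by (rule order_tendstoD) simp
  then obtain n0 where n0: "\<And>n. n \<ge> n0 \<Longrightarrow> M * (2 / 3) ^ n < 1"
    unfolding eventually_sequentially by blast
  \<comment> \<open>Chosen so that the finitely many cases \<open>n \<le> n0\<close>, where the
    absorption of \<open>M\<close> may fail, hold outright.\<close>
  define C where "C = Max (insert 1 ((\<lambda>n. N (exp_coeff n) / c ^ (n * q ^ n)) ` {..n0}))"
  have C1: "C \<ge> 1" unfolding C_def by (intro Max_ge) auto
  have C_small: "N (exp_coeff n) \<le> (C * c ^ n) ^ (q ^ n)" if "n \<le> n0" for n
  proof -
    have "N (exp_coeff n) / c ^ (n * q ^ n) \<le> C" unfolding C_def using that by (intro Max_ge) auto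
    also have "C ^ 1 \<le> C ^ (q ^ n)" using C1 by (intro power_increasing) (auto simp: Suc_leI)
    hence "C \<le> C ^ (q ^ n)" by simp
    finally show ?thesis using c by (simp add: divide_le_eq power_mult_distrib power_mult)
  qed
  have "N (exp_coeff n) \<le> (C * c ^ n) ^ (q ^ n)" for n
  proof (induction n rule: less_induct)
    case (less n)
    show ?case
    proof (cases "n \<le> n0")
      case False
      define D where "D = M * ((4 / 3) * (C * c ^ n)) ^ (q ^ n)"
      have D0: "D \<ge> 0" using M1 C1 c by (simp add: D_def)
      have "N (P j * tw (int j) (exp_coeff (n - j))) \<le> D" if j: "j \<in> {1..n}" for j
      proof (cases "j \<le> r")
        case True
        have "N (tw (int j) (exp_coeff (n - j))) \<le> N (exp_coeff (n - j)) ^ (q ^ j)" by (rule N_tw_le) simp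
        also have "\<dots> \<le> ((C * c ^ (n - j)) ^ (q ^ (n - j))) ^ (q ^ j)"
          using less.IH[of "n - j"] j by (intro power_mono) auto
        \<comment> \<open>Twisting by \<open>j\<close> turns the exponent \<open>q ^ (n - j)\<close>
          into \<open>q ^ n\<close>: the bound has this shape in order to be stable under the
          recursion.\<close>
        also have "\<dots> = (C * c ^ (n - j)) ^ (q ^ n)"
          using j by (simp flip: power_mult power_add)
        also have "\<dots> \<le> ((4 / 3) * (C * c ^ n)) ^ (q ^ n)"
        proof (rule power_mono)
          have "C * c ^ (n - j) * 1 \<le> C * c ^ (n - j) * (4 / 3 * c ^ j)"
            using cj[OF True] C1 c by (intro mult_left_mono) auto
          also have "\<dots> = (4 / 3) * (C * c ^ n)"
            using j by (simp flip: power_add)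
          finally show "C * c ^ (n - j) \<le> (4 / 3) * (C * c ^ n)" by simp
        qed (use C1 c in auto)
        finally have "N (tw (int j) (exp_coeff (n - j))) \<le> ((4 / 3) * (C * c ^ n)) ^ (q ^ n)" .
        hence "N (P j) * N (tw (int j) (exp_coeff (n - j))) \<le> D"
          unfolding D_def using M[of j] M1 by (intro mult_mono) (auto simp: T_tw)
        thus ?thesis using N_mult_le[of "P j" "tw (int j) (exp_coeff (n - j))"] by (simp add: T_tw)
      qed (use D0 j in \<open>simp add: P_def\<close>)
      hence sum: "N (\<Sum>j\<in>{1..n}. P j * tw (int j) (exp_coeff (n - j))) \<le> D"
        using D0 by (intro N_sum_le) (auto intro!: T_mult T_tw)
      have qn: "real q ^ (q ^ n) > 0" by simp
      have "N (exp_coeff n) = nv (1 / (\<theta> ^ (q ^ n) - \<theta>)) * N (\<Sum>j\<in>{1..n}. P j * tw (int j) (exp_coeff (n - j)))"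
        using False by (subst exp_coeff.simps) (simp add: N_mconst_mult T_sum T_mult T_tw)
      also have "nv (1 / (\<theta> ^ (q ^ n) - \<theta>)) = 1 / real q ^ (q ^ n)"
      proof -
        have "nv (1 / (\<theta> ^ (q ^ n) - \<theta>)) * nv (\<theta> ^ (q ^ n) - \<theta>) = 1"
          using theta_frob_neq[of n] False by (simp flip: nv_mult)
        thus ?thesis using nv_theta_frob_diff[of n] False qn by (simp add: eq_divide_eq)
      qed
      also have "1 / real q ^ (q ^ n) * N (\<Sum>j\<in>{1..n}. P j * tw (int j) (exp_coeff (n - j))) \<le> D / real q ^ (q ^ n)"
        using sum qn by (simp add: divide_right_mono)
      also have "\<dots> = M * ((4 / 3) / real q) ^ (q ^ n) * (C * c ^ n) ^ (q ^ n)"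
        by (simp add: D_def power_mult_distrib power_divide)
      also have "\<dots> \<le> 1 * (C * c ^ n) ^ (q ^ n)"
      proof (rule mult_right_mono)
        have "M * ((4 / 3) / real q) ^ (q ^ n) \<le> M * (2 / 3) ^ (q ^ n)"
          using M1 q_ge_2 by (intro mult_left_mono power_mono) (auto simp: field_simps)
        also have "\<dots> \<le> 1"
        proof (rule less_imp_le, rule n0)
          have "n < q ^ n" using q_ge_2 by (intro less_exp[THEN less_le_trans] power_mono) auto
          thus "n0 \<le> q ^ n" using False by simp
        qed
        finally show "M * ((4 / 3) / real q) ^ (q ^ n) \<le> 1" .
      qed (use C1 c in auto)
      finally show ?thesis by simp
    qed (rule C_small)
  qed
  thus thesis using that C1 c by blast
qed

text \<open>The terms are bounded by \<open>C * N x * c ^ i\<close> raised to the power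
  \<open>q ^ i\<close>. As soon as this base is below 1 it bounds its own powers, and it tends to
  0.\<close>

lemma exp_terms_tendsto:
  assumes "x \<in> T"
  shows "(\<lambda>i. N (exp_coeff i * tw (int i) x)) \<longlonglongrightarrow> 0"
proof -
  obtain C c :: real where C: "C \<ge> 1" "0 < c" "c < 1" "\<And>n. N (exp_coeff n) \<le> (C * c ^ n) ^ (q ^ n)"
    using exp_coeff_bound by blast
  have "(\<lambda>i. C * N x * c ^ i) \<longlonglongrightarrow> C * N x * 0"
    by (intro tendsto_mult tendsto_const LIMSEQ_realpow_zero) (use C in auto)
  hence lim: "(\<lambda>i. C * N x * c ^ i) \<longlonglongrightarrow> 0" by simp
  hence "eventually (\<lambda>i. C * N x * c ^ i < 1) sequentially"
    by (rule order_tendstoD) simp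
  hence le: "eventually (\<lambda>i. N (exp_coeff i * tw (int i) x) \<le> C * N x * c ^ i) sequentially"
  proof eventually_elim
    case (elim i)
    have nn: "0 \<le> C * N x * c ^ i" using C assms by simp
    have "N (exp_coeff i * tw (int i) x) \<le> N (exp_coeff i) * N (tw (int i) x)"
      by (rule N_mult_le) (auto simp: T_tw assms)
    also have "\<dots> \<le> (C * c ^ i) ^ (q ^ i) * N x ^ (q ^ i)"
      by (rule mult_mono) (use C N_tw_le[OF assms] assms in \<open>auto simp: T_tw\<close>)
    also have "\<dots> = (C * N x * c ^ i) ^ (q ^ i)"
      by (simp add: power_mult_distrib mult_ac)
    also have "\<dots> \<le> (C * N x * c ^ i) ^ 1"
      using nn elim by (intro power_decreasing) (auto simp: Suc_leI)
    finally show ?case by simp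
  qed
  show ?thesis
    by (rule tendsto_sandwich[OF _ le tendsto_const lim])
       (intro always_eventually allI, simp add: T_mult T_tw assms)
qed

definition exp_phi :: "'k mps \<Rightarrow> 'k mps" where
  "exp_phi x = (SOME L. L \<in> T \<and> tends (\<lambda>n. \<Sum>i<n. exp_coeff i * tw (int i) x) L)"

lemma exp_phi_T [simp]: "x \<in> T \<Longrightarrow> exp_phi x \<in> T"
  and exp_phi_tends: "x \<in> T \<Longrightarrow> tends (\<lambda>n. \<Sum>i<n. exp_coeff i * tw (int i) x) (exp_phi x)"
proof -
  assume x: "x \<in> T"
  obtain L where "L \<in> T" "tends (\<lambda>n. \<Sum>i<n. exp_coeff i * tw (int i) x) L"
    by (rule series_converges[of "\<lambda>i. exp_coeff i * tw (int i) x"]) (auto intro!: T_mult T_tw x exp_terms_tendsto)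
  hence "\<exists>L. L \<in> T \<and> tends (\<lambda>n. \<Sum>i<n. exp_coeff i * tw (int i) x) L" by blast
  from someI_ex[OF this] show "exp_phi x \<in> T" "tends (\<lambda>n. \<Sum>i<n. exp_coeff i * tw (int i) x) (exp_phi x)"
    by (simp_all add: exp_phi_def)
qed

text \<open>Beyond the leading term \<open>x\<close> every term carries a power of
  \<open>N x\<close> with exponent at least \<open>q\<close>, and the coefficients are
  bounded.\<close>

lemma exp_phi_near_identity:
  obtains K where "K \<ge> 1" "\<And>x. x \<in> T \<Longrightarrow> N x \<le> 1 \<Longrightarrow> N (exp_phi x - x) \<le> K * N x ^ q"
proof -
  \<comment> \<open>The coefficients are the terms of the series at \<open>x = 1\<close>.\<close>
  have "(\<lambda>i. N (exp_coeff i)) \<longlonglongrightarrow> 0" using exp_terms_tendsto[of 1] by simp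
  hence "Bseq (\<lambda>i. N (exp_coeff i))" by (intro convergent_imp_Bseq convergentI)
  then obtain K where K: "\<And>i. \<bar>N (exp_coeff i)\<bar> \<le> K" by (auto simp: Bseq_def)
  define K' where "K' = max 1 K"
  have K': "K' \<ge> 1" "N (exp_coeff i) \<le> K'" for i using K[of i] by (auto simp: K'_def)
  have "N (exp_phi x - x) \<le> K' * N x ^ q" if x: "x \<in> T" "N x \<le> 1" for x
  proof (rule tends_bound)
    show "tends (\<lambda>n. (\<Sum>i<n. exp_coeff i * tw (int i) x) + - x) (exp_phi x - x)"
      using tends_add[OF exp_phi_tends[OF x(1)] tends_const[of "- x"]] x
      by (auto simp: T_sum T_mult T_tw T_minus)
    fix n :: nat assume n: "n \<ge> 1"
    have "(\<Sum>i<n. exp_coeff i * tw (int i) x) + - x = (\<Sum>i\<in>{1..<n}. exp_coeff i * tw (int i) x)"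
      using n by (simp add: lessThan_atLeast0 sum.atLeast_Suc_lessThan exp_coeff_0)
    also have "N \<dots> \<le> K' * N x ^ q"
    proof (rule N_sum_le)
      fix i assume i: "i \<in> {1..<n}"
      have "q ^ 1 \<le> q ^ i" using i q_ge_2 by (intro power_increasing) auto
      hence "N x ^ (q ^ i) \<le> N x ^ q" using x by (intro power_decreasing) auto
      hence "N (exp_coeff i) * N (tw (int i) x) \<le> K' * N x ^ q"
        using K'(1) K'(2)[of i] N_tw_le[OF x(1), of i] by (intro mult_mono) (auto simp: T_tw x)
      thus "N (exp_coeff i * tw (int i) x) \<le> K' * N x ^ q"
        using N_mult_le[of "exp_coeff i" "tw (int i) x"] x by (simp add: T_tw)
    qed (use x K' in \<open>auto intro!: T_mult T_tw\<close>)
    finally show "N ((\<Sum>i<n. exp_coeff i * tw (int i) x) + - x) \<le> K' * N x ^ q" .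
  qed (use x in \<open>auto intro!: T_diff T_sum T_mult T_tw\<close>)
  thus thesis using that K' by blast
qed

definition phi :: "'k mps \<Rightarrow> 'k mps" where
  "phi x = (\<Sum>j\<le>r. P j * tw (int j) x)"

text \<open>The identity holds exactly between partial sums: the first \<open>n\<close> terms at
  \<open>\<theta> x\<close> are the coefficients \<open>P j\<close> applied to the
  \<open>j\<close>-th twists of the first \<open>n - j\<close> terms at \<open>x\<close>. Letting
  \<open>n\<close> grow is then harmless because only finitely many \<open>j\<close> occur.\<close>

lemma phi_exp_phi:
  assumes x: "x \<in> T"
  shows "phi (exp_phi x) = exp_phi (mconst \<theta> * x)"
proof (rule tends_unique)
  define y where "y = (\<lambda>i. exp_coeff i * tw (int i) x)"
  have y_T: "y i \<in> T" for i using x by (auto simp: y_def intro!: T_mult T_tw)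
  have *: "(\<Sum>i<n. exp_coeff i * tw (int i) (mconst \<theta> * x)) = (\<Sum>j\<le>r. P j * tw (int j) (\<Sum>i<n - j. y i))" for n
  proof -
    have "exp_coeff i * tw (int i) (mconst \<theta> * x) = (\<Sum>j\<le>i. P j * tw (int j) (y (i - j)))" for i
    proof -
      have "exp_coeff i * tw (int i) (mconst \<theta> * x) = (mconst (\<theta> ^ (q ^ i)) * exp_coeff i) * tw (int i) x"
        by (simp add: tw_mult tw_mconst twist_nat mult_ac)
      also have "\<dots> = (\<Sum>j\<le>i. P j * tw (int j) (y (i - j)))"
        by (simp add: exp_coeff_rec sum_distrib_right y_def tw_mult tw_tw mult.assoc)
      finally show ?thesis .
    qed
    hence "(\<Sum>i<n. exp_coeff i * tw (int i) (mconst \<theta> * x)) = (\<Sum>i<n. \<Sum>j\<le>i. P j * tw (int j) (y (i - j)))"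
      by simp
    also have "\<dots> = (\<Sum>(j, i)\<in>{(j, i). j + i < n}. P j * tw (int j) (y i))"
      by (rule sum.triangle_reindex[symmetric])
    \<comment> \<open>Terms with \<open>j > r\<close> vanish with \<open>P j\<close>; for
      \<open>j \<ge> n\<close> the truncated \<open>n - j\<close> gives an empty range, as it
      should.\<close>
    also have "\<dots> = (\<Sum>(j, i)\<in>(SIGMA j:{..r}. {..<n - j}). P j * tw (int j) (y i))"
    proof (rule sum.mono_neutral_right)
      have "{(j, i). j + i < n} \<subseteq> {..<n} \<times> {..<n}" by auto
      thus "finite {(j, i). j + i < n}" by (rule finite_subset) simp
    qed (auto simp: P_def split: if_splits)
    also have "\<dots> = (\<Sum>j\<le>r. \<Sum>i<n - j. P j * tw (int j) (y i))"
      by (rule sum.Sigma[symmetric]) auto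
    finally show ?thesis by (simp add: tw_sum sum_distrib_left)
  qed
  show "tends (\<lambda>n. \<Sum>i<n. exp_coeff i * tw (int i) (mconst \<theta> * x)) (phi (exp_phi x))"
    unfolding phi_def *
    by (intro tends_sum tends_mult tends_tw tends_offset[OF exp_phi_tends[OF x, folded y_def]] T_mult T_tw T_sum)
       (simp_all add: x y_T)
  show "tends (\<lambda>n. \<Sum>i<n. exp_coeff i * tw (int i) (mconst \<theta> * x)) (exp_phi (mconst \<theta> * x))"
    by (rule exp_phi_tends) (simp add: T_mult x)
qed (auto simp: phi_def x intro!: T_mult T_sum T_tw exp_phi_T)

end

section \<open>Evaluation at z = theta and the period lattice\<close>

context c_infinity
begin

lemma N_add_le_sum: "f \<in> T \<Longrightarrow> g \<in> T \<Longrightarrow> N (f + g) \<le> N f + N g"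
  by (rule N_add_le) auto

lemma N_diff_le_sum: "f \<in> T \<Longrightarrow> g \<in> T \<Longrightarrow> N (f - g) \<le> N f + N g"
  by (rule N_diff_le) auto

section \<open>Series in z convergent up to the absolute value of theta\<close>

definition TZ :: "'k mps fps set" where
  "TZ = {g. (\<forall>i. fps_nth g i \<in> T) \<and> (\<lambda>i. real q ^ i * N (fps_nth g i)) \<longlonglongrightarrow> 0}"

lemma TZ_nth: "g \<in> TZ \<Longrightarrow> fps_nth g i \<in> T"
  and TZ_lim: "g \<in> TZ \<Longrightarrow> (\<lambda>i. real q ^ i * N (fps_nth g i)) \<longlonglongrightarrow> 0"
  by (simp_all add: TZ_def)

lemma TZ_I:
  assumes "\<And>i. fps_nth g i \<in> T" "\<And>i. i \<ge> n \<Longrightarrow> real q ^ i * N (fps_nth g i) \<le> f i" "f \<longlonglongrightarrow> 0"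
  shows "g \<in> TZ"
  unfolding TZ_def mem_Collect_eq
proof (intro conjI allI)
  show "(\<lambda>i. real q ^ i * N (fps_nth g i)) \<longlonglongrightarrow> 0"
  proof (rule tendsto_sandwich[OF _ _ tendsto_const assms(3)])
    show "eventually (\<lambda>i. real q ^ i * N (fps_nth g i) \<le> f i) sequentially"
      unfolding eventually_sequentially using assms(2) by blast
  qed (simp add: assms(1))
qed (rule assms(1))

lemma TZ_eventually_0:
  assumes "\<And>i. fps_nth g i \<in> T" "\<And>i. i \<ge> n \<Longrightarrow> fps_nth g i = 0"
  shows "g \<in> TZ"
  by (rule TZ_I[of _ n "\<lambda>_. 0"]) (use assms in auto)

lemma TZ_const: "c \<in> T \<Longrightarrow> fps_const c \<in> TZ"
  by (rule TZ_eventually_0[of _ 1]) auto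

lemma TZ_0 [simp]: "0 \<in> TZ"
  by (rule TZ_eventually_0[of _ 0]) auto

lemma TZ_1 [simp]: "1 \<in> TZ"
  by (rule TZ_eventually_0[of _ 1]) (auto simp: fps_one_nth)

lemma TZ_X [simp]: "fps_X \<in> TZ"
  by (rule TZ_eventually_0[of _ 2]) (auto simp: fps_X_nth)

lemma TZ_add:
  assumes "g \<in> TZ" "h \<in> TZ"
  shows "g + h \<in> TZ"
proof (rule TZ_I)
  show "(\<lambda>i. real q ^ i * N (fps_nth g i) + real q ^ i * N (fps_nth h i)) \<longlonglongrightarrow> 0"
    using tendsto_add[OF assms[THEN TZ_lim]] by simp
  fix i
  have "N (fps_nth (g + h) i) \<le> N (fps_nth g i) + N (fps_nth h i)"
    using assms by (auto intro!: N_add_le simp: TZ_nth)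
  thus "real q ^ i * N (fps_nth (g + h) i) \<le> real q ^ i * N (fps_nth g i) + real q ^ i * N (fps_nth h i)"
    by (simp flip: distrib_left add: mult_left_mono)
qed (use assms in \<open>auto intro: T_add TZ_nth\<close>)

lemma TZ_sum: "(\<And>i. i \<in> S \<Longrightarrow> f i \<in> TZ) \<Longrightarrow> sum f S \<in> TZ"
  by (induction S rule: infinite_finite_induct) (auto intro: TZ_add)

lemma TZ_mult:
  assumes g: "g \<in> TZ" and h: "h \<in> TZ"
  shows "g * h \<in> TZ"
proof -
  define G where "G = (\<lambda>i. real q ^ i * N (fps_nth g i))"
  define H where "H = (\<lambda>i. real q ^ i * N (fps_nth h i))"
  have nn: "G i \<ge> 0" "H i \<ge> 0" for i using g h by (simp_all add: G_def H_def TZ_nth)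
  have lim: "G \<longlonglongrightarrow> 0" "H \<longlonglongrightarrow> 0" using TZ_lim[OF g] TZ_lim[OF h] by (simp_all add: G_def H_def)
  have "Bseq G" "Bseq H" using lim by (auto intro: convergent_imp_Bseq convergentI)
  then obtain C1 C2 where "\<And>i. G i \<le> C1" "\<And>i. H i \<le> C2"
    using nn by (auto simp: Bseq_def)
  define C where "C = 1 + max C1 C2"
  have bnd: "G i \<le> C" "H i \<le> C" for i
    using \<open>G i \<le> C1\<close> \<open>H i \<le> C2\<close> by (auto simp: C_def)
  have "0 \<le> C1" using \<open>G 0 \<le> C1\<close> nn(1)[of 0] by linarith
  hence C: "C > 0" by (auto simp: C_def)
  have gh_T: "fps_nth (g * h) n \<in> T" for n
    using g h by (auto simp: fps_mult_nth TZ_nth intro!: T_sum T_mult)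
  have "(\<lambda>n. real q ^ n * N (fps_nth (g * h) n)) \<longlonglongrightarrow> 0"
    unfolding LIMSEQ_iff
  proof (intro allI impI)
    fix e :: real assume e: "e > 0"
    define d where "d = e / (2 * C)"
    have d: "d > 0" using e C by (simp add: d_def)
    obtain n1 n2 where n12: "\<And>i. i \<ge> n1 \<Longrightarrow> G i < d" "\<And>i. i \<ge> n2 \<Longrightarrow> H i < d"
      using lim d nn unfolding LIMSEQ_iff by (metis abs_of_nonneg diff_zero real_norm_def)
    have "real q ^ n * N (fps_nth (g * h) n) < e" if n: "n \<ge> n1 + n2" for n
    proof -
      \<comment> \<open>Either \<open>i \<ge> n1\<close> or \<open>n - i \<ge> n2\<close>: one
        factor is small and the other is bounded by \<open>C\<close>.\<close>
      have "G i * H (n - i) \<le> e / 2" if "i \<le> n" for i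
      proof (cases "i \<ge> n1")
        case True
        hence "G i * H (n - i) \<le> d * C" using n12(1)[of i] bnd d nn by (intro mult_mono) auto
        thus ?thesis using C by (simp add: d_def)
      next
        case False
        hence "n - i \<ge> n2" using n by simp
        hence "G i * H (n - i) \<le> C * d" using n12(2)[of "n - i"] bnd C nn by (intro mult_mono) auto
        thus ?thesis using C by (simp add: d_def)
      qed
      moreover have "N (fps_nth g i * fps_nth h (n - i)) \<le> (G i * H (n - i)) / real q ^ n" if "i \<le> n" for i
      proof -
        have "G i * H (n - i) = (real q ^ i * real q ^ (n - i)) * (N (fps_nth g i) * N (fps_nth h (n - i)))"
          by (simp add: G_def H_def)
        also have "real q ^ i * real q ^ (n - i) = real q ^ n" using that by (simp flip: power_add)
        finally have "(G i * H (n - i)) / real q ^ n = N (fps_nth g i) * N (fps_nth h (n - i))" by simp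
        thus ?thesis using N_mult_le[of "fps_nth g i" "fps_nth h (n - i)"] g h by (simp add: TZ_nth)
      qed
      ultimately have "N (fps_nth g i * fps_nth h (n - i)) \<le> (e / 2) / real q ^ n" if "i \<le> n" for i
        using that by (meson divide_right_mono of_nat_0_le_iff order_trans zero_le_power)
      hence "N (fps_nth (g * h) n) \<le> (e / 2) / real q ^ n"
        unfolding fps_mult_nth using e g h
        by (intro N_sum_le) (auto intro!: T_mult simp: TZ_nth)
      hence "real q ^ n * N (fps_nth (g * h) n) \<le> e / 2" by (simp add: field_simps)
      thus ?thesis using e by simp
    qed
    thus "\<exists>n0. \<forall>n\<ge>n0. norm (real q ^ n * N (fps_nth (g * h) n) - 0) < e"
      using gh_T by (intro exI[of _ "n1 + n2"]) simp
  qed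
  thus ?thesis using gh_T by (simp add: TZ_def)
qed

text \<open>Boundedness of the weighted coefficients suffices, without a limit 0: the twist has
  exponent at least 2, and \<open>q ^ i\<close> times the square of \<open>C / q ^ i\<close> still
  tends to 0. This is what applies to the Anderson generating function.\<close>

lemma TZ_twist:
  assumes "\<And>i. fps_nth h i \<in> T" "\<And>i. real q ^ i * N (fps_nth h i) \<le> C" "k \<ge> 1"
  shows "zt (int k) h \<in> TZ"
proof -
  have C0: "C \<ge> 0" using assms(2)[of 0] N_nonneg[OF assms(1)[of 0]] by simp
  have "(\<lambda>i. C * (1 / real q) ^ i) \<longlonglongrightarrow> C * 0"
    by (intro tendsto_mult tendsto_const LIMSEQ_realpow_zero) (use q_ge_2 in auto)
  hence lim: "(\<lambda>i. C * (1 / real q) ^ i) \<longlonglongrightarrow> 0" by simp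
  hence "eventually (\<lambda>i. C * (1 / real q) ^ i < 1) sequentially"
    by (rule order_tendstoD) simp
  then obtain n0 where n0: "\<And>i. i \<ge> n0 \<Longrightarrow> C * (1 / real q) ^ i < 1"
    unfolding eventually_sequentially by blast
  have lim': "(\<lambda>i. C * (C * (1 / real q) ^ i)) \<longlonglongrightarrow> 0"
    using tendsto_mult[OF tendsto_const lim, of C] by simp
  have "real q ^ i * N (fps_nth (zt (int k) h) i) \<le> C * (C * (1 / real q) ^ i)" if i: "i \<ge> n0" for i
  proof -
  define x where "x = N (fps_nth h i)"
  have x: "0 \<le> x" "x \<le> C * (1 / real q) ^ i"
    using assms(1,2)[of i] by (simp_all add: x_def power_divide field_simps)
  have "N (fps_nth (zt (int k) h) i) \<le> x ^ (q ^ k)"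
    using N_tw_le[OF assms(1)] by (simp add: x_def)
  also have "\<dots> \<le> x ^ 2"
  proof (rule power_decreasing)
    have "q ^ 1 \<le> q ^ k" using assms(3) q_ge_2 by (intro power_increasing) auto
    thus "2 \<le> q ^ k" using q_ge_2 by simp
  qed (use x n0[OF i] in auto)
  also have "\<dots> \<le> (C * (1 / real q) ^ i) ^ 2" using x by (rule power_mono[rotated])
  finally have "real q ^ i * N (fps_nth (zt (int k) h) i) \<le> real q ^ i * (C * (1 / real q) ^ i) ^ 2"
    by (simp add: mult_left_mono)
  also have "\<dots> = C * (C * (1 / real q) ^ i)"
    by (simp add: power2_eq_square power_divide)
  finally show ?thesis .
  qed
  thus ?thesis using lim' by (intro TZ_I) (auto intro: T_tw assms(1))
qed

section \<open>The value at z = theta\<close>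

definition ev :: "'k mps fps \<Rightarrow> 'k mps" where
  "ev g = (SOME L. L \<in> T \<and> tends (\<lambda>n. \<Sum>i<n. mconst (\<theta> ^ i) * fps_nth g i) L)"

lemma ev_terms_T: "g \<in> TZ \<Longrightarrow> mconst (\<theta> ^ i) * fps_nth g i \<in> T"
  by (simp add: T_mult TZ_nth)

lemma ev_exists:
  assumes "g \<in> TZ"
  shows "\<exists>L\<in>T. tends (\<lambda>n. \<Sum>i<n. mconst (\<theta> ^ i) * fps_nth g i) L \<and>
           (\<forall>m. nv_tendsto nv (\<lambda>n. \<Sum>i<n. mcoeff (fps_nth g i) m * \<theta> ^ i) (mcoeff L m))"
proof -
  have "(\<lambda>i. N (mconst (\<theta> ^ i) * fps_nth g i)) \<longlonglongrightarrow> 0"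
    using TZ_lim[OF assms] assms by (simp add: N_mconst_mult TZ_nth nv_power nv_theta)
  from series_converges[OF ev_terms_T[OF assms] this] obtain L where L:
    "L \<in> T" "tends (\<lambda>n. \<Sum>i<n. mconst (\<theta> ^ i) * fps_nth g i) L"
    "\<And>m. nv_tendsto nv (\<lambda>n. \<Sum>i<n. mcoeff (mconst (\<theta> ^ i) * fps_nth g i) m) (mcoeff L m)"
    by blast
  show ?thesis
    by (intro bexI[of _ L] conjI allI) (use L in \<open>simp_all add: mult.commute[of "mcoeff _ _"]\<close>)
qed

lemma ev_T [simp]: "g \<in> TZ \<Longrightarrow> ev g \<in> T"
  and ev_tends: "g \<in> TZ \<Longrightarrow> tends (\<lambda>n. \<Sum>i<n. mconst (\<theta> ^ i) * fps_nth g i) (ev g)"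
proof -
  assume "g \<in> TZ"
  hence "\<exists>L. L \<in> T \<and> tends (\<lambda>n. \<Sum>i<n. mconst (\<theta> ^ i) * fps_nth g i) L"
    using ev_exists by blast
  from someI_ex[OF this] show "ev g \<in> T" "tends (\<lambda>n. \<Sum>i<n. mconst (\<theta> ^ i) * fps_nth g i) (ev g)"
    by (simp_all add: ev_def)
qed

lemma ev_eqI:
  assumes "g \<in> TZ" "tends (\<lambda>n. \<Sum>i<n. mconst (\<theta> ^ i) * fps_nth g i) L" "L \<in> T"
  shows "ev g = L"
  using tends_unique[OF ev_tends[OF assms(1)] assms(2)] assms ev_terms_T by (auto intro: T_sum)

lemma ev_pointwise:
  assumes "g \<in> TZ"
  shows "nv_tendsto nv (\<lambda>n. \<Sum>i<n. mcoeff (fps_nth g i) m * \<theta> ^ i) (mcoeff (ev g) m)"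
  using ev_exists[OF assms] ev_eqI[OF assms] by metis

lemma ev_add:
  assumes "g \<in> TZ" "h \<in> TZ"
  shows "ev (g + h) = ev g + ev h"
proof (rule ev_eqI)
  show "tends (\<lambda>n. \<Sum>i<n. mconst (\<theta> ^ i) * fps_nth (g + h) i) (ev g + ev h)"
    using tends_add[OF assms[THEN ev_tends]] assms
    by (simp add: T_sum ev_terms_T distrib_left sum.distrib)
qed (use assms in \<open>auto intro: TZ_add T_add\<close>)

lemma ev_0 [simp]: "ev 0 = 0"
  by (rule ev_eqI) (simp_all add: tends_const)

lemma ev_sum: "(\<And>i. i \<in> S \<Longrightarrow> f i \<in> TZ) \<Longrightarrow> ev (sum f S) = (\<Sum>i\<in>S. ev (f i))"
  by (induction S rule: infinite_finite_induct) (auto simp: ev_add TZ_sum)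

lemma ev_const_mult:
  assumes "c \<in> T" "g \<in> TZ"
  shows "ev (fps_const c * g) = c * ev g"
proof (rule ev_eqI)
  show "tends (\<lambda>n. \<Sum>i<n. mconst (\<theta> ^ i) * fps_nth (fps_const c * g) i) (c * ev g)"
    using tends_mult[OF ev_tends[OF assms(2)] assms(1)] assms
    by (simp add: T_sum ev_terms_T sum_distrib_left mult.left_commute)
qed (use assms in \<open>auto intro: TZ_mult TZ_const T_mult\<close>)

lemma ev_X_mult:
  assumes "g \<in> TZ"
  shows "ev (fps_X * g) = mconst \<theta> * ev g"
proof (rule ev_eqI)
  have "(\<Sum>i<n. mconst (\<theta> ^ i) * fps_nth (fps_X * g) i)
      = mconst \<theta> * (\<Sum>i<n - 1. mconst (\<theta> ^ i) * fps_nth g i)" for n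
  proof (cases n)
    case (Suc k)
    show ?thesis unfolding Suc sum.lessThan_Suc_shift
      by (simp add: sum_distrib_left mconst_mult mult.assoc)
  qed simp
  thus "tends (\<lambda>n. \<Sum>i<n. mconst (\<theta> ^ i) * fps_nth (fps_X * g) i) (mconst \<theta> * ev g)"
    using tends_mult[OF tends_offset[OF ev_tends[OF assms], of 1], of "mconst \<theta>"] assms
    by (simp add: T_sum ev_terms_T)
qed (use assms in \<open>auto intro: TZ_mult T_mult\<close>)

lemma ev_X_power_mult:
  assumes "g \<in> TZ"
  shows "fps_X ^ i * g \<in> TZ \<and> ev (fps_X ^ i * g) = mconst (\<theta> ^ i) * ev g"
  by (induction i) (use assms in \<open>auto simp: mult.assoc ev_X_mult TZ_mult mconst_mult\<close>)

lemma ev_finite: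
  assumes "\<And>i. fps_nth g i \<in> T" "\<And>i. i \<ge> n \<Longrightarrow> fps_nth g i = 0"
  shows "ev g = (\<Sum>i<n. mconst (\<theta> ^ i) * fps_nth g i)"
proof (rule ev_eqI)
  show "tends (\<lambda>k. \<Sum>i<k. mconst (\<theta> ^ i) * fps_nth g i) (\<Sum>i<n. mconst (\<theta> ^ i) * fps_nth g i)"
    unfolding tends_def
  proof (rule tendsto_eventually, unfold eventually_sequentially, intro exI[of _ n] allI impI)
    fix k assume "n \<le> k"
    hence "(\<Sum>i<k. mconst (\<theta> ^ i) * fps_nth g i) - (\<Sum>i<n. mconst (\<theta> ^ i) * fps_nth g i) = 0"
      by (subst sum_lessThan_diff) (auto simp: assms(2))
    thus "N ((\<Sum>i<k. mconst (\<theta> ^ i) * fps_nth g i) - (\<Sum>i<n. mconst (\<theta> ^ i) * fps_nth g i)) = 0"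
      by simp
  qed
qed (use assms TZ_eventually_0 in \<open>auto intro!: T_sum T_mult\<close>)

text \<open>With a polynomial factor multiplicativity reduces to linearity over \<open>T\<close> and
  the rule for \<open>fps_X\<close>, so no product of two infinite series has to be
  rearranged.\<close>

lemma ev_finite_mult:
  assumes c: "\<And>i. fps_nth c i \<in> T" "\<And>i. i \<ge> n \<Longrightarrow> fps_nth c i = 0" and g: "g \<in> TZ"
  shows "ev (c * g) = ev c * ev g"
proof -
  have "c = (\<Sum>i<n. fps_const (fps_nth c i) * fps_X ^ i)"
    by (rule fps_ext) (use c in \<open>auto simp: fps_sum_nth fps_X_power_nth if_distrib cong: if_cong\<close>)
  hence "c * g = (\<Sum>i<n. fps_const (fps_nth c i) * (fps_X ^ i * g))"
    by (metis (no_types, lifting) mult.assoc sum.cong sum_distrib_right)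
  hence "ev (c * g) = (\<Sum>i<n. ev (fps_const (fps_nth c i) * (fps_X ^ i * g)))"
    using ev_X_power_mult[OF g] c by (simp add: ev_sum TZ_mult TZ_const)
  also have "\<dots> = (\<Sum>i<n. fps_nth c i * (mconst (\<theta> ^ i) * ev g))"
    using ev_X_power_mult[OF g] c by (simp add: ev_const_mult)
  also have "\<dots> = (\<Sum>i<n. mconst (\<theta> ^ i) * fps_nth c i) * ev g"
    unfolding sum_distrib_right by (intro sum.cong refl) (simp add: mult_ac)
  finally show ?thesis using ev_finite[OF c] by simp
qed

end

context drinfeld
begin

section \<open>The defining equation of V and its single unknown series\<close>

definition u :: "'k mps" where "u = tw (- int r) B"

text \<open>Here \<open>u\<close> is the inverse of the twist of \<open>A r\<close> by
  \<open>- r\<close>, because twisting is multiplicative and \<open>A r * B = 1\<close>.\<close>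

definition Phi :: "nat \<Rightarrow> nat \<Rightarrow> 'k mps fps" where
  "Phi k j = (if k + 1 < r then (if j = k + 1 then 1 else 0)
     else if j = 0 then (fps_X - fps_const (mconst \<theta>)) * fps_const u
     else fps_const (- tw (- int j) (A j) * u))"

definition V :: "(nat \<Rightarrow> 'k mps fps) set" where
  "V = {G. (\<forall>j<r. G j \<in> TZ) \<and> (\<forall>j\<ge>r. G j = 0) \<and>
        (\<forall>j<r. (\<Sum>k<r. zt (-1) (G k) * Phi k j) = G j)}"

definition Lam :: "'k mps set" where
  "Lam = {x \<in> T. exp_phi x = 0}"

text \<open>For \<open>G\<close> in \<open>V\<close> this is \<open>G 0 / (z - \<theta>)\<close>, the negative of the Anderson generating
  function of \<open>D\<^sub>0 G\<close>.\<close>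

definition agf :: "(nat \<Rightarrow> 'k mps fps) \<Rightarrow> 'k mps fps" where
  "agf G = zt (-1) (G (r - 1)) * fps_const u"

text \<open>Each row but the last has a single entry 1, just right of the diagonal, and the last row
  carries the factor \<open>u\<close> throughout. So column \<open>j\<close> sees the twisted entry
  \<open>j - 1\<close> (none for \<open>j = 0\<close>) and a multiple of
  \<open>agf G\<close>.\<close>

lemma Phi_eqs_iff:
  "(\<forall>j<r. (\<Sum>k<r. zt (-1) (G k) * Phi k j) = G j) \<longleftrightarrow>
     G 0 = (fps_X - fps_const (mconst \<theta>)) * agf G \<and>
     (\<forall>j. 1 \<le> j \<and> j < r \<longrightarrow> G j = zt (-1) (G (j - 1)) - fps_const (tw (- int j) (A j)) * agf G)"
proof -
  have last: "sum f {..<r} = sum f {..<r - 1} + f (r - 1)" for f :: "nat \<Rightarrow> 'k mps fps"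
    using r_pos by (metis Suc_diff_1 less_eq_Suc_le One_nat_def sum.lessThan_Suc)
  have 0: "(\<Sum>k<r. zt (-1) (G k) * Phi k 0) = (fps_X - fps_const (mconst \<theta>)) * agf G"
  proof -
    have "(\<Sum>k<r - 1. zt (-1) (G k) * Phi k 0) = 0"
      by (intro sum.neutral) (auto simp: Phi_def)
    thus ?thesis unfolding last using r_pos by (simp add: Phi_def agf_def mult_ac)
  qed
  have *: "(\<Sum>k<r. zt (-1) (G k) * Phi k j) = zt (-1) (G (j - 1)) - fps_const (tw (- int j) (A j)) * agf G"
    if j: "1 \<le> j" "j < r" for j
  proof -
    have "(\<Sum>k<r - 1. zt (-1) (G k) * Phi k j) = (\<Sum>k<r - 1. if k = j - 1 then zt (-1) (G k) else 0)"
      using j by (intro sum.cong) (auto simp: Phi_def)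
    also have "\<dots> = zt (-1) (G (j - 1))" using j by simp
    finally have "(\<Sum>k<r - 1. zt (-1) (G k) * Phi k j) = zt (-1) (G (j - 1))" .
    moreover have "zt (-1) (G (r - 1)) * Phi (r - 1) j = - (fps_const (tw (- int j) (A j)) * agf G)"
      using j by (simp add: Phi_def agf_def mult_ac flip: fps_const_mult fps_const_neg)
    ultimately show ?thesis by (simp add: last)
  qed
  have split: "(\<forall>j<r. Q j) \<longleftrightarrow> Q 0 \<and> (\<forall>j. 1 \<le> j \<and> j < r \<longrightarrow> Q j)" for Q
  proof (intro iffI allI impI)
    fix j assume "Q 0 \<and> (\<forall>j. 1 \<le> j \<and> j < r \<longrightarrow> Q j)" "j < r"
    thus "Q j" by (cases "j = 0") auto
  qed (use r_pos in auto)
  show ?thesis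
    unfolding split[of "\<lambda>j. (\<Sum>k<r. zt (-1) (G k) * Phi k j) = G j"] 0
    by (intro conj_cong eq_commute all_cong1 imp_cong refl, elim conjE) (subst *, assumption+, rule eq_commute)
qed

lemma V_agf:
  assumes "G \<in> V"
  shows "G 0 = (fps_X - fps_const (mconst \<theta>)) * agf G"
    and "1 \<le> j \<Longrightarrow> j < r \<Longrightarrow> G j = zt (-1) (G (j - 1)) - fps_const (tw (- int j) (A j)) * agf G"
  using assms unfolding V_def Phi_eqs_iff by blast+

lemma u_T: "u \<in> T"
  by (simp add: u_def T_tw B_T)

lemma agf_nth_T: "G \<in> V \<Longrightarrow> fps_nth (agf G) i \<in> T"
  using r_pos by (auto simp: agf_def V_def intro!: T_mult T_tw u_T TZ_nth)

text \<open>The column relations unrolled down to \<open>G 0\<close>; twisting by \<open>j\<close>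
  clears all negative twists of the coefficients.\<close>

lemma V_twisted:
  assumes "G \<in> V" "j < r"
  shows "zt (int j) (G j) = (fps_X - fps_const (mconst \<theta>)) * agf G
           - (\<Sum>k\<in>{1..j}. fps_const (A k) * zt (int k) (agf G))"
  using assms(2)
proof (induction j)
  case 0
  show ?case using V_agf(1)[OF assms(1)] by simp
next
  case (Suc j)
  have "zt (int (Suc j)) (G (Suc j)) = zt (int j) (G j) - fps_const (A (Suc j)) * zt (int (Suc j)) (agf G)"
    using V_agf(2)[OF assms(1), of "Suc j"] Suc.prems
    by (simp add: zt_diff zt_zt zt_mult zt_const tw_tw)
  thus ?case using Suc by simp
qed

text \<open>The columns give the terms with \<open>k < r\<close>. The term \<open>k = r\<close> is
  the definition of \<open>agf\<close> read backwards: twisting it by \<open>r\<close> turns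
  \<open>u\<close> into \<open>B\<close>, which cancels against \<open>A r\<close>.\<close>

lemma V_functional:
  assumes "G \<in> V"
  shows "(fps_X - fps_const (mconst \<theta>)) * agf G = (\<Sum>k\<in>{1..r}. fps_const (A k) * zt (int k) (agf G))"
proof -
  have "int r + - 1 = int (r - 1)" using r_pos by simp
  hence "zt (int r) (agf G) = zt (int (r - 1)) (G (r - 1)) * fps_const B"
    unfolding agf_def by (simp only: zt_mult zt_zt zt_const u_def tw_tw add.right_inverse tw_zero_index)
  hence "fps_const (A r) * zt (int r) (agf G) = fps_const (A r * B) * zt (int (r - 1)) (G (r - 1))"
    by (simp add: mult_ac flip: fps_const_mult)
  hence *: "fps_const (A r) * zt (int r) (agf G) = zt (int (r - 1)) (G (r - 1))" by (simp add: A_B)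
  have "{1..r} = insert r {1..r - 1}" using r_pos by auto
  hence "sum f {1..r} = f r + sum f {1..r - 1}" for f :: "nat \<Rightarrow> 'k mps fps"
    using r_pos by simp
  thus ?thesis using V_twisted[OF assms, of "r - 1"] r_pos by (simp add: *)
qed

lemma phi_eq: "phi x = mconst \<theta> * x + (\<Sum>k\<in>{1..r}. A k * tw (int k) x)"
  by (simp add: phi_def sum_atMost_head P_def)

lemma phi_0 [simp]: "phi 0 = 0"
  by (simp add: phi_def)

lemma phi_add: "phi (x + y) = phi x + phi y"
  by (simp add: phi_def tw_add distrib_left sum.distrib)

lemma phi_minus: "phi (- x) = - phi x"
  using phi_add[of x "- x"] by (simp add: eq_neg_iff_add_eq_0 add.commute)

lemma functional_iff_phi:
  "(fps_X - fps_const (mconst \<theta>)) * h = (\<Sum>k\<in>{1..r}. fps_const (A k) * zt (int k) h) \<longleftrightarrow>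
   (\<forall>i. phi (fps_nth h i) = (if i = 0 then 0 else fps_nth h (i - 1)))"
proof -
  have "fps_nth ((fps_X - fps_const (mconst \<theta>)) * h) i =
      (if i = 0 then 0 else fps_nth h (i - 1)) - mconst \<theta> * fps_nth h i" for i
    by (simp add: left_diff_distrib)
  moreover have "fps_nth (\<Sum>k\<in>{1..r}. fps_const (A k) * zt (int k) h) i =
      phi (fps_nth h i) - mconst \<theta> * fps_nth h i" for i
    by (simp add: fps_sum_nth phi_eq)
  ultimately show ?thesis unfolding fps_eq_iff by auto
qed

lemma partial_sum_agf:
  "(\<Sum>i<Suc n. mconst (\<theta> ^ i) * fps_nth ((fps_X - fps_const (mconst \<theta>)) * h) i)
     = - (mconst (\<theta> ^ Suc n) * fps_nth h n)"
  by (induction n) (simp_all add: left_diff_distrib right_diff_distrib mconst_mult mult_ac)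

lemma ev_agf_tends:
  assumes "(fps_X - fps_const (mconst \<theta>)) * h \<in> TZ"
  shows "tends (\<lambda>n. - (mconst (\<theta> ^ Suc n) * fps_nth h n)) (ev ((fps_X - fps_const (mconst \<theta>)) * h))"
proof -
  have "tends (\<lambda>n. \<Sum>i<Suc n. mconst (\<theta> ^ i) * fps_nth ((fps_X - fps_const (mconst \<theta>)) * h) i)
          (ev ((fps_X - fps_const (mconst \<theta>)) * h))"
    using LIMSEQ_Suc[OF ev_tends[OF assms, unfolded tends_def]] unfolding tends_def .
  thus ?thesis unfolding partial_sum_agf .
qed

section \<open>Exponentials of the quotients of x by powers of theta\<close>

definition tors :: "'k mps \<Rightarrow> nat \<Rightarrow> 'k mps" where
  "tors x n = mconst (1 / \<theta> ^ Suc n) * x"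

lemma tors_T: "x \<in> T \<Longrightarrow> tors x n \<in> T"
  by (simp add: tors_def T_mult)

text \<open>The sequence starts with \<open>x / \<theta>\<close>, so multiplication by
  \<open>\<theta>\<close> at \<open>n = 0\<close> falls back to \<open>x\<close> itself. This is the
  place where the condition \<open>exp_phi x = 0\<close> enters.\<close>

lemma theta_tors: "mconst \<theta> * tors x n = (if n = 0 then x else tors x (n - 1))"
  by (cases n) (simp_all add: tors_def flip: mconst_mult mult.assoc)

lemma theta_power_tors: "mconst (\<theta> ^ Suc n) * tors x n = x"
  by (simp add: tors_def del: power_Suc flip: mconst_mult mult.assoc)

lemma N_tors:
  assumes "x \<in> T"
  shows "N (tors x n) = N x / real q ^ Suc n"
proof -
  have "N x = real q ^ Suc n * N (tors x n)"
    using N_mconst_mult[OF tors_T[OF assms], of "\<theta> ^ Suc n" n] theta_power_tors[of n x]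
    by (simp only: nv_power nv_theta)
  thus ?thesis by (simp add: field_simps)
qed

lemma phi_exp_phi_tors:
  assumes "x \<in> T"
  shows "phi (exp_phi (tors x n)) = (if n = 0 then exp_phi x else exp_phi (tors x (n - 1)))"
  using phi_exp_phi[OF tors_T[OF assms]] by (simp add: theta_tors)

text \<open>The error of \<open>exp\<close> is at least quadratic in
  \<open>N x / q ^ (n + 1)\<close>, so a factor of order \<open>1 / q ^ (n + 1)\<close> survives the
  weight \<open>q ^ (n + 1)\<close>.\<close>

lemma exp_phi_tors_lim:
  assumes "x \<in> T"
  shows "(\<lambda>n. real q ^ Suc n * N (exp_phi (tors x n) - tors x n)) \<longlonglongrightarrow> 0"
proof -
  obtain K where K: "K \<ge> 1" "\<And>x. x \<in> T \<Longrightarrow> N x \<le> 1 \<Longrightarrow> N (exp_phi x - x) \<le> K * N x ^ q"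
    using exp_phi_near_identity by blast
  have geo: "(\<lambda>n. c * (1 / real q) ^ Suc n) \<longlonglongrightarrow> 0" for c
  proof -
    have "(\<lambda>n. c * (1 / real q) ^ n) \<longlonglongrightarrow> c * 0"
      by (intro tendsto_mult tendsto_const LIMSEQ_realpow_zero) (use q_ge_2 in auto)
    thus ?thesis by (intro LIMSEQ_Suc) simp
  qed
  have "eventually (\<lambda>n. N x * (1 / real q) ^ Suc n < 1) sequentially"
    using geo by (rule order_tendstoD) simp
  hence le: "eventually (\<lambda>n. real q ^ Suc n * N (exp_phi (tors x n) - tors x n) \<le> K * N x ^ 2 * (1 / real q) ^ Suc n)
          sequentially"
  proof eventually_elim
    case (elim n)
    define y where "y = N (tors x n)"
    define Q where "Q = real q ^ Suc n"
    have Q: "Q > 0" using q_pos by (simp add: Q_def)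
    have y: "y = N x / Q" unfolding y_def Q_def by (rule N_tors[OF assms])
    have y1: "y \<le> 1" "0 \<le> y"
      using elim assms by (simp_all add: y Q_def power_divide)
    have "N (exp_phi (tors x n) - tors x n) \<le> K * y ^ q"
      using K(2)[OF tors_T[OF assms], of n] y1 by (simp add: y_def)
    also have "\<dots> \<le> K * y ^ 2"
      using y1 q_ge_2 K(1) by (intro mult_left_mono power_decreasing) auto
    finally have "Q * N (exp_phi (tors x n) - tors x n) \<le> Q * (K * y ^ 2)"
      using Q by simp
    also have "\<dots> = K * N x ^ 2 * (1 / Q)"
      using Q by (simp add: y power2_eq_square)
    also have "1 / Q = (1 / real q) ^ Suc n" by (simp add: Q_def power_divide)
    finally show ?case by (simp add: Q_def)
  qed
  show ?thesis
    by (rule tendsto_sandwich[OF _ le tendsto_const geo])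
       (intro always_eventually allI, simp add: T_diff tors_T assms)
qed

text \<open>On the ball of radius \<open>1 / M\<close> the terms with \<open>j \<ge> 1\<close> are
  at most \<open>M * N x ^ 2\<close>, hence at most \<open>N x\<close>, and the term
  \<open>\<theta> x\<close> of norm \<open>q * N x\<close> dominates. The bound limits the
  expansion; \<open>phi\<close> need not shrink anything.\<close>

lemma phi_contracts:
  obtains \<delta> where "\<delta> > 0" "\<And>x. x \<in> T \<Longrightarrow> N x \<le> \<delta> \<Longrightarrow> N (phi x) \<le> real q * N x"
proof -
  define M where "M = Max (insert 1 (N ` P ` {..r}))"
  have M1: "M \<ge> 1" unfolding M_def by (intro Max_ge) auto
  have M: "N (P j) \<le> M" if "j \<le> r" for j
    unfolding M_def using that by (intro Max_ge) auto
  have "N (phi x) \<le> real q * N x" if x: "x \<in> T" "N x \<le> 1 / M" for x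
    unfolding phi_def
  proof (rule N_sum_le)
    fix j assume j: "j \<in> {..r}"
    show "N (P j * tw (int j) x) \<le> real q * N x"
    proof (cases "j = 0")
      case False
      have "1 / M \<le> 1" using M1 by simp
      hence x1: "N x \<le> 1" using x(2) by linarith
      have "q ^ 1 \<le> q ^ j" using False q_ge_2 by (intro power_increasing) auto
      hence "N x ^ (q ^ j) \<le> N x ^ 2" using x x1 q_ge_2 by (intro power_decreasing) auto
      also have "\<dots> \<le> 1 / M * N x" unfolding power2_eq_square using x by (intro mult_right_mono) auto
      finally have "N (tw (int j) x) \<le> 1 / M * N x" using N_tw_le[OF x(1), of j] by simp
      hence "N (P j) * N (tw (int j) x) \<le> M * (1 / M * N x)"
        using M[of j] j M1 x by (intro mult_mono) (auto simp: T_tw)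
      also have "\<dots> = 1 * N x" using M1 by simp
      also have "\<dots> \<le> real q * N x" using q_ge_2 x by (intro mult_right_mono) auto
      finally show ?thesis using N_mult_le[of "P j" "tw (int j) x"] x by (simp add: T_tw)
    qed (simp add: P_def N_mconst_mult x nv_theta)
  qed (use x in \<open>auto intro!: T_mult T_tw\<close>)
  thus thesis using that[of "1 / M"] M1 by simp
qed

text \<open>A \<open>\<phi>\<close>-compatible system \<open>d\<close> with \<open>d n = o(\<theta>\<^sup>-\<^sup>n)\<close> vanishes, because
  \<open>\<phi>\<close> expands small elements by a factor of at most \<open>q\<close>.\<close>

lemma compatible_system_0:
  assumes d_T: "\<And>n. d n \<in> T" and d: "\<And>n. phi (d (Suc n)) = d n"
    and lim: "(\<lambda>n. real q ^ Suc n * N (d n)) \<longlonglongrightarrow> 0"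
  shows "d n = 0"
proof -
  obtain \<delta> where \<delta>: "\<delta> > 0" "\<And>x. x \<in> T \<Longrightarrow> N x \<le> \<delta> \<Longrightarrow> N (phi x) \<le> real q * N x"
    using phi_contracts by blast
  have "eventually (\<lambda>n. real q ^ Suc n * N (d n) < \<delta>) sequentially"
    using lim \<delta>(1) by (rule order_tendstoD)
  then obtain n0 where n0: "\<And>n. n \<ge> n0 \<Longrightarrow> real q ^ Suc n * N (d n) < \<delta>"
    unfolding eventually_sequentially by blast
  have small: "N (d n) \<le> \<delta>" if "n \<ge> n0" for n
  proof -
    have "1 * N (d n) \<le> real q ^ Suc n * N (d n)"
      using d_T q_ge_2 by (intro mult_right_mono one_le_power) auto
    thus ?thesis using n0[OF that] by linarith
  qed
  have growth: "N (d n) \<le> real q ^ k * N (d (n + k))" if "n \<ge> n0" for n k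
  proof (induction k)
    case (Suc k)
    have "N (d (n + k)) \<le> real q * N (d (n + Suc k))"
      using \<delta>(2)[OF d_T, of "n + Suc k"] small[of "n + Suc k"] that d[of "n + k"] by simp
    hence "real q ^ k * N (d (n + k)) \<le> real q ^ k * (real q * N (d (n + Suc k)))"
      by (intro mult_left_mono) auto
    also have "\<dots> = real q ^ Suc k * N (d (n + Suc k))" by simp
    finally show ?case using Suc by linarith
  qed simp
  \<comment> \<open>From \<open>n0\<close> on the weighted norm \<open>q ^ (n + 1) * N (d n)\<close>
    does not decrease, yet it tends to 0.\<close>
  have large: "d n = 0" if n: "n \<ge> n0" for n
  proof -
    have "(\<lambda>k. real q ^ Suc (k + n) * N (d (k + n))) \<longlonglongrightarrow> 0"
      by (rule LIMSEQ_ignore_initial_segment[OF lim])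
    moreover have "real q ^ Suc n * N (d n) \<le> real q ^ Suc (k + n) * N (d (k + n))" for k
    proof -
      have "real q ^ Suc n * N (d n) \<le> real q ^ Suc n * (real q ^ k * N (d (n + k)))"
        using growth[OF n] by (intro mult_left_mono) auto
      thus ?thesis by (simp add: power_add mult_ac add.commute)
    qed
    ultimately have "real q ^ Suc n * N (d n) \<le> 0"
      by (intro LIMSEQ_le_const) auto
    moreover have "real q ^ Suc n > 0" by (rule zero_less_power) simp
    ultimately have "N (d n) \<le> 0" by (meson mult_pos_pos not_le)
    hence "N (d n) = 0" using N_nonneg[OF d_T[of n]] by linarith
    thus ?thesis by (rule N_eq_0[OF d_T])
  qed
  show ?thesis
  proof (cases "n \<ge> n0")
    case False
    hence "n \<le> n0" by simp
    \<comment> \<open>Below \<open>n0\<close> the vanishing descends through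
      \<open>d n = phi (d (Suc n))\<close>.\<close>
    thus ?thesis by (induction rule: inc_induct) (use large d in \<open>auto, metis phi_0\<close>)
  qed (rule large)
qed

section \<open>The bijection between V and the periods\<close>

lemma V_agf_eq:
  assumes G: "G \<in> V"
  shows "fps_nth (agf G) n = - exp_phi (tors (ev (G 0)) n)" and "exp_phi (ev (G 0)) = 0"
proof -
  define x where "x = ev (G 0)"
  define h where "h = agf G"
  have G0: "G 0 = (fps_X - fps_const (mconst \<theta>)) * h" using V_agf(1)[OF G] by (simp add: h_def)
  have "G 0 \<in> TZ" using G r_pos by (auto simp: V_def)
  hence x: "x \<in> T" by (simp add: x_def)
  have h_T: "fps_nth h i \<in> T" for i unfolding h_def by (rule agf_nth_T[OF G])
  have phi_h: "phi (fps_nth h i) = (if i = 0 then 0 else fps_nth h (i - 1))" for i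
    using V_functional[OF G] functional_iff_phi unfolding h_def by blast
  define d where "d = (\<lambda>n. fps_nth h n + exp_phi (tors x n))"
  have d_T: "d n \<in> T" for n by (simp add: d_def T_add h_T tors_T x)
  have phi_d: "phi (d n) = (if n = 0 then exp_phi x else d (n - 1))" for n
    by (simp add: d_def phi_add phi_h phi_exp_phi_tors x)
  have lim1: "(\<lambda>n. N (- (mconst (\<theta> ^ Suc n) * fps_nth h n) - x)) \<longlonglongrightarrow> 0"
    using ev_agf_tends[of h] \<open>G 0 \<in> TZ\<close> unfolding tends_def G0[symmetric] x_def .
  have lim: "(\<lambda>n. real q ^ Suc n * N (d n)) \<longlonglongrightarrow> 0"
  proof (rule tendsto_sandwich[OF _ _ tendsto_const])
    show "(\<lambda>n. N (- (mconst (\<theta> ^ Suc n) * fps_nth h n) - x) +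
             real q ^ Suc n * N (exp_phi (tors x n) - tors x n)) \<longlonglongrightarrow> 0"
      using tendsto_add[OF lim1 exp_phi_tors_lim[OF x]] by simp
    show "eventually (\<lambda>n. real q ^ Suc n * N (d n) \<le> N (- (mconst (\<theta> ^ Suc n) * fps_nth h n) - x) +
             real q ^ Suc n * N (exp_phi (tors x n) - tors x n)) sequentially"
    proof (intro always_eventually allI)
      fix n
      let ?c = "mconst (\<theta> ^ Suc n)"
      \<comment> \<open>Both brackets are errors of approximations to \<open>x\<close>, one from
        \<open>exp\<close> near 0 and one from the partial sums of the evaluation; \<open>x\<close>
        cancels and each bracket tends to 0.\<close>
      have "?c * d n = ?c * (exp_phi (tors x n) - tors x n) - (- (?c * fps_nth h n) - x)"
        using theta_power_tors[of n x] by (simp add: d_def algebra_simps)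
      moreover have "N (?c * (exp_phi (tors x n) - tors x n) - (- (?c * fps_nth h n) - x))
          \<le> N (- (?c * fps_nth h n) - x) + N (?c * (exp_phi (tors x n) - tors x n))"
        unfolding add.commute[of "N (- (?c * fps_nth h n) - x)"]
        by (intro N_diff_le_sum T_mult T_diff T_minus exp_phi_T tors_T x h_T T_mconst)
      moreover have "N (?c * d n) = real q ^ Suc n * N (d n)"
        using N_mconst_mult[OF d_T, of "\<theta> ^ Suc n" n] by (simp only: nv_power nv_theta)
      moreover have "N (?c * (exp_phi (tors x n) - tors x n)) = real q ^ Suc n * N (exp_phi (tors x n) - tors x n)"
        using N_mconst_mult[of "exp_phi (tors x n) - tors x n" "\<theta> ^ Suc n"] x
        by (simp only: nv_power nv_theta T_diff exp_phi_T tors_T)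
      ultimately show "real q ^ Suc n * N (d n) \<le> N (- (?c * fps_nth h n) - x) +
             real q ^ Suc n * N (exp_phi (tors x n) - tors x n)" by simp
    qed
  qed (simp add: d_T)
  have "d n = 0" for n
    by (rule compatible_system_0[of d]) (use d_T phi_d lim in auto)
  thus "fps_nth (agf G) n = - exp_phi (tors (ev (G 0)) n)" for n
    using eq_neg_iff_add_eq_0 by (auto simp: d_def h_def x_def)
  show "exp_phi (ev (G 0)) = 0"
    using phi_d[of 0] \<open>\<And>n. d n = 0\<close> by (simp add: x_def)
qed

text \<open>The value fixes \<open>agf\<close>, and \<open>agf\<close> fixes every entry through
  \<open>V_twisted\<close> because twists are invertible.\<close>

lemma V_inj:
  assumes "G \<in> V" "H \<in> V" "ev (G 0) = ev (H 0)"
  shows "G = H"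
proof
  fix j
  have "agf G = agf H"
    by (rule fps_ext) (simp add: V_agf_eq assms)
  show "G j = H j"
  proof (cases "j < r")
    case True
    hence "zt (int j) (G j) = zt (int j) (H j)"
      by (simp add: V_twisted assms(1,2) \<open>agf G = agf H\<close>)
    hence "zt (- int j) (zt (int j) (G j)) = zt (- int j) (zt (int j) (H j))" by simp
    thus ?thesis by (simp add: zt_zt)
  qed (use assms in \<open>simp add: V_def\<close>)
qed

lemma V_surj:
  assumes "x \<in> Lam"
  obtains G where "G \<in> V" "ev (G 0) = x"
proof -
  have x: "x \<in> T" "exp_phi x = 0" using assms by (auto simp: Lam_def)
  define h where "h = Abs_fps (\<lambda>n. - exp_phi (tors x n))"
  have h_nth: "fps_nth h n = - exp_phi (tors x n)" for n by (simp add: h_def)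
  have h_T: "fps_nth h n \<in> T" for n by (simp add: h_nth T_minus tors_T x)
  have "phi (fps_nth h i) = (if i = 0 then 0 else fps_nth h (i - 1))" for i
    by (simp add: h_nth phi_minus phi_exp_phi_tors x)
  hence func: "(fps_X - fps_const (mconst \<theta>)) * h = (\<Sum>k\<in>{1..r}. fps_const (A k) * zt (int k) h)"
    using functional_iff_phi by blast
  define e where "e = (\<lambda>n. real q ^ Suc n * N (exp_phi (tors x n) - tors x n))"
  have "Bseq e"
    using exp_phi_tors_lim[OF x(1)] unfolding e_def by (intro convergent_imp_Bseq convergentI)
  then obtain C0 where "\<forall>n. norm (e n) \<le> C0" by (rule BseqE)
  hence C0: "e n \<le> C0" for n by (simp add: abs_le_iff)
  \<comment> \<open>No more than boundedness can be expected:
    \<open>q ^ (n + 1) * N (fps_nth h n)\<close> tends to \<open>N x\<close>.\<close>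
  have bound: "real q ^ n * N (fps_nth h n) \<le> C0 + N x" for n
  proof -
    have "N (tors x n + (exp_phi (tors x n) - tors x n)) \<le> N (exp_phi (tors x n) - tors x n) + N (tors x n)"
      unfolding add.commute[of "N (exp_phi (tors x n) - tors x n)"]
      by (intro N_add_le_sum T_diff exp_phi_T tors_T x)
    hence "real q ^ Suc n * N (exp_phi (tors x n)) \<le> real q ^ Suc n * (N (exp_phi (tors x n) - tors x n) + N (tors x n))"
      by (intro mult_left_mono) auto
    also have "\<dots> = real q ^ Suc n * N (exp_phi (tors x n) - tors x n) + N x"
      using x by (simp add: distrib_left N_tors del: power_Suc)
    finally have "real q ^ Suc n * N (exp_phi (tors x n)) \<le> C0 + N x" using C0[of n] unfolding e_def by linarith
    moreover have "real q ^ n * N (exp_phi (tors x n)) \<le> real q ^ Suc n * N (exp_phi (tors x n))"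
      using q_ge_2 x by (intro mult_right_mono power_increasing) (auto simp: tors_T)
    ultimately show ?thesis unfolding h_nth N_minus by linarith
  qed
  \<comment> \<open>\<open>V_twisted\<close> together with the functional equation forces the twist
    of \<open>G j\<close> by \<open>j\<close> to be the remaining part \<open>k > j\<close> of the
    sum; this is that part twisted back. All twists of \<open>h\<close> that occur are positive, as
    \<open>TZ_twist\<close> requires.\<close>
  define G where "G = (\<lambda>j. if j < r then \<Sum>k\<in>{j+1..r}. fps_const (tw (- int j) (A k)) * zt (int (k - j)) h else 0)"
  have G_TZ: "G j \<in> TZ" for j
  proof -
    have "fps_const (tw (- int j) (A k)) * zt (int (k - j)) h \<in> TZ" if "k \<in> {j+1..r}" for k
      by (intro TZ_mult TZ_const T_tw A_T TZ_twist[OF h_T bound]) (use that in auto)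
    thus ?thesis by (auto simp: G_def intro!: TZ_sum)
  qed
  have agf: "agf G = h"
  proof -
    have "{r - 1 + 1..r} = {r}" "int (r - (r - 1)) = 1" "- int (r - 1) = 1 - int r" using r_pos by auto
    hence "agf G = fps_const (tw (- int r) (A r * B)) * h"
      using r_pos by (simp add: agf_def G_def zt_mult zt_const zt_zt u_def tw_tw tw_mult mult_ac flip: fps_const_mult)
    thus ?thesis by (simp add: A_B)
  qed
  have G0: "G 0 = (fps_X - fps_const (mconst \<theta>)) * agf G"
    unfolding agf func using r_pos by (simp add: G_def)
  have "G j = zt (-1) (G (j - 1)) - fps_const (tw (- int j) (A j)) * agf G" if j: "1 \<le> j" "j < r" for j
  proof -
    have "zt (-1) (G (j - 1)) = (\<Sum>k\<in>{j..r}. fps_const (tw (- int j) (A k)) * zt (int (k - j)) h)"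
    proof -
      have "zt (-1) (fps_const (tw (- int (j - 1)) (A k)) * zt (int (k - (j - 1))) h)
          = fps_const (tw (- int j) (A k)) * zt (int (k - j)) h" if "k \<in> {j..r}" for k
        using j that by (simp add: zt_mult zt_const tw_tw zt_zt of_nat_diff)
      thus ?thesis using j by (simp add: G_def zt_sum)
    qed
    also have "\<dots> = fps_const (tw (- int j) (A j)) * h + G j"
      using j by (simp add: sum.atLeast_Suc_atMost G_def)
    finally show ?thesis by (simp add: agf)
  qed
  hence "G \<in> V"
    unfolding V_def mem_Collect_eq Phi_eqs_iff using G_TZ G0 by (intro conjI) (blast, simp add: G_def, blast+)
  moreover have "ev (G 0) = x"
  proof (rule tends_unique)
    show "tends (\<lambda>n. - (mconst (\<theta> ^ Suc n) * fps_nth h n)) (ev (G 0))"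
      using ev_agf_tends[of h] G_TZ[of 0] G0 by (simp only: agf)
    have "N (- (mconst (\<theta> ^ Suc n) * fps_nth h n) - x) = real q ^ Suc n * N (exp_phi (tors x n) - tors x n)" for n
    proof -
      have "- (mconst (\<theta> ^ Suc n) * fps_nth h n) - x = mconst (\<theta> ^ Suc n) * (exp_phi (tors x n) - tors x n)"
        using theta_power_tors[of n x] by (simp add: h_nth right_diff_distrib del: power_Suc)
      thus ?thesis using N_mconst_mult[of "exp_phi (tors x n) - tors x n" "\<theta> ^ Suc n"] x
        by (simp only: nv_power nv_theta T_diff exp_phi_T tors_T)
    qed
    thus "tends (\<lambda>n. - (mconst (\<theta> ^ Suc n) * fps_nth h n)) x"
      unfolding tends_def using exp_phi_tors_lim[OF x(1)] by simp
  qed (auto intro!: T_minus T_mult h_T ev_T G_TZ x)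
  ultimately show thesis by (rule that)
qed

lemma ev_bij: "bij_betw (\<lambda>G. ev (G 0)) V Lam"
  unfolding bij_betw_def
proof
  show "inj_on (\<lambda>G. ev (G 0)) V" by (rule inj_onI) (rule V_inj)
  show "(\<lambda>G. ev (G 0)) ` V = Lam"
  proof
    show "(\<lambda>G. ev (G 0)) ` V \<subseteq> Lam"
      using V_agf_eq(2) r_pos by (auto simp: Lam_def V_def)
    show "Lam \<subseteq> (\<lambda>G. ev (G 0)) ` V"
    proof
      fix x assume "x \<in> Lam"
      then obtain G where "G \<in> V" "ev (G 0) = x" by (rule V_surj)
      thus "x \<in> (\<lambda>G. ev (G 0)) ` V" by blast
    qed
  qed
qed

end

section \<open>Freeness\<close>

context c_infinity
begin

section \<open>Frobenius-fixed series as polynomials over the finite field\<close>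

definition FZ :: "'k mps fps set" where
  "FZ = {c \<in> TZ. zt (-1) c = c}"

definition AT :: "'k mps set" where
  "AT = {a. mcoeff a \<in> A_ts q s \<theta>}"

lemma twist_fixed_iff: "twist q (-1) x = x \<longleftrightarrow> (x::'k) \<in> Fq q"
proof
  assume "twist q (-1) x = x"
  thus "x \<in> Fq q" using twist_power[of 1 "-1" x] by (simp add: Fq_def)
next
  assume "x \<in> Fq q"
  thus "twist q (-1) x = x" by (intro twist_eqI[of 1]) (simp_all add: Fq_def)
qed

lemma Fq_0 [simp]: "(0::'k) \<in> Fq q"
  by (simp add: Fq_def)

text \<open>This discreteness is what turns convergence conditions on fixed series into finiteness,
  both in \<open>z\<close> and in the variables t.\<close>

lemma nv_Fq:
  assumes "x \<in> Fq q" "x \<noteq> 0"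
  shows "nv x = 1"
proof (rule ccontr)
  assume ne: "nv x \<noteq> 1"
  have eq: "nv x ^ q = nv x" using assms(1) by (simp add: Fq_def flip: nv_power)
  have pos: "nv x > 0" using assms(2) by (simp add: less_le)
  have "1 < q" using q_ge_2 by simp
  show False
  proof (cases "nv x < 1")
    case True
    have "nv x ^ q < nv x ^ 1" by (rule power_strict_decreasing) (use \<open>1 < q\<close> pos True in auto)
    thus False using eq by simp
  next
    case False
    have "nv x ^ 1 < nv x ^ q" by (rule power_strict_increasing) (use \<open>1 < q\<close> ne False in auto)
    thus False using eq by simp
  qed
qed

lemma FZ_TZ: "c \<in> FZ \<Longrightarrow> c \<in> TZ"
  by (simp add: FZ_def)

lemma FZ_Fq:
  assumes "c \<in> FZ"
  shows "mcoeff (fps_nth c i) m \<in> Fq q"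
proof -
  have "twist q (-1) (mcoeff (fps_nth c i) m) = mcoeff (fps_nth (zt (-1) c) i) m" by simp
  also have "zt (-1) c = c" using assms by (simp add: FZ_def)
  finally show ?thesis by (simp add: twist_fixed_iff)
qed

text \<open>All coefficients lie in \<open>F_q\<close>, so one of norm below 1 is 0, and the
  convergence condition leaves only finitely many others.\<close>

lemma FZ_bounded:
  assumes "c \<in> FZ"
  obtains n where "\<And>i. i \<ge> n \<Longrightarrow> fps_nth c i = 0"
proof -
  have T: "fps_nth c i \<in> T" for i using assms by (simp add: FZ_TZ TZ_nth)
  have "eventually (\<lambda>i. real q ^ i * N (fps_nth c i) < 1) sequentially"
    using TZ_lim[OF FZ_TZ[OF assms]] by (rule order_tendstoD) simp
  then obtain n where n: "\<And>i. i \<ge> n \<Longrightarrow> real q ^ i * N (fps_nth c i) < 1"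
    unfolding eventually_sequentially by blast
  have "fps_nth c i = 0" if "i \<ge> n" for i
  proof (rule mps_eqI)
    fix m
    have "1 * N (fps_nth c i) \<le> real q ^ i * N (fps_nth c i)"
      using T q_ge_2 by (intro mult_right_mono one_le_power) auto
    hence "nv (mcoeff (fps_nth c i) m) < 1"
      using n[OF that] nv_mcoeff_le_N[OF T, of i m] by linarith
    thus "mcoeff (fps_nth c i) m = mcoeff 0 m"
      using nv_Fq[OF FZ_Fq[OF assms], of i m] by fastforce
  qed
  thus thesis by (rule that)
qed

lemma ev_FZ_mult:
  assumes "c \<in> FZ" "g \<in> TZ"
  shows "ev (c * g) = ev c * ev g"
proof -
  obtain n where "\<And>i. i \<ge> n \<Longrightarrow> fps_nth c i = 0" using FZ_bounded[OF assms(1)] by blast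
  thus ?thesis using assms by (intro ev_finite_mult) (auto simp: FZ_TZ TZ_nth)
qed

lemma ev_FZ:
  assumes c: "c \<in> FZ"
  shows "ev c \<in> AT"
proof -
  obtain n where n: "\<And>i. i \<ge> n \<Longrightarrow> fps_nth c i = 0" using FZ_bounded[OF c] by blast
  have T: "fps_nth c i \<in> T" for i using c by (simp add: FZ_TZ TZ_nth)
  have ev: "mcoeff (ev c) m = (\<Sum>i<n. \<theta> ^ i * mcoeff (fps_nth c i) m)" for m
    using ev_finite[OF T n] by (simp add: mcoeff_sum)
  have fin: "finite {m. mcoeff (fps_nth c i) m \<noteq> 0}" for i
  proof (rule finite_subset)
    show "{m. mcoeff (fps_nth c i) m \<noteq> 0} \<subseteq> {m. 1 \<le> nv (mcoeff (fps_nth c i) m)}"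
      using nv_Fq[OF FZ_Fq[OF c]] by fastforce
    show "finite {m. 1 \<le> nv (mcoeff (fps_nth c i) m)}" using T[of i] by (simp add: T_iff)
  qed
  show ?thesis
    unfolding AT_def A_ts_def mem_Collect_eq
  proof (intro conjI allI impI)
    fix m assume "\<not> valid_mi s m"
    thus "mcoeff (ev c) m = 0" using T by (auto simp: ev T_iff intro!: sum.neutral)
  next
    have "{m. mcoeff (ev c) m \<noteq> 0} \<subseteq> (\<Union>i<n. {m. mcoeff (fps_nth c i) m \<noteq> 0})"
      unfolding ev by (auto intro: ccontr elim!: sum.not_neutral_contains_not_neutral)
    thus "finite {m. mcoeff (ev c) m \<noteq> 0}"
      by (rule finite_subset) (use fin in auto)
  next
    fix m
    let ?P = "\<Sum>i<n. monom (mcoeff (fps_nth c i) m) i"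
    have "coeff ?P k = (if k < n then mcoeff (fps_nth c k) m else 0)" for k
      by (simp add: coeff_sum)
    hence "\<forall>k. coeff ?P k \<in> Fq q" using FZ_Fq[OF c] by simp
    moreover have "mcoeff (ev c) m = poly ?P \<theta>"
      by (simp add: ev poly_sum poly_monom mult.commute)
    ultimately show "\<exists>P. (\<forall>i. coeff P i \<in> Fq q) \<and> mcoeff (ev c) m = poly P \<theta>" by blast
  qed
qed

lemma AT_lift:
  assumes "a \<in> AT"
  obtains c where "c \<in> FZ" "ev c = a"
proof -
  let ?S = "{m. mcoeff a m \<noteq> 0}"
  have a: "\<And>m. \<not> valid_mi s m \<Longrightarrow> mcoeff a m = 0" "finite ?S"
    "\<And>m. \<exists>P. (\<forall>i. coeff P i \<in> Fq q) \<and> mcoeff a m = poly P \<theta>"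
    using assms by (auto simp: AT_def A_ts_def)
  \<comment> \<open>\<open>A_ts\<close> offers a polynomial for each \<open>m\<close> separately.
    Taking 0 wherever the coefficient vanishes leaves finitely many nonzero choices, which bounds
    the degree in \<open>z\<close> and keeps each coefficient of the lift finite in t.\<close>
  have "\<exists>P. (\<forall>i. coeff P i \<in> Fq q) \<and> mcoeff a m = poly P \<theta> \<and> (mcoeff a m = 0 \<longrightarrow> P = 0)" for m
  proof (cases "mcoeff a m = 0")
    case True
    thus ?thesis by (intro exI[of _ 0]) simp
  qed (use a(3)[of m] in blast)
  then obtain P where P: "\<And>m i. coeff (P m) i \<in> Fq q" "\<And>m. mcoeff a m = poly (P m) \<theta>"
    "\<And>m. mcoeff a m = 0 \<Longrightarrow> P m = 0"
    by metis
  define n where "n = Suc (Max (insert 0 (degree ` P ` ?S)))"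
  have n: "coeff (P m) i = 0" if "i \<ge> n" for m i
  proof (cases "m \<in> ?S")
    case True
    hence "degree (P m) < n" unfolding n_def less_Suc_eq_le using a(2) by (intro Max_ge) auto
    thus ?thesis using that by (intro coeff_eq_0) simp
  qed (use P(3) in auto)
  have tate: "(\<lambda>m. coeff (P m) i) \<in> tate s nv" for i
    unfolding tate_def mem_Collect_eq
  proof (intro conjI allI impI)
    fix m assume "\<not> valid_mi s m"
    thus "coeff (P m) i = 0" using a(1) P(3) by simp
  next
    fix e :: real assume "e > 0"
    hence "{m. e \<le> nv (coeff (P m) i)} \<subseteq> ?S" using P(3) by force
    thus "finite {m. e \<le> nv (coeff (P m) i)}" by (rule finite_subset) (rule a(2))
  qed
  define c where "c = Abs_fps (\<lambda>i. Mps (\<lambda>m. coeff (P m) i))"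
  have c_T: "fps_nth c i \<in> T" and c_nth: "mcoeff (fps_nth c i) m = coeff (P m) i" for i m
  proof -
    obtain F where "F \<in> T" "mcoeff F = (\<lambda>m. coeff (P m) i)" using tate_mcoeff_obtain[OF tate] by blast
    moreover from this have "fps_nth c i = F" using mcoeff_inverse[of F] by (simp add: c_def)
    ultimately show "fps_nth c i \<in> T" "mcoeff (fps_nth c i) m = coeff (P m) i" by simp_all
  qed
  have c0: "fps_nth c i = 0" if "i \<ge> n" for i
    by (rule mps_eqI) (simp add: c_nth n that)
  have "zt (-1) c = c"
    by (rule fps_ext, rule mps_eqI) (simp add: c_nth twist_fixed_iff P(1))
  hence "c \<in> FZ" using TZ_eventually_0[of c n] c_T c0 by (simp add: FZ_def)
  moreover have "ev c = a"
  proof (rule mps_eqI)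
    fix m
    have "ev c = (\<Sum>i<n. mconst (\<theta> ^ i) * fps_nth c i)" by (rule ev_finite[OF c_T c0])
    hence "mcoeff (ev c) m = (\<Sum>i<n. \<theta> ^ i * coeff (P m) i)" by (simp add: mcoeff_sum c_nth)
    also have "\<dots> = (\<Sum>i<n. coeff (P m) i * \<theta> ^ i)" by (simp add: mult.commute)
    also have "\<dots> = (\<Sum>i\<le>degree (P m). coeff (P m) i * \<theta> ^ i)"
    proof (cases "degree (P m) < n")
      case True
      thus ?thesis by (intro sum.mono_neutral_right) (auto simp: coeff_eq_0)
    next
      case False
      thus ?thesis by (intro sum.mono_neutral_left) (auto simp: n)
    qed
    also have "\<dots> = mcoeff a m" by (simp add: P(2) poly_altdef)
    finally show "mcoeff (ev c) m = mcoeff a m" .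
  qed
  ultimately show thesis by (rule that)
qed

lemma FZ_0 [simp]: "0 \<in> FZ" and FZ_1 [simp]: "1 \<in> FZ"
  by (simp_all add: FZ_def)

end

section \<open>Coordinates with respect to the trivialization\<close>

lemma vec_mult_assoc:
  fixes x :: "nat \<Rightarrow> 'a::comm_semiring_0"
  shows "(\<Sum>k<r. (\<Sum>l<r. x l * Y l k) * z k) = (\<Sum>l<r. x l * (\<Sum>k<r. Y l k * z k))"
  by (simp add: sum_distrib_left sum_distrib_right mult.assoc) (rule sum.swap)

locale rigid_trivialization = drinfeld q s \<theta> nv r A B
  for q s :: nat and \<theta> :: "'k::field" and nv :: "'k \<Rightarrow> real" and r A B +
  fixes \<Psi> \<Upsilon> :: "nat \<Rightarrow> nat \<Rightarrow> 'k mps fps"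
  assumes Psi_TZ: "\<And>i j. i < r \<Longrightarrow> j < r \<Longrightarrow> \<Psi> i j \<in> TZ"
    and Ups_TZ: "\<And>i j. i < r \<Longrightarrow> j < r \<Longrightarrow> \<Upsilon> i j \<in> TZ"
    and Psi_Ups: "\<And>i j. i < r \<Longrightarrow> j < r \<Longrightarrow> (\<Sum>k<r. \<Psi> i k * \<Upsilon> k j) = (if i = j then 1 else 0)"
    and Ups_Psi: "\<And>i j. i < r \<Longrightarrow> j < r \<Longrightarrow> (\<Sum>k<r. \<Upsilon> i k * \<Psi> k j) = (if i = j then 1 else 0)"
    and Psi_tw: "\<And>i j. i < r \<Longrightarrow> j < r \<Longrightarrow> zt (-1) (\<Psi> i j) = (\<Sum>k<r. Phi i k * \<Psi> k j)"
begin

text \<open>Twisting \<open>\<Upsilon> \<Psi> = 1\<close> and inserting the equation of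
  \<open>\<Psi>\<close> shows that the twist of \<open>\<Upsilon>\<close> times \<open>Phi\<close>
  is again a left inverse of \<open>\<Psi>\<close>, hence equal to \<open>\<Upsilon>\<close>. So the
  rows of the inverse matrix lie in \<open>V\<close>, and their images under \<open>D_0\<close> form
  the basis.\<close>

lemma Ups_tw:
  assumes "i < r" "j < r"
  shows "(\<Sum>k<r. zt (-1) (\<Upsilon> i k) * Phi k j) = \<Upsilon> i j"
proof -
  define Y where "Y = (\<lambda>l. \<Sum>k<r. zt (-1) (\<Upsilon> i k) * Phi k l)"
  have Y: "(\<Sum>l<r. Y l * \<Psi> l m) = (if i = m then 1 else 0)" if "m < r" for m
  proof -
    have "(\<Sum>l<r. Y l * \<Psi> l m) = (\<Sum>k<r. zt (-1) (\<Upsilon> i k) * (\<Sum>l<r. Phi k l * \<Psi> l m))"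
      unfolding Y_def by (rule vec_mult_assoc)
    also have "\<dots> = zt (-1) (\<Sum>k<r. \<Upsilon> i k * \<Psi> k m)"
      unfolding zt_sum zt_mult using that by (intro sum.cong) (simp_all add: Psi_tw)
    also have "\<dots> = (if i = m then 1 else 0)" using that assms by (simp add: Ups_Psi)
    finally show ?thesis .
  qed
  have "\<Upsilon> i j = (\<Sum>m<r. (if i = m then 1 else 0) * \<Upsilon> m j)"
    using assms by (simp add: if_distrib if_distribR cong: if_cong)
  also have "\<dots> = (\<Sum>m<r. (\<Sum>l<r. Y l * \<Psi> l m) * \<Upsilon> m j)"
    by (intro sum.cong) (simp_all add: Y)
  also have "\<dots> = (\<Sum>l<r. Y l * (\<Sum>m<r. \<Psi> l m * \<Upsilon> m j))" by (rule vec_mult_assoc)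
  also have "\<dots> = (\<Sum>l<r. Y l * (if l = j then 1 else 0))"
    using assms by (intro sum.cong) (simp_all add: Psi_Ups)
  also have "\<dots> = Y j" using assms by (simp add: if_distrib cong: if_cong)
  finally show ?thesis by (simp add: Y_def)
qed

definition comb :: "(nat \<Rightarrow> 'k mps fps) \<Rightarrow> nat \<Rightarrow> 'k mps fps" where
  "comb c = (\<lambda>j. if j < r then \<Sum>i<r. c i * \<Upsilon> i j else 0)"

definition basis :: "nat \<Rightarrow> 'k mps" where
  "basis i = ev (\<Upsilon> i 0)"

lemma comb_V:
  assumes c: "\<And>i. i < r \<Longrightarrow> c i \<in> FZ"
  shows "comb c \<in> V"
  unfolding V_def mem_Collect_eq
proof (intro conjI allI impI)
  fix j assume j: "j < r"
  show "comb c j \<in> TZ"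
    using j c Ups_TZ by (auto simp: comb_def FZ_TZ intro!: TZ_sum TZ_mult)
  have "zt (-1) (c i) = c i" if "i < r" for i using c[OF that] by (simp add: FZ_def)
  hence "(\<Sum>k<r. zt (-1) (comb c k) * Phi k j) = (\<Sum>k<r. (\<Sum>i<r. c i * zt (-1) (\<Upsilon> i k)) * Phi k j)"
    by (intro sum.cong) (simp_all add: comb_def zt_sum zt_mult)
  also have "\<dots> = (\<Sum>i<r. c i * (\<Sum>k<r. zt (-1) (\<Upsilon> i k) * Phi k j))" by (rule vec_mult_assoc)
  also have "\<dots> = comb c j" using j by (simp add: Ups_tw comb_def)
  finally show "(\<Sum>k<r. zt (-1) (comb c k) * Phi k j) = comb c j" .
qed (simp add: comb_def)

lemma comb_Psi:
  assumes "j < r"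
  shows "(\<Sum>k<r. comb c k * \<Psi> k j) = c j"
proof -
  have "(\<Sum>k<r. comb c k * \<Psi> k j) = (\<Sum>k<r. (\<Sum>i<r. c i * \<Upsilon> i k) * \<Psi> k j)"
    by (intro sum.cong) (simp_all add: comb_def)
  also have "\<dots> = (\<Sum>i<r. c i * (\<Sum>k<r. \<Upsilon> i k * \<Psi> k j))" by (rule vec_mult_assoc)
  also have "\<dots> = (\<Sum>i<r. c i * (if i = j then 1 else 0))"
    using assms by (intro sum.cong) (simp_all add: Ups_Psi)
  also have "\<dots> = c j" using assms by (simp add: if_distrib cong: if_cong)
  finally show ?thesis .
qed

lemma V_comb:
  assumes G: "G \<in> V"
  obtains c where "\<And>i. i < r \<Longrightarrow> c i \<in> FZ" "G = comb c"
proof -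
  have G_TZ: "\<And>j. j < r \<Longrightarrow> G j \<in> TZ" and G_0: "\<And>j. j \<ge> r \<Longrightarrow> G j = 0"
    and G_tw: "\<And>j. j < r \<Longrightarrow> (\<Sum>k<r. zt (-1) (G k) * Phi k j) = G j"
    using G by (auto simp: V_def)
  define c where "c = (\<lambda>j. \<Sum>k<r. G k * \<Psi> k j)"
  have "c j \<in> FZ" if j: "j < r" for j
  proof -
    \<comment> \<open>\<open>g \<Psi>\<close> is fixed: the equation of \<open>\<Psi>\<close>
      produces a factor \<open>Phi\<close> that the equation of \<open>g\<close> absorbs.\<close>
    have "zt (-1) (c j) = (\<Sum>k<r. zt (-1) (G k) * (\<Sum>l<r. Phi k l * \<Psi> l j))"
      using j by (simp add: c_def zt_sum zt_mult Psi_tw)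
    also have "\<dots> = (\<Sum>l<r. (\<Sum>k<r. zt (-1) (G k) * Phi k l) * \<Psi> l j)"
      by (rule vec_mult_assoc[symmetric])
    also have "\<dots> = c j" by (simp add: G_tw c_def)
    finally have "zt (-1) (c j) = c j" .
    moreover have "c j \<in> TZ"
      unfolding c_def using j by (intro TZ_sum TZ_mult G_TZ Psi_TZ) auto
    ultimately show ?thesis by (simp add: FZ_def)
  qed
  moreover have "G = comb c"
  proof
    fix j
    show "G j = comb c j"
    proof (cases "j < r")
      case True
      hence "comb c j = (\<Sum>i<r. (\<Sum>k<r. G k * \<Psi> k i) * \<Upsilon> i j)" by (simp add: comb_def c_def)
      also have "\<dots> = (\<Sum>k<r. G k * (\<Sum>i<r. \<Psi> k i * \<Upsilon> i j))" by (rule vec_mult_assoc)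
      also have "\<dots> = (\<Sum>k<r. G k * (if k = j then 1 else 0))"
        using True by (intro sum.cong) (simp_all add: Psi_Ups)
      also have "\<dots> = G j" using True by (simp add: if_distrib cong: if_cong)
      finally show ?thesis ..
    qed (simp add: comb_def G_0)
  qed
  ultimately show thesis by (rule that)
qed

lemma ev_comb:
  assumes "\<And>i. i < r \<Longrightarrow> c i \<in> FZ"
  shows "ev (comb c 0) = (\<Sum>i<r. ev (c i) * basis i)"
proof -
  have r0: "0 < r" using r_pos by simp
  hence "comb c 0 = (\<Sum>i<r. c i * \<Upsilon> i 0)" by (simp add: comb_def)
  hence "ev (comb c 0) = ev (\<Sum>i<r. c i * \<Upsilon> i 0)" by simp
  also have "\<dots> = (\<Sum>i<r. ev (c i * \<Upsilon> i 0))"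
    by (rule ev_sum) (use assms Ups_TZ r0 in \<open>simp add: TZ_mult FZ_TZ\<close>)
  finally show ?thesis using assms Ups_TZ r0 by (simp add: ev_FZ_mult basis_def)
qed

lemma ev_V_Lam: "G \<in> V \<Longrightarrow> ev (G 0) \<in> Lam"
  using ev_bij by (auto simp: bij_betw_def)

lemma AT_lift_vec:
  assumes "\<And>i. i < r \<Longrightarrow> a i \<in> AT"
  obtains c where "\<And>i. i < r \<Longrightarrow> c i \<in> FZ" "\<And>i. i < r \<Longrightarrow> ev (c i) = a i"
proof -
  have "\<forall>i\<in>{..<r}. \<exists>c. c \<in> FZ \<and> ev c = a i"
  proof
    fix i assume "i \<in> {..<r}"
    hence "a i \<in> AT" using assms by simp
    then obtain c where "c \<in> FZ" "ev c = a i" by (rule AT_lift)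
    thus "\<exists>c. c \<in> FZ \<and> ev c = a i" by blast
  qed
  from bchoice[OF this] obtain c where "\<forall>i\<in>{..<r}. c i \<in> FZ \<and> ev (c i) = a i" by blast
  thus thesis by (intro that[of c]) auto
qed

lemma span_Lam:
  assumes "\<And>i. i < r \<Longrightarrow> a i \<in> AT"
  shows "(\<Sum>i<r. a i * basis i) \<in> Lam"
proof -
  obtain c where c: "\<And>i. i < r \<Longrightarrow> c i \<in> FZ" "\<And>i. i < r \<Longrightarrow> ev (c i) = a i"
    using AT_lift_vec assms by blast
  have "(\<Sum>i<r. a i * basis i) = ev (comb c 0)" using ev_comb[of c] c by simp
  thus ?thesis using ev_V_Lam[OF comb_V[of c]] c by simp
qed

lemma basis_Lam:
  assumes "i < r"
  shows "basis i \<in> Lam"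
proof -
  have "(\<Sum>k<r. (if k = i then 1 else 0) * basis k) \<in> Lam"
    using ev_FZ[OF FZ_1] ev_FZ[OF FZ_0] ev_finite[of 1 1]
    by (intro span_Lam) (auto simp: fps_one_nth)
  also have "(\<Sum>k<r. (if k = i then 1 else 0) * basis k) = (\<Sum>k<r. if k = i then basis k else 0)"
    by (intro sum.cong) auto
  finally show ?thesis using assms by simp
qed

lemma Lam_span:
  assumes "x \<in> Lam"
  obtains a where "\<And>i. i < r \<Longrightarrow> a i \<in> AT" "x = (\<Sum>i<r. a i * basis i)"
proof -
  obtain G where G: "G \<in> V" "ev (G 0) = x" using V_surj[OF assms] by blast
  obtain c where c: "\<And>i. i < r \<Longrightarrow> c i \<in> FZ" "G = comb c" using V_comb[OF G(1)] by blast
  show thesis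
    by (rule that[of "\<lambda>i. ev (c i)"]) (use c G ev_FZ ev_comb in auto)
qed

text \<open>Arbitrary lifts of the coefficients to \<open>FZ\<close> suffice: equal values give
  equal vectors in \<open>V\<close>, multiplication by \<open>\<Psi>\<close> recovers the
  coordinates, and evaluation returns to the coefficients.\<close>

lemma basis_indep:
  assumes "\<And>i. i < r \<Longrightarrow> a i \<in> AT" "\<And>i. i < r \<Longrightarrow> a' i \<in> AT"
    and "(\<Sum>i<r. a i * basis i) = (\<Sum>i<r. a' i * basis i)" "i < r"
  shows "a i = a' i"
proof -
  obtain c where c: "\<And>i. i < r \<Longrightarrow> c i \<in> FZ" "\<And>i. i < r \<Longrightarrow> ev (c i) = a i"
    using AT_lift_vec assms(1) by blast
  obtain c' where c': "\<And>i. i < r \<Longrightarrow> c' i \<in> FZ" "\<And>i. i < r \<Longrightarrow> ev (c' i) = a' i"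
    using AT_lift_vec assms(2) by blast
  have "ev (comb c 0) = ev (comb c' 0)" using assms(3) c c' by (simp add: ev_comb)
  hence "comb c = comb c'" using c c' by (intro V_inj comb_V) auto
  hence "c i = c' i" using comb_Psi[OF assms(4)] by metis
  thus ?thesis using c(2) c'(2) assms(4) by metis
qed

end

section \<open>Transfer to the function-level definitions\<close>

definition zrep :: "'k::field mps fps \<Rightarrow> 'k zs" where
  "zrep g = (\<lambda>i. mcoeff (fps_nth g i))"

lemma zrep_inject: "zrep g = zrep h \<longleftrightarrow> g = h"
  by (auto simp: zrep_def fun_eq_iff fps_eq_iff simp flip: mcoeff_inject)

lemma mcoeff_fun_inject: "(\<lambda>n. mcoeff (x n)) = (\<lambda>n. mcoeff (y n)) \<longleftrightarrow> (\<forall>n. x n = y n)"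
  by (metis mcoeff_inject)

lemma zs_zero_zrep: "zs_zero = zrep 0"
  by (simp add: zs_zero_def zrep_def zero_mps.rep_eq)

lemma zs_const_zrep: "zs_const (mcoeff c) = zrep (fps_const c)"
  by (auto simp: zs_const_def zrep_def fun_eq_iff ts_zero_def)

lemma zs_one_zrep: "zs_one = zrep 1"
  using zs_const_zrep[of 1] by (simp add: zs_one_def one_mps.rep_eq)

lemma zs_mul_zrep: "zs_mul (zrep g) (zrep h) = zrep (g * h)"
  by (simp add: zs_mul_def zrep_def fun_eq_iff fps_mult_nth mcoeff_sum atLeast0AtMost flip: times_mps.rep_eq)

lemma z_minus_theta_zrep: "z_minus_theta \<theta> = zrep (fps_X - fps_const (mconst \<theta>))"
  by (auto simp: z_minus_theta_def zrep_def fun_eq_iff mconst.rep_eq ts_const_def ts_zero_def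
      one_mps.rep_eq fps_X_nth)

lemma vec_mat_zrep:
  assumes "\<And>k. k < r \<Longrightarrow> x k = zrep (y k)" "\<And>k. k < r \<Longrightarrow> M k j = zrep (L k j)"
  shows "vec_mat r x M j = zrep (\<Sum>k<r. y k * L k j)"
  by (simp add: vec_mat_def assms zs_mul_zrep) (simp add: zrep_def fps_sum_nth mcoeff_sum fun_eq_iff)

lemma mat_mul_zrep:
  assumes "\<And>k. k < r \<Longrightarrow> M i k = zrep (K i k)" "\<And>k. k < r \<Longrightarrow> M' k j = zrep (L k j)"
  shows "mat_mul r M M' i j = zrep (\<Sum>k<r. K i k * L k j)"
  using vec_mat_zrep[of r "M i" "K i" M' j L] assms by (simp add: mat_mul_def vec_mat_def)

context c_infinity
begin

lemma zs_tw_zrep: "zs_tw q n (zrep g) = zrep (zt n g)"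
  by (simp add: zs_tw_def zrep_def ts_tw_mcoeff)

lemma zrep_tate_z: "zrep g \<in> tate_z s q nv \<longleftrightarrow> g \<in> TZ"
  by (simp add: tate_z_def TZ_def T_def N_def zrep_def)

lemma tate_z_zrep:
  assumes "g \<in> tate_z s q nv"
  shows "\<exists>G\<in>TZ. g = zrep G"
proof -
  have "\<exists>F. mcoeff F = g i" for i
    using assms tate_mcoeff_obtain[of "g i"] by (auto simp: tate_z_def)
  then obtain F where F: "\<And>i. mcoeff (F i) = g i" by metis
  have "g = zrep (Abs_fps F)" by (simp add: zrep_def F)
  thus ?thesis using assms zrep_tate_z by metis
qed

lemma zs_eval_zrep:
  assumes "g \<in> TZ"
  shows "zs_eval nv \<theta> (zrep g) = mcoeff (ev g)"
  unfolding zs_eval_def zrep_def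
  using ev_pointwise[OF assms] nv_tendsto_unique by (intro ext the_equality) blast+

lemma A_ts_mcoeff:
  assumes "f \<in> A_ts q s \<theta>"
  shows "\<exists>F\<in>AT. f = mcoeff F"
proof
  show "f = mcoeff (Mps f)"
    using assms by (intro Mps_inverse[symmetric]) (use valid_mi_imp_fin_mi in \<open>auto simp: A_ts_def\<close>)
  thus "Mps f \<in> AT" using assms by (simp add: AT_def)
qed

lemma tw_mul_mcoeff:
  "tw_mul q (\<lambda>i. mcoeff (a i)) (\<lambda>i. mcoeff (b i)) = (\<lambda>n. mcoeff (\<Sum>i\<le>n. a i * tw (int i) (b (n - i))))"
  by (simp add: tw_mul_def fun_eq_iff ts_tw_mcoeff mcoeff_sum flip: times_mps.rep_eq)

end

context drinfeld
begin

lemma ts_inv_u: "ts_inv s nv (ts_tw q (- int r) (mcoeff (A r))) = mcoeff u"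
proof -
  let ?a = "tw (- int r) (A r)"
  have inv: "?a * u = 1" by (simp add: u_def A_B flip: tw_mult)
  show ?thesis
    unfolding ts_inv_def ts_tw_mcoeff
  proof (rule the_equality)
    show "mcoeff u \<in> tate s nv \<and> ts_mul (mcoeff ?a) (mcoeff u) = ts_one"
      using u_T inv by (simp add: T_def flip: times_mps.rep_eq one_mps.rep_eq)
    fix g assume g: "g \<in> tate s nv \<and> ts_mul (mcoeff ?a) g = ts_one"
    then obtain G where G: "mcoeff G = g" using tate_mcoeff_obtain by blast
    have "?a * G = 1" using g by (simp add: G times_mps.rep_eq one_mps.rep_eq flip: mcoeff_inject)
    hence "u * (?a * G) = u" by simp
    moreover have "u * (?a * G) = (?a * u) * G" by (simp only: mult_ac)
    ultimately show "g = mcoeff u" by (simp add: inv flip: G)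
  qed
qed

lemma Phi_mat_zrep:
  assumes a: "\<forall>i\<in>{1..r}. a i = mcoeff (A i)" and "j < r"
  shows "Phi_mat q \<theta> nv s r a i j = zrep (Phi i j)"
proof -
  have ar: "a r = mcoeff (A r)" using a r_pos by simp
  have "(\<lambda>m. - ts_tw q (- int j) (a j) m) = mcoeff (- tw (- int j) (A j))" if "j \<noteq> 0"
    using a that assms(2) by (simp add: ts_tw_mcoeff uminus_mps.rep_eq)
  thus ?thesis
    unfolding Phi_mat_def Phi_def Let_def ar ts_inv_u
    by (auto simp: zs_const_zrep zs_one_zrep zs_zero_zrep z_minus_theta_zrep zs_mul_zrep
        simp flip: times_mps.rep_eq)
qed

lemma phi_theta_mcoeff:
  assumes "\<forall>i\<in>{1..r}. a i = mcoeff (A i)"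
  shows "phi_theta \<theta> r a = (\<lambda>i. mcoeff (P i))"
  using assms by (auto simp: phi_theta_def P_def fun_eq_iff mconst.rep_eq ts_zero_def)

text \<open>The definite description has a usable value only after existence and uniqueness are
  known. Every candidate lifts to the ring type, where its equation becomes the recursion that
  determines it from the constant term.\<close>

lemma exp_coeffs_mcoeff:
  assumes "\<forall>i\<in>{1..r}. a i = mcoeff (A i)"
  shows "exp_coeffs q \<theta> nv s r a = (\<lambda>i. mcoeff (exp_coeff i))"
proof -
  define b :: "nat \<Rightarrow> 'k mps" where "b = (\<lambda>i. if i = 0 then mconst \<theta> else 0)"
  have b: "(\<lambda>i. if i = 0 then ts_const \<theta> else ts_zero) = (\<lambda>i. mcoeff (b i))"
    by (auto simp: b_def fun_eq_iff mconst.rep_eq ts_zero_def)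
  \<comment> \<open>Moving \<open>\<theta>\<close> to the left past \<open>\<tau>^n\<close> raises
    it to the power \<open>q ^ n\<close>; only \<open>i = n\<close> contributes.\<close>
  have sum_b: "(\<Sum>i\<le>n. x i * tw (int i) (b (n - i))) = mconst (\<theta> ^ (q ^ n)) * x n" for x n
  proof -
    have "(\<Sum>i\<le>n. x i * tw (int i) (b (n - i))) = (\<Sum>i\<le>n. if i = n then x i * tw (int i) (mconst \<theta>) else 0)"
      by (intro sum.cong) (auto simp: b_def)
    thus ?thesis by (simp add: tw_mconst twist_nat mult.commute)
  qed
  have eq: "tw_mul q (\<lambda>i. mcoeff (x i)) (\<lambda>i. mcoeff (b i)) = tw_mul q (\<lambda>i. mcoeff (P i)) (\<lambda>i. mcoeff (x i))
      \<longleftrightarrow> (\<forall>n. mconst (\<theta> ^ (q ^ n)) * x n = (\<Sum>j\<le>n. P j * tw (int j) (x (n - j))))" for x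
    unfolding tw_mul_mcoeff sum_b mcoeff_fun_inject ..
  show ?thesis
    unfolding exp_coeffs_def phi_theta_mcoeff[OF assms] b
  proof (rule the_equality)
    show "(\<forall>i. mcoeff (exp_coeff i) \<in> tate s nv) \<and> mcoeff (exp_coeff 0) = ts_one \<and>
        tw_mul q (\<lambda>i. mcoeff (exp_coeff i)) (\<lambda>i. mcoeff (b i)) = tw_mul q (\<lambda>i. mcoeff (P i)) (\<lambda>i. mcoeff (exp_coeff i))"
      unfolding eq using exp_coeff_T exp_coeff_rec by (simp add: T_def exp_coeff_0 one_mps.rep_eq)
  next
    fix \<alpha>
    assume \<alpha>: "(\<forall>i. \<alpha> i \<in> tate s nv) \<and> \<alpha> 0 = ts_one \<and>
        tw_mul q \<alpha> (\<lambda>i. mcoeff (b i)) = tw_mul q (\<lambda>i. mcoeff (P i)) \<alpha>"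
    hence "\<exists>F. mcoeff F = \<alpha> i" for i using tate_mcoeff_obtain[of "\<alpha> i"] by blast
    then obtain x where x: "\<And>i. mcoeff (x i) = \<alpha> i" by metis
    hence \<alpha>_eq: "\<alpha> = (\<lambda>i. mcoeff (x i))" by auto
    have "x 0 = 1" using \<alpha> x[of 0] by (simp add: one_mps.rep_eq flip: mcoeff_inject)
    moreover have "\<forall>n. mconst (\<theta> ^ (q ^ n)) * x n = (\<Sum>j\<le>n. P j * tw (int j) (x (n - j)))"
      using \<alpha> unfolding \<alpha>_eq eq by blast
    ultimately have "x = exp_coeff" by (intro exp_coeff_unique) blast+
    thus "\<alpha> = (\<lambda>i. mcoeff (exp_coeff i))" by (simp add: \<alpha>_eq)
  qed
qed

text \<open>\<open>Lambda_phi\<close> speaks of convergence to 0 only. The series always converges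
  to \<open>exp_phi F\<close>, so uniqueness of limits closes the gap.\<close>

lemma Lambda_phi_mcoeff:
  assumes "\<forall>i\<in>{1..r}. a i = mcoeff (A i)"
  shows "Lambda_phi q \<theta> nv s r a = mcoeff ` Lam"
proof -
  have sums: "ts_sums nv (\<lambda>i. ts_mul (mcoeff (exp_coeff i)) (ts_tw q (int i) (mcoeff F))) ts_zero \<longleftrightarrow> exp_phi F = 0"
    if F: "F \<in> T" for F
  proof -
    have S_T: "(\<Sum>i<n. exp_coeff i * tw (int i) F) \<in> T" for n
      by (intro T_sum T_mult T_tw F exp_coeff_T)
    have "ts_sums nv (\<lambda>i. ts_mul (mcoeff (exp_coeff i)) (ts_tw q (int i) (mcoeff F))) ts_zero
        \<longleftrightarrow> tends (\<lambda>n. \<Sum>i<n. exp_coeff i * tw (int i) F) 0"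
      by (subst tends_iff[OF S_T T_0])
         (simp add: ts_sums_def N_def ts_tw_mcoeff ts_zero_def mcoeff_sum[abs_def] flip: times_mps.rep_eq)
    also have "\<dots> \<longleftrightarrow> exp_phi F = 0"
      using exp_phi_tends[OF F] tends_unique[OF exp_phi_tends[OF F] _ S_T exp_phi_T[OF F] T_0] by metis
    finally show ?thesis .
  qed
  show ?thesis
  proof (intro equalityI subsetI)
    fix f assume f: "f \<in> Lambda_phi q \<theta> nv s r a"
    then obtain F where "F \<in> T" "mcoeff F = f"
      using tate_mcoeff_obtain by (auto simp: Lambda_phi_def)
    thus "f \<in> mcoeff ` Lam"
      using f sums[of F] by (auto simp: Lambda_phi_def exp_coeffs_mcoeff[OF assms] Lam_def)
  next
    fix f assume "f \<in> mcoeff ` Lam"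
    thus "f \<in> Lambda_phi q \<theta> nv s r a"
      using sums by (auto simp: Lambda_phi_def exp_coeffs_mcoeff[OF assms] Lam_def T_def)
  qed
qed

lemma V_phi_zrep:
  assumes a: "\<forall>i\<in>{1..r}. a i = mcoeff (A i)"
  shows "V_phi q \<theta> nv s r a = (\<lambda>G j. zrep (G j)) ` V"
proof -
  have vm: "vec_mat r (\<lambda>k. zs_tw q (-1) (g k)) (Phi_mat q \<theta> nv s r a) j = zrep (\<Sum>k<r. zt (-1) (G k) * Phi k j)"
    if "j < r" "\<And>k. k < r \<Longrightarrow> g k = zrep (G k)" for g G j
    by (rule vec_mat_zrep) (simp_all add: that zs_tw_zrep Phi_mat_zrep[OF a])
  show ?thesis
  proof (intro equalityI subsetI)
    fix g assume g: "g \<in> V_phi q \<theta> nv s r a"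
    have "\<exists>G. (j < r \<longrightarrow> G \<in> TZ) \<and> (j \<ge> r \<longrightarrow> G = 0) \<and> g j = zrep G" for j
    proof (cases "j < r")
      case True
      hence "g j \<in> tate_z s q nv" using g by (simp add: V_phi_def)
      thus ?thesis using tate_z_zrep True by fastforce
    next
      case False
      thus ?thesis using g by (intro exI[of _ 0]) (simp add: V_phi_def zs_zero_zrep)
    qed
    then obtain G where G: "\<And>j. j < r \<Longrightarrow> G j \<in> TZ" "\<And>j. j \<ge> r \<Longrightarrow> G j = 0" "\<And>j. g j = zrep (G j)"
      by metis
    have "(\<Sum>k<r. zt (-1) (G k) * Phi k j) = G j" if "j < r" for j
    proof -
      have "zrep (\<Sum>k<r. zt (-1) (G k) * Phi k j) = zrep (G j)"
        using vm[OF that, of g G] g that G(3) by (simp add: V_phi_def)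
      thus ?thesis by (simp add: zrep_inject)
    qed
    hence "G \<in> V" using G by (simp add: V_def)
    moreover have "g = (\<lambda>j. zrep (G j))" using G(3) by auto
    ultimately show "g \<in> (\<lambda>G j. zrep (G j)) ` V" by blast
  next
    fix g assume "g \<in> (\<lambda>G j. zrep (G j)) ` V"
    then obtain G where "G \<in> V" "g = (\<lambda>j. zrep (G j))" by blast
    thus "g \<in> V_phi q \<theta> nv s r a"
      using vm[of _ g G] by (auto simp: V_phi_def V_def zrep_tate_z zs_zero_zrep)
  qed
qed

lemma bij_zs_eval:
  assumes a: "\<forall>i\<in>{1..r}. a i = mcoeff (A i)"
  shows "bij_betw (\<lambda>g. zs_eval nv \<theta> (g 0)) (V_phi q \<theta> nv s r a) (Lambda_phi q \<theta> nv s r a)"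
proof -
  have eval: "zs_eval nv \<theta> (zrep (G 0)) = mcoeff (ev (G 0))" if "G \<in> V" for G
    using that r_pos by (intro zs_eval_zrep) (simp add: V_def)
  have "bij_betw (mcoeff \<circ> (\<lambda>G. ev (G 0))) V (mcoeff ` Lam)"
    by (rule bij_betw_trans[OF ev_bij]) (simp add: bij_betw_def inj_on_def mcoeff_inject)
  hence "bij_betw ((\<lambda>g. zs_eval nv \<theta> (g 0)) \<circ> (\<lambda>G j. zrep (G j))) V (mcoeff ` Lam)"
    by (rule bij_betw_cong[THEN iffD1, rotated]) (simp add: eval)
  \<comment> \<open>\<open>V_phi\<close> is the image of \<open>V\<close>, so a composite that is
    injective on \<open>V\<close> makes the outer map injective on that image.\<close>
  thus ?thesis
    unfolding V_phi_zrep[OF a] Lambda_phi_mcoeff[OF a]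
    by (auto simp: bij_betw_def inj_on_def image_image o_def)
qed

lemma rigid_trivialization_exists:
  assumes a: "\<forall>i\<in>{1..r}. a i = mcoeff (A i)" and "has_rat q \<theta> nv s r a"
  shows "\<exists>\<Psi> \<Upsilon>. rigid_trivialization q s \<theta> nv r A B \<Psi> \<Upsilon>"
proof -
  obtain M L where mats: "\<forall>i<r. \<forall>j<r. M i j \<in> tate_z s q nv" "\<forall>i<r. \<forall>j<r. L i j \<in> tate_z s q nv"
    "mat_eq r (mat_mul r M L) mat_id" "mat_eq r (mat_mul r L M) mat_id"
    "mat_eq r (mat_tw q (-1) M) (mat_mul r (Phi_mat q \<theta> nv s r a) M)"
    using assms(2) unfolding has_rat_def in_GL_def by blast
  have lift: "\<exists>K'. \<forall>i<r. \<forall>j<r. K' i j \<in> TZ \<and> K i j = zrep (K' i j)"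
    if K: "\<forall>i<r. \<forall>j<r. K i j \<in> tate_z s q nv" for K
  proof -
    have "\<exists>G. i < r \<and> j < r \<longrightarrow> G \<in> TZ \<and> K i j = zrep G" for i j
      using K tate_z_zrep[of "K i j"] by blast
    then obtain K' where "\<And>i j. i < r \<and> j < r \<longrightarrow> K' i j \<in> TZ \<and> K i j = zrep (K' i j)" by metis
    thus ?thesis by blast
  qed
  obtain \<Psi> where Psi: "\<And>i j. i < r \<Longrightarrow> j < r \<Longrightarrow> \<Psi> i j \<in> TZ"
    "\<And>i j. i < r \<Longrightarrow> j < r \<Longrightarrow> M i j = zrep (\<Psi> i j)"
    using lift[OF mats(1)] by blast
  obtain \<Upsilon> where Ups: "\<And>i j. i < r \<Longrightarrow> j < r \<Longrightarrow> \<Upsilon> i j \<in> TZ"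
    "\<And>i j. i < r \<Longrightarrow> j < r \<Longrightarrow> L i j = zrep (\<Upsilon> i j)"
    using lift[OF mats(2)] by blast
  have id: "mat_id i j = zrep (if i = j then 1 else 0)" for i j
    by (simp add: mat_id_def zs_one_zrep zs_zero_zrep)
  have "rigid_trivialization q s \<theta> nv r A B \<Psi> \<Upsilon>"
  proof
    fix i j assume ij: "i < r" "j < r"
    show "\<Psi> i j \<in> TZ" "\<Upsilon> i j \<in> TZ" using ij Psi Ups by auto
    have "zrep (\<Sum>k<r. \<Psi> i k * \<Upsilon> k j) = mat_mul r M L i j"
      by (rule mat_mul_zrep[symmetric]) (simp_all add: ij Psi Ups)
    also have "\<dots> = zrep (if i = j then 1 else 0)" using mats(3) ij by (simp add: mat_eq_def id)
    finally show "(\<Sum>k<r. \<Psi> i k * \<Upsilon> k j) = (if i = j then 1 else 0)" unfolding zrep_inject .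
    have "zrep (\<Sum>k<r. \<Upsilon> i k * \<Psi> k j) = mat_mul r L M i j"
      by (rule mat_mul_zrep[symmetric]) (simp_all add: ij Psi Ups)
    also have "\<dots> = zrep (if i = j then 1 else 0)" using mats(4) ij by (simp add: mat_eq_def id)
    finally show "(\<Sum>k<r. \<Upsilon> i k * \<Psi> k j) = (if i = j then 1 else 0)" unfolding zrep_inject .
    have "zrep (zt (-1) (\<Psi> i j)) = mat_tw q (-1) M i j"
      using ij by (simp add: mat_tw_def Psi zs_tw_zrep)
    also have "\<dots> = mat_mul r (Phi_mat q \<theta> nv s r a) M i j" using mats(5) ij by (simp add: mat_eq_def)
    also have "\<dots> = zrep (\<Sum>k<r. Phi i k * \<Psi> k j)"
      by (rule mat_mul_zrep) (simp_all add: ij Psi Phi_mat_zrep[OF a])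
    finally show "zt (-1) (\<Psi> i j) = (\<Sum>k<r. Phi i k * \<Psi> k j)" unfolding zrep_inject .
  qed
  thus ?thesis by blast
qed

end

context rigid_trivialization
begin

lemma free_rank_Lambda: "free_rank q s \<theta> r (mcoeff ` Lam)"
proof -
  define comb_ts where "comb_ts = (\<lambda>a m. \<Sum>i<r. ts_mul (a i) (mcoeff (basis i)) m)"
  have comb_mcoeff: "comb_ts (\<lambda>i. mcoeff (x i)) = mcoeff (\<Sum>i<r. x i * basis i)" for x
    by (simp add: comb_ts_def mcoeff_sum fun_eq_iff flip: times_mps.rep_eq)
  have comb_cong: "comb_ts a = comb_ts a'" if "\<And>i. i < r \<Longrightarrow> a i = a' i" for a a'
    using that by (simp add: comb_ts_def)
  have lift: "\<exists>x. \<forall>i<r. x i \<in> AT \<and> a i = mcoeff (x i)" if a: "\<forall>i<r. a i \<in> A_ts q s \<theta>" for a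
  proof -
    have "\<forall>i\<in>{..<r}. \<exists>F. F \<in> AT \<and> a i = mcoeff F"
      using a A_ts_mcoeff by blast
    from bchoice[OF this] show ?thesis by auto
  qed
  have "\<exists>!a. (\<forall>i<r. a i \<in> A_ts q s \<theta>) \<and> (\<forall>i\<ge>r. a i = ts_zero) \<and> f = comb_ts a"
    if f: "f \<in> mcoeff ` Lam" for f
  proof -
    obtain F where F: "F \<in> Lam" "f = mcoeff F" using f by blast
    obtain x where x: "\<And>i. i < r \<Longrightarrow> x i \<in> AT" "F = (\<Sum>i<r. x i * basis i)"
      using Lam_span[OF F(1)] by blast
    show ?thesis
    proof (intro ex1I conjI allI impI)
      \<comment> \<open>The value 0 beyond \<open>r\<close> is prescribed so that uniqueness can
        hold for functions on all of \<open>nat\<close>.\<close>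
      let ?a = "\<lambda>i. if i < r then mcoeff (x i) else ts_zero"
      show "?a i \<in> A_ts q s \<theta>" if "i < r" for i using x(1)[OF that] that by (simp add: AT_def)
      show "?a i = ts_zero" if "r \<le> i" for i using that by simp
      have "comb_ts ?a = comb_ts (\<lambda>i. mcoeff (x i))" by (rule comb_cong) simp
      thus "f = comb_ts ?a" using F x by (simp add: comb_mcoeff)
      fix a assume a: "(\<forall>i<r. a i \<in> A_ts q s \<theta>) \<and> (\<forall>i\<ge>r. a i = ts_zero) \<and> f = comb_ts a"
      then obtain y where y: "\<And>i. i < r \<Longrightarrow> y i \<in> AT" "\<And>i. i < r \<Longrightarrow> a i = mcoeff (y i)"
        using lift by blast
      have "comb_ts a = comb_ts (\<lambda>i. mcoeff (y i))" by (rule comb_cong) (rule y(2))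
      hence "mcoeff (\<Sum>i<r. y i * basis i) = mcoeff (\<Sum>i<r. x i * basis i)"
        using a F x by (simp add: comb_mcoeff)
      hence "(\<Sum>i<r. y i * basis i) = (\<Sum>i<r. x i * basis i)" by (simp add: mcoeff_inject)
      hence "y i = x i" if "i < r" for i using basis_indep[of y x i] x y that by blast
      thus "a = ?a" using a y by (auto simp: fun_eq_iff)
    qed
  qed
  moreover have "comb_ts a \<in> mcoeff ` Lam" if "\<forall>i<r. a i \<in> A_ts q s \<theta>" for a
  proof -
    obtain x where x: "\<And>i. i < r \<Longrightarrow> x i \<in> AT" "\<And>i. i < r \<Longrightarrow> a i = mcoeff (x i)"
      using lift[OF \<open>\<forall>i<r. a i \<in> A_ts q s \<theta>\<close>] by blast
    have "comb_ts a = comb_ts (\<lambda>i. mcoeff (x i))" by (rule comb_cong) (rule x(2))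
    thus ?thesis using span_Lam[of x] x(1) by (simp add: comb_mcoeff)
  qed
  ultimately show ?thesis
    unfolding free_rank_def
    by (intro exI[of _ "\<lambda>i. mcoeff (basis i)"]) (simp add: basis_Lam comb_ts_def)
qed

end

theorem theorem4p15:
  fixes q s r :: nat and \<theta> :: "'k::field" and nv :: "'k \<Rightarrow> real" and A :: "nat \<Rightarrow> 'k ts"
  assumes "is_C_infinity q \<theta> nv"
    and "1 \<le> r"
    and "\<forall>i\<in>{1..r}. A i \<in> tate s nv"
    and "\<exists>B\<in>tate s nv. ts_mul (A r) B = ts_one"
    and "has_rat q \<theta> nv s r A"
  shows "bij_betw (\<lambda>g. zs_eval nv \<theta> (g 0)) (V_phi q \<theta> nv s r A) (Lambda_phi q \<theta> nv s r A)
         \<and> free_rank q s \<theta> r (Lambda_phi q \<theta> nv s r A)"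
proof -
  interpret c_infinity q s \<theta> nv by unfold_locales (rule assms(1))
  have "\<forall>i\<in>{1..r}. \<exists>F. F \<in> T \<and> A i = mcoeff F"
    using assms(3) tate_mcoeff_obtain by metis
  then obtain A' where A': "\<forall>i\<in>{1..r}. A' i \<in> T" "\<forall>i\<in>{1..r}. A i = mcoeff (A' i)"
    by metis
  obtain B where "B \<in> tate s nv" "ts_mul (A r) B = ts_one" using assms(4) by blast
  then obtain B' where B': "B' \<in> T" "ts_mul (mcoeff (A' r)) (mcoeff B') = ts_one"
    using tate_mcoeff_obtain A'(2) assms(2) by (metis atLeastAtMost_iff order_refl)
  interpret drinfeld q s \<theta> nv r A' B'
  proof
    show "A' r * B' = 1"
      using B'(2) by (simp add: times_mps.rep_eq one_mps.rep_eq flip: mcoeff_inject)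
  qed (use assms(2) A' B' in auto)
  obtain \<Psi> \<Upsilon> where "rigid_trivialization q s \<theta> nv r A' B' \<Psi> \<Upsilon>"
    using rigid_trivialization_exists[OF A'(2) assms(5)] by blast
  then interpret rigid_trivialization q s \<theta> nv r A' B' \<Psi> \<Upsilon> .
  show ?thesis
    using bij_zs_eval[OF A'(2)] free_rank_Lambda Lambda_phi_mcoeff[OF A'(2)] by simp
qed

end
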